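(* For every integer $r\ge 3$, $$\mathcal T_r=\mathcal T(r,r-2)=\{P^{\mathcal M} : \mathcal M \text{ is a multiset of } r-3 \text{ perfect matchings of the Petersen graph } P\},$$ where graphs are considered up to isomorphism.
   Context: All graphs are finite and may have parallel edges but no loops. For $X\subseteq V(G)$, $\partial_G(X)$ is the set of edges of $G$ with exactly one end in $X$. An $r$-regular graph $G$ is an $r$-graph if $|\partial_G(X)|\ge r$ for every $X\subseteq V(G)$ of odd cardinality. A graph is class 1 if its edge-chromatic number equals its maximum degree, and class 2 otherwise. "Smallest" refers to the number of vertices (the order). $\mathcal T_r$ is the set of the smallest $r$-graphs of class 2, i.e. those of minimum order among all $r$-graphs of class 2. For an $r$-graph $G$, $\pi(G)$ is the largest integer $t$ such that $G$ has $t$ pairwise disjoint perfect matchings. $\mathcal T(r,k)$ is the set of all $r$-graphs $G$ with $\pi(G)=k$ that have minimum order among all $r$-graphs with $\pi=k$. $P$ is the Petersen graph. For a finite multiset $\mathcal M$ of perfect matchings of $P$, $P^{\mathcal M}=P+\sum_{M\in\mathcal M}M$ is the graph obtained from $P$ by adding, for every $M\in\mathcal M$ (counted with multiplicity), a new parallel copy of every edge of $M$. *)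

theory Defs
  imports Main "HOL-Library.Multiset"
begin

text \<open>
  Finite loopless multigraphs. Edges are objects of their own, so parallel edges are distinct
  edges with the same set of two ends. The vertex set is required to be nonempty: the graph
  without vertices would otherwise be a vacuous \<open>r\<close>-graph whose only perfect matching is empty.
\<close>

record ('v, 'e) mgraph =
  verts :: "'v set"
  edges :: "'e set"
  ends :: "'e \<Rightarrow> 'v set"

definition multigraph :: "('v, 'e) mgraph \<Rightarrow> bool" where
  "multigraph G \<longleftrightarrow>
     finite (verts G) \<and> verts G \<noteq> {} \<and> finite (edges G) \<and>
     (\<forall>e \<in> edges G. ends G e \<subseteq> verts G \<and> card (ends G e) = 2)"

definition order :: "('v, 'e) mgraph \<Rightarrow> nat" where
  "order G = card (verts G)"

definition degree :: "('v, 'e) mgraph \<Rightarrow> 'v \<Rightarrow> nat" where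
  "degree G v = card {e \<in> edges G. v \<in> ends G e}"

definition max_degree :: "('v, 'e) mgraph \<Rightarrow> nat" where
  "max_degree G = Max (degree G ` verts G)"

definition regular :: "nat \<Rightarrow> ('v, 'e) mgraph \<Rightarrow> bool" where
  "regular r G \<longleftrightarrow> (\<forall>v \<in> verts G. degree G v = r)"

definition boundary :: "('v, 'e) mgraph \<Rightarrow> 'v set \<Rightarrow> 'e set" where
  "boundary G X = {e \<in> edges G. card (ends G e \<inter> X) = 1}"

definition r_graph :: "nat \<Rightarrow> ('v, 'e) mgraph \<Rightarrow> bool" where
  "r_graph r G \<longleftrightarrow>
     multigraph G \<and> regular r G \<and>
     (\<forall>X \<subseteq> verts G. odd (card X) \<longrightarrow> card (boundary G X) \<ge> r)"

definition proper_edge_colouring :: "('v, 'e) mgraph \<Rightarrow> ('e \<Rightarrow> nat) \<Rightarrow> bool" where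
  "proper_edge_colouring G c \<longleftrightarrow>
     (\<forall>e \<in> edges G. \<forall>f \<in> edges G. e \<noteq> f \<and> ends G e \<inter> ends G f \<noteq> {} \<longrightarrow> c e \<noteq> c f)"

definition edge_chromatic_number :: "('v, 'e) mgraph \<Rightarrow> nat" where
  "edge_chromatic_number G =
     (LEAST k. \<exists>c. proper_edge_colouring G c \<and> c ` edges G \<subseteq> {..<k})"

definition class_1 :: "('v, 'e) mgraph \<Rightarrow> bool" where
  "class_1 G \<longleftrightarrow> edge_chromatic_number G = max_degree G"

definition class_2 :: "('v, 'e) mgraph \<Rightarrow> bool" where
  "class_2 G \<longleftrightarrow> \<not> class_1 G"

definition perfect_matching :: "('v, 'e) mgraph \<Rightarrow> 'e set \<Rightarrow> bool" where
  "perfect_matching G M \<longleftrightarrow>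
     M \<subseteq> edges G \<and> (\<forall>v \<in> verts G. \<exists>!e. e \<in> M \<and> v \<in> ends G e)"

text \<open>The maximum number of pairwise disjoint perfect matchings, written \<open>\<pi>(G)\<close>.\<close>

definition pm_packing_number :: "('v, 'e) mgraph \<Rightarrow> nat" where
  "pm_packing_number G =
     Max {card F | F. (\<forall>M \<in> F. perfect_matching G M) \<and> pairwise disjnt F}"

definition isomorphic :: "('v, 'e) mgraph \<Rightarrow> ('w, 'f) mgraph \<Rightarrow> bool" where
  "isomorphic G H \<longleftrightarrow>
     (\<exists>f g. bij_betw f (verts G) (verts H) \<and> bij_betw g (edges G) (edges H) \<and>
            (\<forall>e \<in> edges G. ends H (g e) = f ` ends G e))"

text \<open>
  Graphs up to isomorphism are represented by graphs whose vertices and edges are natural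
  numbers. The following lemma shows that no isomorphism type is lost in this way, so that
  minimality among these graphs is minimality among all finite multigraphs.
\<close>

lemma multigraph_isomorphic_nat:
  fixes G :: "('v, 'e) mgraph"
  assumes "multigraph G"
  shows "\<exists>H :: (nat, nat) mgraph. multigraph H \<and> isomorphic G H"
proof -
  have fin: "finite (verts G)" "finite (edges G)"
    using assms by (auto simp: multigraph_def)
  obtain f :: "'v \<Rightarrow> nat" where f: "inj_on f (verts G)"
    using fin(1) finite_imp_inj_to_nat_seg by blast
  obtain g :: "'e \<Rightarrow> nat" where g: "inj_on g (edges G)"
    using fin(2) finite_imp_inj_to_nat_seg by blast
  define H :: "(nat, nat) mgraph" where
    "H = \<lparr>verts = f ` verts G, edges = g ` edges G,
          ends = (\<lambda>e. f ` ends G (inv_into (edges G) g e))\<rparr>"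
  have "card (f ` ends G e) = 2" if "e \<in> edges G" for e
    using that assms f by (auto simp: multigraph_def card_image inj_on_subset)
  then have "multigraph H"
    using assms g by (auto simp: multigraph_def H_def)
  moreover have "isomorphic G H"
    unfolding isomorphic_def
    by (rule exI[of _ f], rule exI[of _ g]) (use f g in \<open>auto simp: H_def bij_betw_def\<close>)
  ultimately show ?thesis by blast
qed

definition smallest_class_2 :: "nat \<Rightarrow> (nat, nat) mgraph set" where
  "smallest_class_2 r = {G. r_graph r G \<and> class_2 G \<and>
      (\<forall>H :: (nat, nat) mgraph. r_graph r H \<and> class_2 H \<longrightarrow> order G \<le> order H)}"

definition smallest_packing :: "nat \<Rightarrow> nat \<Rightarrow> (nat, nat) mgraph set" where
  "smallest_packing r k = {G. r_graph r G \<and> pm_packing_number G = k \<and>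
      (\<forall>H :: (nat, nat) mgraph. r_graph r H \<and> pm_packing_number H = k \<longrightarrow> order G \<le> order H)}"

text \<open>
  The Petersen graph as the Kneser graph on the 2-subsets of a 5-set. It is simple, so an edge
  is the set of its two ends.
\<close>

definition petersen :: "(nat set, nat set set) mgraph" where
  "petersen =
     \<lparr>verts = {A. A \<subseteq> {..<5} \<and> card A = 2},
      edges = {{A, B} | A B. A \<subseteq> {..<5} \<and> card A = 2 \<and> B \<subseteq> {..<5} \<and> card B = 2 \<and> A \<inter> B = {}},
      ends = (\<lambda>e. e)\<rparr>"

text \<open>
  The graph \<open>G + (\<Sum>M \<in> \<M>. M)\<close>: \<open>Inl e\<close> is the original edge \<open>e\<close>, and \<open>Inr (M, i, e)\<close> is the
  parallel copy of \<open>e\<close> added for the \<open>i\<close>-th occurrence of \<open>M\<close> in \<open>\<M>\<close>.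
\<close>

definition add_matchings ::
    "('v, 'e) mgraph \<Rightarrow> 'e set multiset \<Rightarrow> ('v, 'e + 'e set \<times> nat \<times> 'e) mgraph" where
  "add_matchings G \<M> =
     \<lparr>verts = verts G,
      edges = Inl ` edges G \<union> {Inr (M, i, e) | M i e. M \<in># \<M> \<and> i < count \<M> M \<and> e \<in> M},
      ends = (\<lambda>x. case x of Inl e \<Rightarrow> ends G e | Inr (M, i, e) \<Rightarrow> ends G e)\<rparr>"

end

theory Submission
  imports Defs
begin

text \<open>
  A graph is encoded by its edge multiplicities \<open>\<mu> u v\<close>, and a perfect matching by the fixed-point-free
  involution that exchanges the two ends of each edge. Then an \<open>r\<close>-graph is class 1 iff \<open>\<mu>\<close> is a sum of \<open>r\<close> pairings.
  A nontrivial tight cut (an odd cut of size \<open>r\<close>) allows to contract both sides, decompose and glue. Without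
  such cuts, and on at most eight vertices, deleting any perfect matching leaves an \<open>(r - 1)\<close>-graph, so class 2
  requires ten vertices.

  On ten vertices the only obstacle to deleting a perfect matching is a 5-set \<open>X\<close> with a cut of size \<open>r + 2\<close>
  that contains the matching. Suppose that every perfect matching is obstructed, say \<open>\<sigma>\<close> by \<open>X\<close>. In
  \<open>2\<mu> - \<sigma>\<close> the cut of \<open>X\<close> is tight, so this \<open>(2r - 1)\<close>-graph is a sum of \<open>2r - 1\<close> perfect matchings,
  which are obstructed by pairwise different sets \<open>Y\<close> with three vertices in \<open>X\<close>. The 2-sets \<open>X - Y\<close> are
  pairwise different, as are the \<open>Y - X\<close>, and together they span at least \<open>r - 1\<close> edges for each \<open>Y\<close>, while
  \<open>X\<close> and its complement only span \<open>2r - 1\<close> edges each. Hence \<open>r \<le> 3\<close>, and for \<open>r = 3\<close> the graph consists of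
  two 5-cycles joined by a matching, from which the obstructions recover the Petersen graph.

  For \<open>r \<ge> 4\<close> it remains to delete perfect matchings one by one, using that the Petersen graph plus a
  perfect matching containing a non-edge is 4-edge-colourable. Conversely, every perfect matching of the
  Petersen graph meets a cut formed by two disjoint 5-cycles in 1 modulo 4 edges, so that an \<open>r\<close>-edge-colouring
  of the graph with \<open>r - 3\<close> added matchings would give \<open>r\<close> congruent to \<open>5 + (r - 3)\<close> modulo 4.
\<close>

subsection \<open>Tutte's theorem\<close>

text \<open>Multiplicities turn doubling, contraction and deletion into arithmetic on functions. The
  obstacle is the number five. A matching crosses an odd cut an odd number of times, at most as
  often as the smaller side has vertices: on eight vertices at most 3 times. A cut that is not tight
  has at least r + 2 edges by parity, which is just enough for 3 crossings. On ten vertices 5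
  crossings occur, and of a cut of size r + 2 they leave r - 3 edges where r - 1 are needed. In
  \<open>2\<mu>\<close> that cut has 2r + 4 edges, so removing \<open>\<sigma>\<close> once leaves
  exactly 2r - 1: the cut becomes tight, and both contractions have at most eight vertices. A
  matching crosses a set and its complement alike, so an obstructing set may be complemented; this
  gives three vertices in X once intersections of size 0, 1, 4 and 5 are excluded. The packing
  number enters through regularity: r - 1 disjoint perfect matchings leave a 1-regular graph, so
  class 2 allows at most r - 2. The added matchings together with one perfect matching of the
  Petersen graph reach this bound.\<close>

definition pairing :: "'a set \<Rightarrow> ('a \<Rightarrow> 'a) \<Rightarrow> bool" where
  "pairing V \<sigma> \<longleftrightarrow> (\<forall>v\<in>V. \<sigma> v \<in> V \<and> \<sigma> v \<noteq> v \<and> \<sigma> (\<sigma> v) = v)"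

text \<open>Tutte's obstruction without components: a member of \<open>\<C>\<close> only has to be
  odd and closed under adjacency in \<open>V - S\<close>. It need not be connected, and
  \<open>\<C>\<close> need not cover \<open>V - S\<close>, so a barrier can be enlarged without
  recomputing components.\<close>

definition barrier :: "'a set \<Rightarrow> ('a \<Rightarrow> 'a \<Rightarrow> bool) \<Rightarrow> 'a set \<Rightarrow> 'a set set \<Rightarrow> bool" where
  "barrier V E S \<C> \<longleftrightarrow> S \<subseteq> V \<and> finite \<C> \<and> card S < card \<C> \<and> pairwise disjnt \<C> \<and>
     (\<forall>C\<in>\<C>. C \<subseteq> V - S \<and> odd (card C) \<and> (\<forall>u\<in>C. \<forall>v\<in>V - S - C. \<not> E u v))"

lemma pairing_insert2:
  assumes "pairing (V - {u, v}) \<sigma>" "u \<in> V" "v \<in> V" "u \<noteq> v"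
  shows "pairing V (\<sigma>(u := v, v := u))"
  using assms unfolding pairing_def by auto

text \<open>The exchange step in Lovasz's argument: \<open>\<sigma>\<close> is a perfect matching
  after adding the edge ac, \<open>\<tau>\<close> after adding bd, and the path a, b, c is present.
  The alternating walk that leaves \<open>d\<close> along \<open>\<sigma>\<close> either closes up
  through \<open>b\<close> away from \<open>a\<close> and \<open>c\<close>, and the matchings are
  exchanged along it, or it meets \<open>a\<close> or \<open>c\<close>, and the piece up to there is
  closed by an edge to \<open>b\<close>.\<close>

lemma alternating_swap:
  assumes fin: "finite V" and s: "pairing V \<sigma>" and t: "pairing V \<tau>"
    and sym: "\<And>u v. E u v \<Longrightarrow> E v u"
    and V: "a \<in> V" "b \<in> V" "c \<in> V" "d \<in> V"
    and ac: "\<sigma> a = c" and bd: "\<tau> b = d"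
    and ab: "E a b" and bc: "E c b"
    and ne: "b \<noteq> a" "b \<noteq> c" "d \<noteq> a" "d \<noteq> c"
    and sE: "\<And>v. v \<in> V - {a, c} \<Longrightarrow> E v (\<sigma> v)"
    and tE: "\<And>v. v \<in> V - {b, d} \<Longrightarrow> E v (\<tau> v)"
  shows "\<exists>\<rho>. pairing V \<rho> \<and> (\<forall>v\<in>V. E v (\<rho> v))"
proof -
  have s1: "\<And>v. v \<in> V \<Longrightarrow> \<sigma> v \<in> V" "\<And>v. v \<in> V \<Longrightarrow> \<sigma> v \<noteq> v" "\<And>v. v \<in> V \<Longrightarrow> \<sigma> (\<sigma> v) = v"
    and t1: "\<And>v. v \<in> V \<Longrightarrow> \<tau> v \<in> V" "\<And>v. v \<in> V \<Longrightarrow> \<tau> v \<noteq> v" "\<And>v. v \<in> V \<Longrightarrow> \<tau> (\<tau> v) = v"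
    using s t unfolding pairing_def by auto
  define y where "y k = ((\<lambda>x. \<tau> (\<sigma> x)) ^^ k) d" for k
  have y0: "y 0 = d" and yS: "\<And>k. y (Suc k) = \<tau> (\<sigma> (y k))"
    by (auto simp: y_def)
  have yV: "y k \<in> V" for k
    by (induction k) (auto simp: y0 yS V s1 t1)
  have td: "\<tau> d = b" using bd t1 V by auto
  have sc: "\<sigma> c = a" using ac s1 V by auto
  have tyS: "\<tau> (y (Suc k)) = \<sigma> (y k)" for k
    using yV s1 t1 by (simp add: yS)
  have inj1: "y i = y j" if "y (Suc i) = y (Suc j)" for i j
    using that yV s1 t1 unfolding yS by metis
  have retreat: "y (j - i) = d" if "y i = y j" "i \<le> j" for i j
    using that
  proof (induction i arbitrary: j)
    case 0 then show ?case by (simp add: y0)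
  next
    case (Suc i)
    then obtain j' where j: "j = Suc j'" by (cases j) auto
    have "y i = y j'" using inj1[of i j'] Suc.prems(1) j by blast
    then have "y (j' - i) = d" using Suc.IH Suc.prems(2) j by blast
    then show ?case using j by simp
  qed
  show ?thesis
  proof (cases "\<exists>k. y k \<in> {a, c}")
    case False
    \<comment> \<open>\<open>K\<close> is the alternating cycle through \<open>b\<close> and
      \<open>d\<close>. It avoids \<open>a\<close> and \<open>c\<close>, so using
      \<open>\<sigma>\<close> on \<open>K\<close> and \<open>\<tau>\<close> elsewhere uses neither
      added edge.\<close>
    define K where "K = range y \<union> \<sigma> ` range y"
    have "\<not> inj y"
      using fin yV finite_subset[of "range y" V] finite_imageD[of y UNIV] by auto
    then obtain i j where "y i = y j" "i < j"
      unfolding inj_def by (metis linorder_neqE_nat)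
    then have "y (j - i) = d" "j - i > 0" using retreat[of i j] by auto
    then obtain n where "y (Suc n) = d" by (metis Suc_pred)
    then have "\<sigma> (y n) = b" using tyS td by metis
    then have bK: "b \<in> K" unfolding K_def by auto
    have dK: "d \<in> K" unfolding K_def using y0 by (metis UnI1 rangeI)
    have KV: "K \<subseteq> V" unfolding K_def using yV s1 by auto
    have sK: "\<sigma> v \<in> K" if "v \<in> K" for v
      using that yV s1 unfolding K_def by auto
    have tK: "\<tau> v \<in> K" if vK: "v \<in> K" for v
    proof -
      consider k where "v = y k" | k where "v = \<sigma> (y k)" using vK unfolding K_def by auto
      then show ?thesis
      proof cases
        case 1
        then show ?thesis
        proof (cases k)
          case 0 then show ?thesis using 1 y0 td bK by simp
        next
          case (Suc k') then show ?thesis using 1 tyS unfolding K_def by auto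
        qed
      next
        case 2 then show ?thesis using yS[of k] unfolding K_def by (metis UnI1 rangeI)
      qed
    qed
    have tK': "\<tau> v \<notin> K" if "v \<in> V" "v \<notin> K" for v
      using tK that t1 by metis
    have acK: "v \<notin> {a, c}" if vK: "v \<in> K" for v
    proof
      assume v: "v \<in> {a, c}"
      consider k where "v = y k" | k where "v = \<sigma> (y k)" using vK unfolding K_def by auto
      then show False
      proof cases
        case 1 then show ?thesis using False v by auto
      next
        case 2
        then have "\<sigma> v = y k" using yV s1 by auto
        then show ?thesis using False v ac sc by auto
      qed
    qed
    let ?r = "\<lambda>v. if v \<in> K then \<sigma> v else \<tau> v"
    have "pairing V ?r"
      unfolding pairing_def using sK tK' s1 t1 by auto
    moreover have "E v (?r v)" if "v \<in> V" for v
      using that acK sE[of v] tE[of v] bK dK by auto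
    ultimately show ?thesis by blast
  next
    case True
    define k where "k = (LEAST k. y k \<in> {a, c})"
    have yk: "y k \<in> {a, c}" using True unfolding k_def by (rule LeastI_ex)
    have min: "y j \<notin> {a, c}" if "j < k" for j
      using that not_less_Least unfolding k_def by blast
    have smin: "\<sigma> (y j) \<notin> {a, c}" if "j < k" for j
    proof
      assume *: "\<sigma> (y j) \<in> {a, c}"
      have "\<sigma> (\<sigma> (y j)) = y j" using yV s1 by auto
      moreover have "\<sigma> (\<sigma> (y j)) = c \<or> \<sigma> (\<sigma> (y j)) = a" using * ac sc by (metis insertE singletonD)
      ultimately show False using min[OF that] by simp
    qed
    \<comment> \<open>\<open>Q\<close> is the walk before \<open>y k\<close>, which is to be matched
      by \<open>\<sigma>\<close>. Then \<open>b\<close> and \<open>y k\<close> are matched with each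
      other, and \<open>\<tau>\<close> is kept on the rest.\<close>
    define Q where "Q = y ` {..<k} \<union> (\<lambda>j. \<sigma> (y j)) ` {..<k}"
    have QV: "Q \<subseteq> V" unfolding Q_def using yV s1 by auto
    have Qac: "v \<notin> {a, c}" if "v \<in> Q" for v
      using that min smin unfolding Q_def by auto
    have ykQ: "y k \<notin> Q" using Qac yk by auto
    have bQ: "b \<notin> Q"
    proof
      assume "b \<in> Q"
      then consider j where "j < k" "b = y j" | j where "j < k" "b = \<sigma> (y j)" unfolding Q_def by auto
      then show False
      proof cases
        case 2
        then have "y (Suc j) = d" using yS bd by auto
        then have "y (m + Suc j) = y m" for m
          by (induction m) (auto simp: y0 yS)
        from this[of "k - Suc j"] 2 have "y k = y (k - Suc j)" by auto
        with yk min[of "k - Suc j"] 2 show False by auto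
      next
        case 1
        have "b \<noteq> d" using bd t1(2) V by metis
        with 1 y0 obtain i where i: "j = Suc i" by (cases j) auto
        with 1 tyS bd have si: "\<sigma> (y i) = d" by metis
        \<comment> \<open>A walk that meets \<open>b\<close> at an even position arrives there
          through \<open>d\<close> and has therefore retraced its own steps; its midpoint would be a
          fixed point of \<open>\<sigma>\<close> or of \<open>\<tau>\<close>.\<close>
        have fold: "y (i - l) = \<sigma> (y l)" if "l \<le> i" for l
          using that
        proof (induction l)
          case 0
          then show ?case using si y0 s1 yV by (metis diff_zero)
        next
          case (Suc l)
          then obtain m where m: "i - l = Suc m" by (metis Suc_diff_Suc Suc_le_lessD)
          have "\<sigma> (y m) = \<tau> (\<sigma> (y l))" using Suc m tyS[of m] by auto
          then have "\<sigma> (y m) = y (Suc l)" by (simp add: yS)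
          then have "y m = \<sigma> (y (Suc l))" using s1 yV by metis
          then show ?case using m by (metis diff_Suc_1 diff_Suc_eq_diff_pred diff_commute One_nat_def)
        qed
        show False
        proof (cases "even i")
          case True
          then obtain l where "i = l + l" by (metis evenE mult_2)
          with fold[of l] have "y l = \<sigma> (y l)" by auto
          with s1 yV show False by metis
        next
          case False
          then obtain l where "i = Suc (l + l)" by (metis oddE mult_2 Suc_eq_plus1)
          with fold[of l] have "y (Suc l) = \<sigma> (y l)" by auto
          with yS[of l] have "\<tau> (\<sigma> (y l)) = \<sigma> (y l)" by simp
          with t1 s1 yV show False by metis
        qed
      qed
    qed
    have sQ: "\<sigma> v \<in> Q" if "v \<in> Q" for v
      using that yV s1 unfolding Q_def by auto
    have tQ: "\<tau> v \<notin> Q \<and> \<tau> v \<noteq> b \<and> \<tau> v \<noteq> y k" if v: "v \<in> V" "v \<notin> Q" "v \<noteq> b" "v \<noteq> y k" for v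
    proof -
      have ty: "\<tau> v \<noteq> y j" if j: "j \<le> k" for j
      proof
        assume *: "\<tau> v = y j"
        show False
        proof (cases j)
          case 0
          then have "v = b" using * y0 td v t1 by metis
          then show False using v by auto
        next
          case (Suc i)
          then have "v = \<sigma> (y i)" using * tyS v t1 by metis
          then show False using Suc j v unfolding Q_def by auto
        qed
      qed
      have tsy: "\<tau> v \<noteq> \<sigma> (y j)" if j: "j < k" for j
      proof
        assume "\<tau> v = \<sigma> (y j)"
        then have "v = y (Suc j)" using yS v t1 by metis
        then show False using j v unfolding Q_def by (cases "Suc j = k") auto
      qed
      have "\<tau> v \<noteq> b"
      proof
        assume "\<tau> v = b"
        then have "v = d" using bd v t1 by metis
        then have "v = y 0" using y0 by simp
        then show False using v unfolding Q_def by (cases "k = 0") auto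
      qed
      moreover have "\<tau> v \<notin> Q"
        unfolding Q_def using ty tsy less_imp_le by blast
      ultimately show ?thesis using ty[of k] by blast
    qed
    have kb: "y k \<noteq> b" using yk ne by auto
    let ?r = "\<lambda>v. if v = b then y k else if v = y k then b else if v \<in> Q then \<sigma> v else \<tau> v"
    have "pairing V ?r"
      unfolding pairing_def
    proof (intro ballI)
      fix v assume v: "v \<in> V"
      consider "v = b" | "v = y k" | "v \<noteq> b" "v \<noteq> y k" "v \<in> Q" | "v \<noteq> b" "v \<noteq> y k" "v \<notin> Q" by blast
      then show "?r v \<in> V \<and> ?r v \<noteq> v \<and> ?r (?r v) = v"
      proof cases
        case 1 then show ?thesis using yV kb by auto
      next
        case 2 then show ?thesis using V kb by auto
      next
        case 3
        have "\<sigma> v \<noteq> b" "\<sigma> v \<noteq> y k" using sQ[OF 3(3)] bQ ykQ by auto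
        then show ?thesis using 3 sQ s1 v by auto
      next
        case 4
        then show ?thesis using tQ t1 v by auto
      qed
    qed
    moreover have "E v (?r v)" if v: "v \<in> V" for v
    proof -
      consider "v = b" | "v = y k" | "v \<noteq> b" "v \<noteq> y k" "v \<in> Q" | "v \<noteq> b" "v \<noteq> y k" "v \<notin> Q" by blast
      then show ?thesis
      proof cases
        case 1 then show ?thesis using yk ab bc sym by auto
      next
        case 2 then show ?thesis using yk ab bc kb by auto
      next
        case 3 then show ?thesis using sE[of v] Qac v by auto
      next
        case 4
        have "v \<noteq> d" using 4 y0 unfolding Q_def by (cases "k = 0") auto
        then show ?thesis using 4 tE[of v] v by auto
      qed
    qed
    ultimately show ?thesis by blast
  qed
qed

lemma card_Diff_pair:
  assumes "finite V" "u \<in> V" "v \<in> V" "u \<noteq> v"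
  shows "card V = card (V - {u, v}) + 2"
  using assms card_mono[of V "{u, v}"] by (simp add: card_Diff_subset)

lemma barrier_mono:
  assumes "barrier V E S \<C>" "\<And>u v. E' u v \<Longrightarrow> E u v"
  shows "barrier V E' S \<C>"
  unfolding barrier_def
proof (intro conjI ballI)
  show "\<not> E' u v" if "C \<in> \<C>" "u \<in> C" "v \<in> V - S - C" for C u v
    using that assms(1) assms(2)[of u v] unfolding barrier_def by metis
qed (use assms(1) in \<open>simp_all add: barrier_def\<close>)

lemma barrier_odd: "odd (card V) \<Longrightarrow> barrier V E {} {V}"
  unfolding barrier_def by auto

text \<open>The saturated case in Lovasz's proof of Tutte's theorem.\<close>

lemma pairing_or_barrier_cliques:
  assumes "finite V" "S \<subseteq> V" and sym: "\<And>u v. E u v \<Longrightarrow> E v u"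
    and "\<forall>s\<in>S. \<forall>v\<in>V. v \<noteq> s \<longrightarrow> E s v"
    and "\<forall>u\<in>V - S. \<forall>v\<in>V - S. \<forall>w\<in>V - S. E u v \<and> E v w \<and> u \<noteq> w \<longrightarrow> E u w"
  shows "odd (card V) \<or> (\<exists>\<sigma>. pairing V \<sigma> \<and> (\<forall>v\<in>V. E v (\<sigma> v))) \<or> (\<exists>\<C>. barrier V E S \<C>)"
  using assms(1,2,4,5)
proof (induction "card V" arbitrary: V S rule: less_induct)
  case less
  note fin = less.prems(1) and SV = less.prems(2) and univ = less.prems(3) and tr = less.prems(4)
  show ?case
  proof (cases "\<exists>u v. u \<in> V - S \<and> v \<in> V - S \<and> u \<noteq> v \<and> E u v")
    case True
    then obtain u v where uv: "u \<in> V - S" "v \<in> V - S" "u \<noteq> v" "E u v" by blast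
    let ?V = "V - {u, v}"
    have cV: "card V = card ?V + 2"
      using card_Diff_pair[OF fin] uv by blast
    have "odd (card ?V) \<or> (\<exists>\<sigma>. pairing ?V \<sigma> \<and> (\<forall>v\<in>?V. E v (\<sigma> v))) \<or> (\<exists>\<C>. barrier ?V E S \<C>)"
    proof (rule less.hyps)
      show "card ?V < card V" "finite ?V" "S \<subseteq> ?V" using cV fin SV uv by auto
      show "\<forall>s\<in>S. \<forall>w\<in>?V. w \<noteq> s \<longrightarrow> E s w" using univ by blast
      show "\<forall>x\<in>?V - S. \<forall>y\<in>?V - S. \<forall>w\<in>?V - S. E x y \<and> E y w \<and> x \<noteq> w \<longrightarrow> E x w"
        using tr by blast
    qed
    then consider "odd (card ?V)" | \<sigma> where "pairing ?V \<sigma>" "\<forall>v\<in>?V. E v (\<sigma> v)" | \<C> where "barrier ?V E S \<C>"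
      by blast
    then show ?thesis
    proof cases
      case 1 then show ?thesis using cV by simp
    next
      case 2
      have "pairing V (\<sigma>(u := v, v := u))" using pairing_insert2[OF 2(1)] uv by blast
      moreover have "\<forall>w\<in>V. E w ((\<sigma>(u := v, v := u)) w)" using 2(2) uv sym by auto
      ultimately show ?thesis by blast
    next
      case 3
      have bf: "finite \<C>" and bcd: "card S < card \<C>" and bd: "pairwise disjnt \<C>"
        and bS: "\<And>C. C \<in> \<C> \<Longrightarrow> C \<subseteq> ?V - S"
        and bo: "\<And>C. C \<in> \<C> \<Longrightarrow> odd (card C)"
        using 3 unfolding barrier_def by simp_all
      have be: "\<not> E x y" if "C \<in> \<C>" "x \<in> C" "y \<in> ?V - S - C" for C x y
        using 3 that unfolding barrier_def by metis
      have fC: "finite C" if "C \<in> \<C>" for C using bS[OF that] fin by (meson Diff_subset finite_subset subset_trans)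
      \<comment> \<open>Outside \<open>S\<close> adjacency is transitive, so the adjacent vertices
        \<open>u\<close> and \<open>v\<close> have the same further neighbours.\<close>
      have Eu: "E c u \<longleftrightarrow> E c v" if "c \<in> ?V - S" for c
        using that uv tr sym by blast
      show ?thesis
      proof (cases "\<exists>C\<in>\<C>. \<exists>c\<in>C. E c u")
        case True
        then obtain C c where C: "C \<in> \<C>" "c \<in> C" "E c u" by blast
        have CV: "C \<subseteq> ?V - S" using C bS by blast
        have cC: "c \<in> ?V - S" using C CV by blast
        have w: "w \<in> C" if "w \<in> ?V - S" "E w u" for w
        proof (rule ccontr)
          assume "w \<notin> C"
          moreover have "E c w"
          proof -
            have "E u w" using that sym by blast
            moreover have "c \<noteq> w" using \<open>w \<notin> C\<close> C by blast
            ultimately show ?thesis using tr C uv cC that by blast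
          qed
          ultimately show False using be[OF C(1,2)] that by blast
        qed
        \<comment> \<open>All neighbours of \<open>u\<close> and \<open>v\<close> outside
          \<open>S\<close> lie in \<open>C\<close>, apart from these two; adding both to
          \<open>C\<close> keeps its size odd.\<close>
        let ?D = "insert u (insert v C)"
        have nin: "u \<notin> C" "v \<notin> C" using CV by auto
        have disj: "pairwise disjnt (insert ?D (\<C> - {C}))"
        proof -
          have *: "disjnt ?D X" if X: "X \<in> \<C> - {C}" for X
          proof -
            have "disjnt C X" using bd C X unfolding pairwise_def by blast
            moreover have "u \<notin> X" "v \<notin> X" using bS X by blast+
            ultimately show ?thesis by simp
          qed
          have "pairwise disjnt (\<C> - {C})" using bd by (meson Diff_subset pairwise_subset)
          then show ?thesis using * by (simp add: pairwise_insert disjnt_sym)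
        qed
        have nD: "?D \<notin> \<C> - {C}" using bS by blast
        have "barrier V E S (insert ?D (\<C> - {C}))"
          unfolding barrier_def
        proof (intro conjI ballI disj SV)
          show "finite (insert ?D (\<C> - {C}))" using bf by auto
          show "card S < card (insert ?D (\<C> - {C}))"
            using bf bcd nD C by (simp add: card_Suc_Diff1 del: card_Diff_insert)
          fix X assume X: "X \<in> insert ?D (\<C> - {C})"
          show "X \<subseteq> V - S" using X bS C uv by blast
          show "odd (card X)"
            using X bo C nin uv fC[OF C(1)] by auto
          fix x y assume x: "x \<in> X" and y: "y \<in> V - S - X"
          show "\<not> E x y"
          proof (cases "X = ?D")
            case True
            then have y': "y \<in> ?V - S" "y \<notin> C" using y by auto
            consider "x = u" | "x = v" | "x \<in> C" using True x by blast
            then show ?thesis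
            proof cases
              case 1 then show ?thesis using w y' sym by blast
            next
              case 2 then show ?thesis using w y' sym Eu by blast
            next
              case 3 then show ?thesis using be[OF C(1)] y' by blast
            qed
          next
            case False
            then have X': "X \<in> \<C>" "X \<noteq> C" using X by auto
            have xV: "x \<in> ?V - S" using X' bS x by blast
            have "disjnt X C" using X' C bd unfolding pairwise_def by blast
            then have "x \<notin> C" using x by (meson disjnt_iff)
            then have "\<not> E x u" "\<not> E x v" using w xV Eu by blast+
            then show ?thesis using be[OF X'(1) x] y by blast
          qed
        qed
        then show ?thesis by blast
      next
        case False
        then have "\<not> E c u" "\<not> E c v" if "C \<in> \<C>" "c \<in> C" for C c
          using that Eu bS by blast+
        then have "\<not> E x y" if "C \<in> \<C>" "x \<in> C" "y \<in> V - S - C" for C x y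
          using that be[of C x y] by blast
        moreover have "C \<subseteq> V - S" if "C \<in> \<C>" for C using bS[OF that] by blast
        ultimately have "barrier V E S \<C>" using bf bcd bd bo SV unfolding barrier_def by blast
        then show ?thesis by blast
      qed
    qed
  next
    case False
    note indep = False
    show ?thesis
    proof (cases "V - S = {}")
      case False
      then obtain t where t: "t \<in> V - S" by blast
      show ?thesis
      proof (cases "S = {}")
        case True
        then have "barrier V E S {{t}}"
          unfolding barrier_def using t indep True by auto
        then show ?thesis by blast
      next
        case False
        then obtain s where s: "s \<in> S" by blast
        \<comment> \<open>As \<open>V - S\<close> spans no edge, \<open>t\<close> is matched with
          the universal vertex \<open>s\<close>. In a barrier of the rest, the new singleton
          \<open>{t}\<close> pays for the return of \<open>s\<close> to \<open>S\<close>.\<close>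
        let ?V = "V - {s, t}" and ?S = "S - {s}"
        have st: "s \<noteq> t" "s \<in> V" using s t SV by auto
        have cV: "card V = card ?V + 2"
          using card_Diff_pair[OF fin] st t by blast
        have "odd (card ?V) \<or> (\<exists>\<sigma>. pairing ?V \<sigma> \<and> (\<forall>v\<in>?V. E v (\<sigma> v))) \<or> (\<exists>\<C>. barrier ?V E ?S \<C>)"
        proof (rule less.hyps)
          show "card ?V < card V" "finite ?V" "?S \<subseteq> ?V" using cV fin SV s t by auto
          show "\<forall>s\<in>?S. \<forall>w\<in>?V. w \<noteq> s \<longrightarrow> E s w" using univ by blast
          show "\<forall>x\<in>?V - ?S. \<forall>y\<in>?V - ?S. \<forall>w\<in>?V - ?S. E x y \<and> E y w \<and> x \<noteq> w \<longrightarrow> E x w"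
            using tr by blast
        qed
        then consider "odd (card ?V)" | \<sigma> where "pairing ?V \<sigma>" "\<forall>v\<in>?V. E v (\<sigma> v)" | \<C> where "barrier ?V E ?S \<C>"
          by blast
        then show ?thesis
        proof cases
          case 1 then show ?thesis using cV by simp
        next
          case 2
          have "pairing V (\<sigma>(s := t, t := s))" using pairing_insert2[OF 2(1)] st t by blast
          moreover have "\<forall>w\<in>V. E w ((\<sigma>(s := t, t := s)) w)" using 2(2) univ s t st sym by auto
          ultimately show ?thesis by blast
        next
          case 3
          have bf: "finite \<C>" and bcd: "card ?S < card \<C>" and bd: "pairwise disjnt \<C>"
            and bS: "\<And>C. C \<in> \<C> \<Longrightarrow> C \<subseteq> ?V - ?S"
            and bo: "\<And>C. C \<in> \<C> \<Longrightarrow> odd (card C)"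
            using 3 unfolding barrier_def by simp_all
          have be: "\<not> E x y" if "C \<in> \<C>" "x \<in> C" "y \<in> ?V - ?S - C" for C x y
            using 3 that unfolding barrier_def by metis
          have tC: "t \<notin> C" if "C \<in> \<C>" for C using bS[OF that] by blast
          have nt: "{t} \<notin> \<C>" using tC by blast
          have "Suc (card ?S) = card S" using s SV fin by (meson card_Suc_Diff1 finite_subset)
          then have "card S < card (insert {t} \<C>)" using bcd bf nt by simp
          moreover have "pairwise disjnt (insert {t} \<C>)"
            using bd tC by (simp add: pairwise_insert disjnt_sym)
          moreover have "\<not> E x y" if "C \<in> insert {t} \<C>" "x \<in> C" "y \<in> V - S - C" for C x y
          proof (cases "C = {t}")
            case True then show ?thesis using that indep t by blast
          next
            case False
            then have C: "C \<in> \<C>" using that by blast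
            show ?thesis
            proof (cases "y = t")
              case True
              then show ?thesis using indep t that bS[OF C] s tC[OF C] by blast
            next
              case False then show ?thesis using be[OF C that(2)] that s by blast
            qed
          qed
          moreover have "C \<subseteq> V - S \<and> odd (card C)" if "C \<in> insert {t} \<C>" for C
            using that bS[of C] bo[of C] t by auto
          ultimately have "barrier V E S (insert {t} \<C>)"
            unfolding barrier_def using bf SV by simp
          then show ?thesis by blast
        qed
      qed
    next
      case True
      then have VS: "V = S" using SV by blast
      show ?thesis
      proof (cases "card V \<le> 1")
        case True
        then have "V = {} \<or> odd (card V)" using fin by (cases "card V") auto
        then show ?thesis by (auto simp: pairing_def)
      next
        case False
        then obtain s where s: "s \<in> V" by fastforce
        have "V \<noteq> {s}" using False by auto
        then obtain t where t: "t \<in> V" "t \<noteq> s" using s by blast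
        let ?V = "V - {s, t}"
        have cV: "card V = card ?V + 2"
          using card_Diff_pair[OF fin] s t by blast
        have "odd (card ?V) \<or> (\<exists>\<sigma>. pairing ?V \<sigma> \<and> (\<forall>v\<in>?V. E v (\<sigma> v))) \<or> (\<exists>\<C>. barrier ?V E ?V \<C>)"
        proof (rule less.hyps)
          show "card ?V < card V" "finite ?V" "?V \<subseteq> ?V" using cV fin by auto
          show "\<forall>s\<in>?V. \<forall>w\<in>?V. w \<noteq> s \<longrightarrow> E s w" using univ VS by blast
        qed auto
        then consider "odd (card ?V)" | \<sigma> where "pairing ?V \<sigma>" "\<forall>v\<in>?V. E v (\<sigma> v)" | \<C> where "barrier ?V E ?V \<C>"
          by blast
        then show ?thesis
        proof cases
          case 1 then show ?thesis using cV by simp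
        next
          case 2
          have "pairing V (\<sigma>(s := t, t := s))" using pairing_insert2[OF 2(1)] s t by blast
          moreover have "\<forall>w\<in>V. E w ((\<sigma>(s := t, t := s)) w)" using 2(2) univ s t VS sym by auto
          ultimately show ?thesis by blast
        next
          case 3
          then have "\<C> \<noteq> {}" "\<forall>C\<in>\<C>. C = {} \<and> odd (card C)" unfolding barrier_def by auto
          then show ?thesis by fastforce
        qed
      qed
    qed
  qed
qed

text \<open>Induction on the number of nonadjacent pairs. A barrier after adding an edge is also one
  before, so it may be assumed that every single added edge creates a perfect matching. If adjacency
  outside the universal vertices is not transitive, the matchings for two added edges combine by
  \<open>alternating_swap\<close>; if it is, \<open>V - S\<close> falls into cliques.\<close>

theorem pairing_or_barrier:
  fixes E :: "'a \<Rightarrow> 'a \<Rightarrow> bool"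
  assumes fin: "finite V" and sym: "\<And>u v. E u v \<Longrightarrow> E v u"
  shows "(\<exists>\<sigma>. pairing V \<sigma> \<and> (\<forall>v\<in>V. E v (\<sigma> v))) \<or> (\<exists>S \<C>. barrier V E S \<C>)"
  using sym
proof (induction "card {p \<in> V \<times> V. \<not> E (fst p) (snd p)}" arbitrary: E rule: less_induct)
  case less
  note sym = less.prems
  define add :: "'a \<Rightarrow> 'a \<Rightarrow> 'a \<Rightarrow> 'a \<Rightarrow> bool" where
    "add u v = (\<lambda>x y. E x y \<or> x = u \<and> y = v \<or> x = v \<and> y = u)" for u v
  have IH: "(\<exists>\<sigma>. pairing V \<sigma> \<and> (\<forall>x\<in>V. add u v x (\<sigma> x))) \<or> (\<exists>S \<C>. barrier V E S \<C>)"
    if uv: "u \<in> V" "v \<in> V" "\<not> E u v" for u v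
  proof -
    have "{p \<in> V \<times> V. \<not> add u v (fst p) (snd p)} \<subset> {p \<in> V \<times> V. \<not> E (fst p) (snd p)}"
      using uv by (force simp: add_def)
    then have "card {p \<in> V \<times> V. \<not> add u v (fst p) (snd p)} < card {p \<in> V \<times> V. \<not> E (fst p) (snd p)}"
      using fin by (intro psubset_card_mono) auto
    moreover have "\<And>x y. add u v x y \<Longrightarrow> add u v y x" using sym by (auto simp: add_def)
    ultimately have "(\<exists>\<sigma>. pairing V \<sigma> \<and> (\<forall>x\<in>V. add u v x (\<sigma> x))) \<or> (\<exists>S \<C>. barrier V (add u v) S \<C>)"
      by (rule less.hyps)
    moreover have "barrier V E S \<C>" if "barrier V (add u v) S \<C>" for S \<C>
      using barrier_mono[OF that] by (simp add: add_def)
    ultimately show ?thesis by blast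
  qed
  define S where "S = {s\<in>V. \<forall>v\<in>V. v \<noteq> s \<longrightarrow> E s v}"
  show ?case
  proof (cases "\<forall>u\<in>V - S. \<forall>v\<in>V - S. \<forall>w\<in>V - S. E u v \<and> E v w \<and> u \<noteq> w \<longrightarrow> E u w")
    case True
    have "odd (card V) \<or> (\<exists>\<sigma>. pairing V \<sigma> \<and> (\<forall>v\<in>V. E v (\<sigma> v))) \<or> (\<exists>\<C>. barrier V E S \<C>)"
      by (rule pairing_or_barrier_cliques[OF fin _ _ _ True]) (use sym in \<open>auto simp: S_def\<close>)
    then show ?thesis using barrier_odd by blast
  next
    case False
    then obtain a b c where abc: "a \<in> V" "b \<in> V - S" "c \<in> V" "E a b" "E b c" "a \<noteq> c" "\<not> E a c"
      by blast
    then obtain d where d: "d \<in> V" "d \<noteq> b" "\<not> E b d" unfolding S_def by blast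
    show ?thesis
    proof (rule ccontr)
      assume no: "\<not> ?thesis"
      then obtain \<sigma> where s: "pairing V \<sigma>" "\<forall>x\<in>V. add a c x (\<sigma> x)" using IH[of a c] abc by blast
      obtain \<tau> where t: "pairing V \<tau>" "\<forall>x\<in>V. add b d x (\<tau> x)" using IH[of b d] abc d no by blast
      have sa: "\<sigma> a = c"
      proof (rule ccontr)
        assume "\<sigma> a \<noteq> c"
        then have "\<sigma> c \<noteq> a" using s abc unfolding pairing_def by metis
        then have "\<forall>x\<in>V. E x (\<sigma> x)" using s \<open>\<sigma> a \<noteq> c\<close> unfolding add_def by blast
        then show False using s no by blast
      qed
      have tb: "\<tau> b = d"
      proof (rule ccontr)
        assume "\<tau> b \<noteq> d"
        then have "\<tau> d \<noteq> b" using t abc d unfolding pairing_def by (metis DiffD1)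
        then have "\<forall>x\<in>V. E x (\<tau> x)" using t \<open>\<tau> b \<noteq> d\<close> unfolding add_def by blast
        then show False using t no by blast
      qed
      have "\<exists>\<rho>. pairing V \<rho> \<and> (\<forall>v\<in>V. E v (\<rho> v))"
      proof (rule alternating_swap[where E = E, OF fin s(1) t(1) sym])
        show "a \<in> V" "b \<in> V" "c \<in> V" "d \<in> V" "\<sigma> a = c" "\<tau> b = d" "E a b" "E c b"
          using abc d sa tb sym by auto
        show "d \<noteq> a" "d \<noteq> c" using abc d sym by auto
        show "b \<noteq> a" "b \<noteq> c" using abc by auto
        show "E v (\<sigma> v)" if "v \<in> V - {a, c}" for v using s that unfolding add_def by blast
        show "E v (\<tau> v)" if "v \<in> V - {b, d}" for v using t that unfolding add_def by blast
      qed auto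
      then show False using no by blast
    qed
  qed
qed

subsection \<open>Edge weights and regular weights\<close>

text \<open>Ordered pairs are counted: \<open>edge_weight \<mu> X X\<close> is twice the number of
  edges spanned by \<open>X\<close>, and between disjoint sets each edge counts once.\<close>

definition edge_weight :: "('a \<Rightarrow> 'a \<Rightarrow> nat) \<Rightarrow> 'a set \<Rightarrow> 'a set \<Rightarrow> nat" where
  "edge_weight \<mu> X Y = (\<Sum>x\<in>X. \<Sum>y\<in>Y. \<mu> x y)"

abbreviation pairing_weight :: "('a \<Rightarrow> 'a) \<Rightarrow> 'a \<Rightarrow> 'a \<Rightarrow> nat" where
  "pairing_weight \<sigma> \<equiv> (\<lambda>u v. of_bool (\<sigma> u = v))"

text \<open>Edge colouring with \<open>r\<close> colours in terms of multiplicities. The pairings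
  form an indexed family because the same pairing may occur repeatedly.\<close>

definition decomposable :: "nat \<Rightarrow> 'a set \<Rightarrow> ('a \<Rightarrow> 'a \<Rightarrow> nat) \<Rightarrow> bool" where
  "decomposable r V \<mu> \<longleftrightarrow> (\<exists>\<sigma>. (\<forall>i<r. pairing V (\<sigma> i)) \<and>
     (\<forall>u\<in>V. \<forall>v\<in>V. \<mu> u v = (\<Sum>i<r. pairing_weight (\<sigma> i) u v)))"

lemma edge_weight_empty [simp]: "edge_weight \<mu> {} Y = 0" "edge_weight \<mu> X {} = 0"
  by (simp_all add: edge_weight_def)

lemma edge_weight_insert_left:
  "finite X \<Longrightarrow> x \<notin> X \<Longrightarrow> edge_weight \<mu> (insert x X) Y = edge_weight \<mu> {x} Y + edge_weight \<mu> X Y"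
  by (simp add: edge_weight_def)

lemma edge_weight_insert_right:
  "finite Y \<Longrightarrow> y \<notin> Y \<Longrightarrow> edge_weight \<mu> X (insert y Y) = edge_weight \<mu> X {y} + edge_weight \<mu> X Y"
  by (simp add: edge_weight_def sum.distrib)

lemma edge_weight_Un_left:
  "finite A \<Longrightarrow> finite B \<Longrightarrow> A \<inter> B = {} \<Longrightarrow> edge_weight \<mu> (A \<union> B) Y = edge_weight \<mu> A Y + edge_weight \<mu> B Y"
  by (simp add: edge_weight_def sum.union_disjoint)

lemma edge_weight_Un_right:
  "finite A \<Longrightarrow> finite B \<Longrightarrow> A \<inter> B = {} \<Longrightarrow> edge_weight \<mu> X (A \<union> B) = edge_weight \<mu> X A + edge_weight \<mu> X B"
  by (simp add: edge_weight_def sum.union_disjoint sum.distrib)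

lemma edge_weight_cong:
  "(\<And>x y. x \<in> X \<Longrightarrow> y \<in> Y \<Longrightarrow> \<mu> x y = \<nu> x y) \<Longrightarrow> edge_weight \<mu> X Y = edge_weight \<nu> X Y"
  by (simp add: edge_weight_def)

lemma edge_weight_add:
  "edge_weight (\<lambda>u v. \<mu> u v + \<nu> u v) X Y = edge_weight \<mu> X Y + edge_weight \<nu> X Y"
  by (simp add: edge_weight_def sum.distrib)

lemma edge_weight_sum:
  "edge_weight (\<lambda>u v. \<Sum>i\<in>I. \<nu> i u v) X Y = (\<Sum>i\<in>I. edge_weight (\<nu> i) X Y)"
proof -
  have "(\<Sum>x\<in>X. \<Sum>y\<in>Y. \<Sum>i\<in>I. \<nu> i x y) = (\<Sum>x\<in>X. \<Sum>i\<in>I. \<Sum>y\<in>Y. \<nu> i x y)"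
    by (intro sum.cong refl sum.swap)
  also have "\<dots> = (\<Sum>i\<in>I. \<Sum>x\<in>X. \<Sum>y\<in>Y. \<nu> i x y)" by (rule sum.swap)
  finally show ?thesis by (simp add: edge_weight_def)
qed

lemma edge_weight_scale:
  "edge_weight (\<lambda>u v. c * \<mu> u v) X Y = c * edge_weight \<mu> X Y"
  by (simp add: edge_weight_def sum_distrib_left)

lemma edge_weight_le:
  assumes "finite X" "finite Y" "x \<in> X" "y \<in> Y"
  shows "\<mu> x y \<le> edge_weight \<mu> X Y"
proof -
  have "\<mu> x y \<le> (\<Sum>y\<in>Y. \<mu> x y)" using assms by (simp add: member_le_sum)
  also have "\<dots> \<le> edge_weight \<mu> X Y"
    unfolding edge_weight_def using assms by (intro member_le_sum[of x X "\<lambda>x. \<Sum>y\<in>Y. \<mu> x y"]) auto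
  finally show ?thesis .
qed

lemma edge_weight_mono:
  assumes "finite X'" "finite Y'" "X \<subseteq> X'" "Y \<subseteq> Y'"
  shows "edge_weight \<mu> X Y \<le> edge_weight \<mu> X' Y'"
proof -
  have "(\<Sum>x\<in>X. \<Sum>y\<in>Y. \<mu> x y) \<le> (\<Sum>x\<in>X. \<Sum>y\<in>Y'. \<mu> x y)"
    using assms by (intro sum_mono sum_mono2) auto
  also have "\<dots> \<le> (\<Sum>x\<in>X'. \<Sum>y\<in>Y'. \<mu> x y)"
    using assms by (intro sum_mono2) auto
  finally show ?thesis by (simp add: edge_weight_def)
qed

lemma edge_weight_pairing:
  assumes "finite X" "finite Y"
  shows "edge_weight (pairing_weight \<sigma>) X Y = card {x\<in>X. \<sigma> x \<in> Y}"
proof -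
  have "(\<Sum>y\<in>Y. of_bool (\<sigma> x = y)) = (of_bool (\<sigma> x \<in> Y) :: nat)" for x
    using assms by (simp add: of_bool_def sum.delta)
  then show ?thesis using assms
    by (simp add: edge_weight_def of_bool_def sum.If_cases Int_def)
qed

locale sym_weight =
  fixes V :: "'a set" and \<mu> :: "'a \<Rightarrow> 'a \<Rightarrow> nat"
  assumes fin: "finite V"
    and sym: "\<And>u v. u \<in> V \<Longrightarrow> v \<in> V \<Longrightarrow> \<mu> u v = \<mu> v u"
    and zero: "\<And>v. v \<in> V \<Longrightarrow> \<mu> v v = 0"
begin

lemma fin_sub: "X \<subseteq> V \<Longrightarrow> finite X"
  using fin finite_subset by blast

lemma edge_weight_commute:
  "X \<subseteq> V \<Longrightarrow> Y \<subseteq> V \<Longrightarrow> edge_weight \<mu> X Y = edge_weight \<mu> Y X"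
  unfolding edge_weight_def by (subst sum.swap) (intro sum.cong refl sym, auto)

lemma even_edge_weight_self:
  assumes "X \<subseteq> V"
  shows "even (edge_weight \<mu> X X)"
proof -
  have "finite X" using assms fin_sub by blast
  then show ?thesis using assms
  proof (induction X rule: finite_induct)
    case (insert x X)
    have "edge_weight \<mu> (insert x X) (insert x X) =
        edge_weight \<mu> {x} {x} + edge_weight \<mu> {x} X + (edge_weight \<mu> X {x} + edge_weight \<mu> X X)"
      using edge_weight_insert_left[OF insert.hyps(1,2)] edge_weight_insert_right[OF insert.hyps(1,2)] by metis
    also have "edge_weight \<mu> X {x} = edge_weight \<mu> {x} X"
      using insert by (intro edge_weight_commute) auto
    also have "edge_weight \<mu> {x} {x} = 0" using insert zero by (simp add: edge_weight_def)
    finally show ?case using insert by simp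
  qed simp
qed

end

locale regular_weight = sym_weight V \<mu> for V :: "'a set" and \<mu> :: "'a \<Rightarrow> 'a \<Rightarrow> nat" +
  fixes r :: nat
  assumes deg: "\<And>v. v \<in> V \<Longrightarrow> (\<Sum>u\<in>V. \<mu> v u) = r"
begin

lemma edge_weight_total: "X \<subseteq> V \<Longrightarrow> edge_weight \<mu> X V = r * card X"
  unfolding edge_weight_def using deg by (subst sum.cong[of X X _ "\<lambda>_. r"]) auto

lemma edge_weight_split:
  assumes "X \<subseteq> V"
  shows "edge_weight \<mu> X X + edge_weight \<mu> X (V - X) = r * card X"
proof -
  have "V = X \<union> (V - X)" using assms by auto
  then have "edge_weight \<mu> X V = edge_weight \<mu> X X + edge_weight \<mu> X (V - X)"
    using edge_weight_Un_right[of X "V - X" \<mu> X] fin fin_sub assms by auto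
  then show ?thesis using edge_weight_total assms by simp
qed

text \<open>The degrees in \<open>X\<close> add up to r times \<open>card X\<close>, and edges
  inside \<open>X\<close> contribute 2 each.\<close>

lemma cut_parity:
  assumes "X \<subseteq> V" "odd (card X)"
  shows "even (edge_weight \<mu> X (V - X)) \<longleftrightarrow> even r"
  using edge_weight_split[OF assms(1)] even_edge_weight_self[OF assms(1)] assms(2)
  by (metis even_add even_mult_iff)

lemma cut_compl:
  assumes "X \<subseteq> V"
  shows "edge_weight \<mu> (V - X) (V - (V - X)) = edge_weight \<mu> X (V - X)"
  using edge_weight_commute[of X "V - X"] assms by (simp add: double_diff)

lemma edge_weight_vertex: "v \<in> V \<Longrightarrow> edge_weight \<mu> {v} (V - {v}) = r"
  using edge_weight_split[of "{v}"] zero by (simp add: edge_weight_def)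

end

lemma pairing_regular_weight:
  assumes "finite V" "pairing V \<sigma>"
  shows "regular_weight V (pairing_weight \<sigma>) 1"
proof
  show "(\<Sum>u\<in>V. pairing_weight \<sigma> v u) = 1" if "v \<in> V" for v
    using assms that unfolding pairing_def by (simp add: of_bool_def sum.delta)
qed (use assms in \<open>auto simp: pairing_def\<close>)

lemma pairing_cut:
  assumes "finite V" "pairing V \<sigma>" "X \<subseteq> V" "odd (card X)"
  shows "odd (edge_weight (pairing_weight \<sigma>) X (V - X))"
    and "edge_weight (pairing_weight \<sigma>) X (V - X) \<le> card X"
    and "edge_weight (pairing_weight \<sigma>) X (V - X) \<le> card (V - X)"
proof -
  interpret regular_weight V "pairing_weight \<sigma>" 1 using pairing_regular_weight assms by blast
  show "odd (edge_weight (pairing_weight \<sigma>) X (V - X))" using cut_parity assms by simp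
  show "edge_weight (pairing_weight \<sigma>) X (V - X) \<le> card X"
    using edge_weight_split[OF assms(3)] by simp
  show "edge_weight (pairing_weight \<sigma>) X (V - X) \<le> card (V - X)"
    using edge_weight_split[of "V - X"] cut_compl[OF assms(3)] by simp
qed

locale r_weight = regular_weight +
  assumes cut: "\<And>X. X \<subseteq> V \<Longrightarrow> odd (card X) \<Longrightarrow> r \<le> edge_weight \<mu> X (V - X)"
begin

lemma even_card: "r > 0 \<Longrightarrow> even (card V)"
  using cut[of V] by auto

lemma cut_not_tight:
  assumes "X \<subseteq> V" "odd (card X)" "edge_weight \<mu> X (V - X) \<noteq> r"
  shows "r + 2 \<le> edge_weight \<mu> X (V - X)"
proof -
  have "edge_weight \<mu> X (V - X) \<noteq> r + 1" using cut_parity[OF assms(1,2)] by (metis even_plus_one_iff)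
  then show ?thesis using cut[OF assms(1,2)] assms(3) by simp
qed

text \<open>A barrier is impossible by counting: every member sends its whole cut, at least r edges,
  into \<open>S\<close>, while \<open>S\<close> can receive at most r times
  \<open>card S\<close>.\<close>

lemma ex_supported_pairing:
  assumes "r > 0"
  shows "\<exists>\<sigma>. pairing V \<sigma> \<and> (\<forall>v\<in>V. 0 < \<mu> v (\<sigma> v))"
proof -
  define E where "E = (\<lambda>u v. u \<in> V \<and> v \<in> V \<and> 0 < \<mu> u v)"
  have Esym: "\<And>u v. E u v \<Longrightarrow> E v u" using sym unfolding E_def by auto
  consider \<sigma> where "pairing V \<sigma>" "\<forall>v\<in>V. E v (\<sigma> v)" | S \<C> where "barrier V E S \<C>"
    using pairing_or_barrier[OF fin, of E] Esym by blast
  then show ?thesis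
  proof cases
    case 1 then show ?thesis unfolding E_def by blast
  next
    case 2
    have S: "S \<subseteq> V" and cC: "finite \<C>" "card S < card \<C>" "pairwise disjnt \<C>"
      and C: "\<And>C. C \<in> \<C> \<Longrightarrow> C \<subseteq> V - S" "\<And>C. C \<in> \<C> \<Longrightarrow> odd (card C)"
      using 2 unfolding barrier_def by simp_all
    have CE: "\<not> E u v" if "C \<in> \<C>" "u \<in> C" "v \<in> V - S - C" for C u v
      using 2 that unfolding barrier_def by metis
    have cutC: "r \<le> edge_weight \<mu> C S" if "C \<in> \<C>" for C
    proof -
      have CV: "C \<subseteq> V" using C that by blast
      have "V - C = S \<union> (V - S - C)" using S C that by blast
      then have "edge_weight \<mu> C (V - C) = edge_weight \<mu> C S + edge_weight \<mu> C (V - S - C)"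
        using edge_weight_Un_right[of S "V - S - C" \<mu> C] S fin fin_sub by auto
      moreover have "edge_weight \<mu> C (V - S - C) = 0"
        unfolding edge_weight_def using CE[OF that] CV unfolding E_def
        by (intro sum.neutral ballI) auto
      ultimately show ?thesis using cut[OF CV C(2)[OF that]] by simp
    qed
    have UV: "\<Union>\<C> \<subseteq> V - S" using C by blast
    have "card \<C> * r \<le> (\<Sum>C\<in>\<C>. edge_weight \<mu> C S)"
      using sum_bounded_below[of \<C> r "\<lambda>C. edge_weight \<mu> C S"] cutC by simp
    also have "\<dots> = edge_weight \<mu> (\<Union>\<C>) S"
      unfolding edge_weight_def
    proof (subst sum.Union_disjoint)
      show "\<forall>A\<in>\<C>. finite A" using C(1) fin by (meson Diff_subset finite_subset subset_trans)
    qed (use cC in \<open>auto simp: pairwise_def disjnt_def\<close>)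
    also have "\<dots> \<le> edge_weight \<mu> V S" using UV S fin fin_sub by (intro edge_weight_mono) auto
    also have "\<dots> = r * card S" using edge_weight_commute[OF _ S, of V] edge_weight_total[OF S] by simp
    finally show ?thesis using cC assms by (simp add: mult.commute)
  qed
qed

end

section \<open>Decompositions into pairings and the deletion of one pairing\<close>

lemma decomposable_0:
  assumes "regular_weight V \<mu> 0"
  shows "decomposable 0 V \<mu>"
proof -
  interpret regular_weight V \<mu> 0 by fact
  show ?thesis using deg fin by (simp add: decomposable_def)
qed

lemma decomposable_Suc:
  assumes "decomposable r V \<nu>" "pairing V \<sigma>"
    and "\<And>u v. u \<in> V \<Longrightarrow> v \<in> V \<Longrightarrow> \<mu> u v = \<nu> u v + pairing_weight \<sigma> u v"
  shows "decomposable (Suc r) V \<mu>"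
proof -
  obtain f where f: "\<forall>i<r. pairing V (f i)" "\<forall>u\<in>V. \<forall>v\<in>V. \<nu> u v = (\<Sum>i<r. pairing_weight (f i) u v)"
    using assms(1) unfolding decomposable_def by blast
  have "\<forall>i<Suc r. pairing V ((f(r := \<sigma>)) i)" using f assms(2) by (auto simp: less_Suc_eq)
  moreover have "\<forall>u\<in>V. \<forall>v\<in>V. \<mu> u v = (\<Sum>i<Suc r. pairing_weight ((f(r := \<sigma>)) i) u v)"
    using f assms(3) by simp
  ultimately show ?thesis unfolding decomposable_def by blast
qed

lemma decomposable_cong:
  assumes "decomposable r V \<nu>" "\<And>u v. u \<in> V \<Longrightarrow> v \<in> V \<Longrightarrow> \<mu> u v = \<nu> u v"
  shows "decomposable r V \<mu>"
  using assms unfolding decomposable_def by simp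

text \<open>The assumption \<open>cr\<close> is the odd-cut condition for the remaining weight.
  Since subtraction on \<open>nat\<close> truncates, the second conclusion records that nothing is
  cut off.\<close>

lemma remove_pairing:
  assumes "r_weight V \<mu> (Suc r)" "pairing V \<sigma>" "\<forall>v\<in>V. 0 < \<mu> v (\<sigma> v)"
    and cr: "\<And>X. X \<subseteq> V \<Longrightarrow> odd (card X) \<Longrightarrow>
      edge_weight (pairing_weight \<sigma>) X (V - X) + r \<le> edge_weight \<mu> X (V - X)"
  shows "r_weight V (\<lambda>u v. \<mu> u v - pairing_weight \<sigma> u v) r"
    and "\<And>u v. u \<in> V \<Longrightarrow> v \<in> V \<Longrightarrow> \<mu> u v = (\<mu> u v - pairing_weight \<sigma> u v) + pairing_weight \<sigma> u v"
proof -
  interpret r_weight V \<mu> "Suc r" by fact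
  interpret s: regular_weight V "pairing_weight \<sigma>" 1 using pairing_regular_weight fin assms by blast
  let ?\<nu> = "\<lambda>u v. \<mu> u v - pairing_weight \<sigma> u v"
  show eq: "\<mu> u v = ?\<nu> u v + pairing_weight \<sigma> u v" if "u \<in> V" "v \<in> V" for u v
    using assms(3) that by auto
  show "r_weight V ?\<nu> r"
  proof
    show "finite V" by (rule fin)
    show "?\<nu> u v = ?\<nu> v u" if "u \<in> V" "v \<in> V" for u v
      using sym[OF that] s.sym[OF that] by simp
    show "?\<nu> v v = 0" if "v \<in> V" for v using zero[OF that] by simp
    show "(\<Sum>u\<in>V. ?\<nu> v u) = r" if "v \<in> V" for v
    proof -
      have "(\<Sum>u\<in>V. \<mu> v u) = (\<Sum>u\<in>V. ?\<nu> v u + pairing_weight \<sigma> v u)"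
        using eq that by (intro sum.cong) auto
      also have "\<dots> = (\<Sum>u\<in>V. ?\<nu> v u) + (\<Sum>u\<in>V. pairing_weight \<sigma> v u)" by (rule sum.distrib)
      finally show ?thesis using deg[OF that] s.deg[OF that] by simp
    qed
    show "r \<le> edge_weight ?\<nu> X (V - X)" if X: "X \<subseteq> V" "odd (card X)" for X
    proof -
      have "edge_weight \<mu> X (V - X) = edge_weight (\<lambda>u v. ?\<nu> u v + pairing_weight \<sigma> u v) X (V - X)"
        by (intro edge_weight_cong eq) (use X in auto)
      then show ?thesis using cr[OF X] by (simp add: edge_weight_add)
    qed
  qed
qed

subsection \<open>Tight cuts\<close>

text \<open>\<open>X\<close> is shrunk to one vertex, named after an element \<open>x0\<close> of
  \<open>X\<close>. Reusing an old element keeps the vertex type, so that an induction over sets of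
  that type can treat the contraction.\<close>

definition contract :: "'a set \<Rightarrow> 'a \<Rightarrow> ('a \<Rightarrow> 'a \<Rightarrow> nat) \<Rightarrow> 'a \<Rightarrow> 'a \<Rightarrow> nat" where
  "contract X x0 \<mu> u v =
     (if u = x0 then if v = x0 then 0 else edge_weight \<mu> X {v}
      else if v = x0 then edge_weight \<mu> {u} X else \<mu> u v)"

lemma card_bij_betw_vimage:
  assumes "bij_betw h A F" "B \<subseteq> F"
  shows "card {i\<in>A. h i \<in> B} = card B"
proof -
  have "h ` {i\<in>A. h i \<in> B} = B"
  proof (intro equalityI subsetI)
    fix b assume b: "b \<in> B"
    then obtain i where "i \<in> A" "h i = b"
      using assms by (metis bij_betw_imp_surj_on imageE subsetD)
    then show "b \<in> h ` {i\<in>A. h i \<in> B}" using b by blast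
  qed auto
  moreover have "inj_on h {i\<in>A. h i \<in> B}"
    using assms(1) unfolding bij_betw_def by (auto intro: inj_on_subset)
  ultimately show ?thesis using card_image by metis
qed

text \<open>Fibres of equal size can be matched up one by one. This serves to assign parallel edges,
  both along a tight cut and in an isomorphism, where only the number of edges with given ends is
  known.\<close>

lemma bij_betw_fibres:
  assumes "finite I" "finite J"
    and "\<And>a. card {i\<in>I. f i = a} = card {j\<in>J. g j = a}"
  shows "\<exists>h. bij_betw h I J \<and> (\<forall>i\<in>I. g (h i) = f i)"
proof -
  have "\<exists>h. bij_betw h {i\<in>I. f i = a} {j\<in>J. g j = a}" for a
    using assms by (intro finite_same_card_bij) auto
  then obtain h where h: "\<And>a. bij_betw (h a) {i\<in>I. f i = a} {j\<in>J. g j = a}" by metis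
  have hJ: "h (f i) i \<in> J \<and> g (h (f i) i) = f i" if "i \<in> I" for i
    using h[of "f i"] that unfolding bij_betw_def by blast
  have "bij_betw (\<lambda>i. h (f i) i) I J"
    unfolding bij_betw_def
  proof
    show "inj_on (\<lambda>i. h (f i) i) I"
    proof (rule inj_onI)
      fix i i' assume i: "i \<in> I" "i' \<in> I" and eq: "h (f i) i = h (f i') i'"
      then have ff: "f i = f i'" using hJ by metis
      have "inj_on (h (f i)) {i'\<in>I. f i' = f i}" using h bij_betw_def by blast
      then show "i = i'" using i eq ff unfolding inj_on_def by simp
    qed
    show "(\<lambda>i. h (f i) i) ` I = J"
    proof
      show "(\<lambda>i. h (f i) i) ` I \<subseteq> J" using hJ by blast
      show "J \<subseteq> (\<lambda>i. h (f i) i) ` I"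
      proof
        fix j assume "j \<in> J"
        then have "j \<in> h (g j) ` {i\<in>I. f i = g j}" using h[of "g j"] unfolding bij_betw_def by blast
        then obtain i where "i \<in> I" "f i = g j" "j = h (g j) i" by blast
        then have "j = h (f i) i" by simp
        then show "j \<in> (\<lambda>i. h (f i) i) ` I" using \<open>i \<in> I\<close> by blast
      qed
    qed
  qed
  then show ?thesis using hJ by blast
qed

context r_weight
begin

text \<open>Tightness makes the degree of the contracted vertex equal to r. An odd set containing
  \<open>x0\<close> becomes, with \<open>x0\<close> expanded to \<open>X\<close>, a set of the same
  parity because \<open>card X\<close> is odd, and with the same cut.\<close>

lemma contract_r_weight:
  assumes X: "X \<subseteq> V" "odd (card X)" "x0 \<in> X" and tight: "edge_weight \<mu> X (V - X) = r"
  shows "r_weight (insert x0 (V - X)) (contract X x0 \<mu>) r"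
proof
  let ?V = "insert x0 (V - X)" and ?\<mu> = "contract X x0 \<mu>"
  have fX: "finite X" using X fin_sub by blast
  show "finite ?V" using fin by simp
  show "?\<mu> u v = ?\<mu> v u" if "u \<in> ?V" "v \<in> ?V" for u v
    using that X sym edge_weight_commute[of X "{v}"] edge_weight_commute[of X "{u}"]
    by (auto simp: contract_def)
  show "?\<mu> v v = 0" if "v \<in> ?V" for v using that zero by (auto simp: contract_def)
  have ZW: "edge_weight ?\<mu> Z W = edge_weight \<mu> Z W" if "Z \<subseteq> V - X" "W \<subseteq> V - X" for Z W
    using that X by (intro edge_weight_cong) (auto simp: contract_def)
  have xW: "edge_weight ?\<mu> {x0} W = edge_weight \<mu> X W" if "W \<subseteq> V - X" for W
  proof -
    have "edge_weight ?\<mu> {x0} W = (\<Sum>w\<in>W. \<Sum>x\<in>X. \<mu> x w)"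
      unfolding edge_weight_def using that X
      by (simp, intro sum.cong) (auto simp: contract_def edge_weight_def)
    also have "\<dots> = edge_weight \<mu> X W" unfolding edge_weight_def by (rule sum.swap)
    finally show ?thesis .
  qed
  have Zx: "edge_weight ?\<mu> Z {x0} = edge_weight \<mu> Z X" if "Z \<subseteq> V - X" for Z
    unfolding edge_weight_def using that X
    by (simp, intro sum.cong) (auto simp: contract_def edge_weight_def)
  have fW: "finite W" "x0 \<notin> W" if "W \<subseteq> V - X" for W
    using that fin X finite_subset[of W "V - X"] by auto
  show "(\<Sum>u\<in>?V. ?\<mu> v u) = r" if "v \<in> ?V" for v
  proof -
    have "(\<Sum>u\<in>?V. ?\<mu> v u) = edge_weight ?\<mu> {v} ?V" by (simp add: edge_weight_def)
    also have "\<dots> = edge_weight ?\<mu> {v} {x0} + edge_weight ?\<mu> {v} (V - X)"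
      using fW[of "V - X"] by (intro edge_weight_insert_right) auto
    also have "\<dots> = r"
    proof (cases "v = x0")
      case True
      have "edge_weight ?\<mu> {x0} {x0} = 0" by (simp add: edge_weight_def contract_def)
      then show ?thesis using True xW[of "V - X"] tight by simp
    next
      case False
      then have v: "v \<in> V - X" using that by simp
      have "edge_weight \<mu> {v} V = edge_weight \<mu> {v} X + edge_weight \<mu> {v} (V - X)"
        using edge_weight_Un_right[of X "V - X" \<mu> "{v}"] fin fX X by (simp add: Un_absorb1)
      then show ?thesis using Zx[of "{v}"] ZW[of "{v}" "V - X"] edge_weight_total[of "{v}"] v by simp
    qed
    finally show ?thesis .
  qed
  show "r \<le> edge_weight ?\<mu> Z (?V - Z)" if Z: "Z \<subseteq> ?V" "odd (card Z)" for Z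
  proof (cases "x0 \<in> Z")
    case True
    define Y where "Y = Z - {x0}"
    define W where "W = V - X - Y"
    have Y: "Y \<subseteq> V - X" "Z = insert x0 Y" "x0 \<notin> Y" "finite Y"
      using Z True fW[of Y] unfolding Y_def by auto
    have XY: "X \<inter> Y = {}" using Y by auto
    have W: "?V - Z = W" "W \<subseteq> V - X" "W = V - (X \<union> Y)" using Y X unfolding W_def by auto
    have "edge_weight ?\<mu> Z (?V - Z) = edge_weight \<mu> X W + edge_weight \<mu> Y W"
      using W Y xW ZW edge_weight_insert_left[of Y x0 ?\<mu> W] by simp
    also have "\<dots> = edge_weight \<mu> (X \<union> Y) W"
      using edge_weight_Un_left[OF fX Y(4) XY] by simp
    also have "\<dots> \<ge> r"
    proof -
      have "card (X \<union> Y) = card X + card Y" using fX Y XY by (intro card_Un_disjoint)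
      moreover have "card Z = Suc (card Y)" using Y by simp
      ultimately have "odd (card (X \<union> Y))" using X Z by simp
      then show ?thesis using cut[of "X \<union> Y"] X Y W by auto
    qed
    finally show ?thesis .
  next
    case False
    then have ZX: "Z \<subseteq> V - X" using Z by auto
    define W where "W = V - X - Z"
    have W: "?V - Z = insert x0 W" "W \<subseteq> V - X" "V - Z = X \<union> W"
      using False ZX X unfolding W_def by auto
    have "edge_weight ?\<mu> Z (?V - Z) = edge_weight \<mu> Z X + edge_weight \<mu> Z W"
      using W Zx ZW ZX fW edge_weight_insert_right[of W x0 ?\<mu> Z] by simp
    also have "\<dots> = edge_weight \<mu> Z (V - Z)"
      using edge_weight_Un_right[OF fX fW(1)[OF W(2)], of \<mu> Z] W(2,3) by fastforce
    also have "\<dots> \<ge> r" using cut[of Z] ZX Z by auto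
    finally show ?thesis .
  qed
qed

text \<open>
  Every part of a decomposition of a contraction uses exactly one edge at the contracted vertex,
  so the parts of the two decompositions can be matched up along the edges of the tight cut.
\<close>

lemma decomposable_glue:
  assumes X: "X \<subseteq> V" "x0 \<in> X" "y0 \<in> V - X"
    and dX: "decomposable r (insert x0 (V - X)) (contract X x0 \<mu>)"
    and dY: "decomposable r (insert y0 X) (contract (V - X) y0 \<mu>)"
  shows "decomposable r V \<mu>"
proof -
  define Y where "Y = V - X"
  have fX: "finite X" and fY: "finite Y" using X fin fin_sub unfolding Y_def by auto
  have VXY: "V = X \<union> Y" "X \<inter> Y = {}" and Y: "y0 \<in> Y" "x0 \<notin> Y" "y0 \<notin> X" "Y \<subseteq> V"
    using X unfolding Y_def by auto
  obtain \<sigma> where s: "\<And>i. i < r \<Longrightarrow> pairing (insert x0 Y) (\<sigma> i)"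
    and sm: "\<And>u v. u \<in> insert x0 Y \<Longrightarrow> v \<in> insert x0 Y \<Longrightarrow>
      contract X x0 \<mu> u v = (\<Sum>i<r. pairing_weight (\<sigma> i) u v)"
    using dX unfolding decomposable_def Y_def by blast
  obtain \<tau> where t: "\<And>i. i < r \<Longrightarrow> pairing (insert y0 X) (\<tau> i)"
    and tm: "\<And>u v. u \<in> insert y0 X \<Longrightarrow> v \<in> insert y0 X \<Longrightarrow>
      contract Y y0 \<mu> u v = (\<Sum>i<r. pairing_weight (\<tau> i) u v)"
    using dY unfolding decomposable_def Y_def by blast
  have cnt: "(\<Sum>i<r. of_bool (P i)) = card {i\<in>{..<r}. P i}" for P
    by (simp add: of_bool_def sum.If_cases Int_def)
  \<comment> \<open>The edges of the cut as triples; the third component tells parallel edges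
    apart.\<close>
  define F where "F = (SIGMA x:X. SIGMA y:Y. {..<\<mu> x y})"
  have fF: "finite F" unfolding F_def using fX fY by auto
  have s0: "\<sigma> i x0 \<in> Y" "\<sigma> i (\<sigma> i x0) = x0" if "i < r" for i
    using s[OF that] unfolding pairing_def by auto
  have t0: "\<tau> i y0 \<in> X" "\<tau> i (\<tau> i y0) = y0" if "i < r" for i
    using t[OF that] unfolding pairing_def by auto
  have "card {i\<in>{..<r}. \<sigma> i x0 = y} = card {e\<in>F. fst (snd e) = y}" for y
  proof (cases "y \<in> Y")
    case True
    have "{e\<in>F. fst (snd e) = y} = (SIGMA x:X. {y} \<times> {..<\<mu> x y})" unfolding F_def using True by auto
    then have "card {e\<in>F. fst (snd e) = y} = (\<Sum>x\<in>X. \<mu> x y)" using fX by (simp add: card_cartesian_product)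
    also have "\<dots> = contract X x0 \<mu> x0 y" using True Y by (auto simp: contract_def edge_weight_def)
    also have "\<dots> = card {i\<in>{..<r}. \<sigma> i x0 = y}" using sm[of x0 y] True cnt by simp
    finally show ?thesis by simp
  next
    case False
    then have "{e\<in>F. fst (snd e) = y} = {}" "{i\<in>{..<r}. \<sigma> i x0 = y} = {}" using s0 unfolding F_def by auto
    then show ?thesis by (simp only: card.empty)
  qed
  \<comment> \<open>\<open>h\<close> gives each part of the first decomposition its own cut edge,
    with the end in \<open>Y\<close> that this part prescribes for \<open>x0\<close>.\<close>
  then obtain h where h: "bij_betw h {..<r} F" "\<And>i. i < r \<Longrightarrow> fst (snd (h i)) = \<sigma> i x0"
    using bij_betw_fibres[of "{..<r}" F "\<lambda>i. \<sigma> i x0" "\<lambda>e. fst (snd e)"] fF by auto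
  have "card {e\<in>F. fst e = x} = card {i\<in>{..<r}. \<tau> i y0 = x}" for x
  proof (cases "x \<in> X")
    case True
    have "{e\<in>F. fst e = x} = {x} \<times> (SIGMA y:Y. {..<\<mu> x y})" unfolding F_def using True by auto
    then have "card {e\<in>F. fst e = x} = (\<Sum>y\<in>Y. \<mu> x y)" using fY by (simp add: card_cartesian_product)
    also have "\<dots> = (\<Sum>y\<in>Y. \<mu> y x)" using sym True X Y by (intro sum.cong) auto
    also have "\<dots> = contract Y y0 \<mu> y0 x" using True Y by (auto simp: contract_def edge_weight_def)
    also have "\<dots> = card {i\<in>{..<r}. \<tau> i y0 = x}" using tm[of y0 x] True cnt by simp
    finally show ?thesis by simp
  next
    case False
    then have "{e\<in>F. fst e = x} = {}" "{i\<in>{..<r}. \<tau> i y0 = x} = {}" using t0 unfolding F_def by auto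
    then show ?thesis by (simp only: card.empty)
  qed
  then obtain g where g: "bij_betw g F {..<r}" "\<And>e. e \<in> F \<Longrightarrow> \<tau> (g e) y0 = fst e"
    using bij_betw_fibres[of F "{..<r}" fst "\<lambda>i. \<tau> i y0"] fF by auto
  \<comment> \<open>Part \<open>k i\<close> of the second decomposition uses the same cut edge as
    part \<open>i\<close> of the first, so the two are glued to \<open>\<rho> i\<close>.\<close>
  define k where "k i = g (h i)" for i
  have k: "bij_betw k {..<r} {..<r}"
    using bij_betw_trans[OF h(1) g(1)] unfolding k_def comp_def .
  have kr: "k i < r" if "i < r" for i using k that unfolding bij_betw_def by auto
  define \<rho> where "\<rho> i v = (if v \<in> Y then if v = \<sigma> i x0 then \<tau> (k i) y0 else \<sigma> i v
      else if v = \<tau> (k i) y0 then \<sigma> i x0 else \<tau> (k i) v)" for i v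
  have hF: "h i \<in> F" if "i < r" for i using h(1) that unfolding bij_betw_def by auto
  have tk: "\<tau> (k i) y0 = fst (h i)" if "i < r" for i unfolding k_def using g(2) hF[OF that] by simp
  have rp: "pairing V (\<rho> i)" if i: "i < r" for i
    unfolding pairing_def
  proof
    fix v assume v: "v \<in> V"
    have a: "\<sigma> i x0 \<in> Y" "\<tau> (k i) y0 \<in> X" "\<tau> (k i) y0 \<notin> Y" using s0[OF i] t0[OF kr[OF i]] VXY by auto
    show "\<rho> i v \<in> V \<and> \<rho> i v \<noteq> v \<and> \<rho> i (\<rho> i v) = v"
    proof (cases "v \<in> Y")
      case True
      have b: "\<sigma> i v \<in> insert x0 Y" "\<sigma> i v \<noteq> v" "\<sigma> i (\<sigma> i v) = v" using s[OF i] True unfolding pairing_def by auto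
      show ?thesis
      proof (cases "v = \<sigma> i x0")
        case True
        then show ?thesis using a VXY unfolding \<rho>_def by auto
      next
        case False
        then have "\<sigma> i v \<noteq> x0" using b by auto
        moreover have "\<sigma> i v \<noteq> \<sigma> i x0" using b s0[OF i] True Y by metis
        ultimately show ?thesis using a b True False VXY unfolding \<rho>_def by auto
      qed
    next
      case False
      then have vX: "v \<in> X" using v VXY by auto
      have b: "\<tau> (k i) v \<in> insert y0 X" "\<tau> (k i) v \<noteq> v" "\<tau> (k i) (\<tau> (k i) v) = v"
        using t[OF kr[OF i]] vX unfolding pairing_def by auto
      show ?thesis
      proof (cases "v = \<tau> (k i) y0")
        case True
        then show ?thesis using a VXY unfolding \<rho>_def by auto
      next
        case F: False
        then have c: "\<tau> (k i) v \<noteq> y0" using b by auto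
        moreover have "\<tau> (k i) v \<noteq> \<tau> (k i) y0" using b t0[OF kr[OF i]] vX Y by metis
        moreover have "\<tau> (k i) v \<in> X" using b c by simp
        moreover have "\<tau> (k i) v \<notin> Y" using calculation VXY by auto
        ultimately show ?thesis using a b F False VXY unfolding \<rho>_def by auto
      qed
    qed
  qed
  have "\<mu> u v = (\<Sum>i<r. pairing_weight (\<rho> i) u v)" if uv: "u \<in> V" "v \<in> V" for u v
  proof -
    have XY: "\<mu> u v = (\<Sum>i<r. pairing_weight (\<rho> i) u v)" if "u \<in> X" "v \<in> Y" for u v
    proof -
      have uY: "u \<notin> Y" using that VXY by auto
      have "\<rho> i u = v \<longleftrightarrow> h i \<in> {u} \<times> {v} \<times> {..<\<mu> u v}" if i: "i < r" for i
      proof -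
        have "\<tau> (k i) u \<noteq> v" if "u \<noteq> \<tau> (k i) y0"
        proof
          assume "\<tau> (k i) u = v"
          moreover have "\<tau> (k i) u \<in> insert y0 X" using t[OF kr[OF i]] \<open>u \<in> X\<close> unfolding pairing_def by auto
          ultimately have "\<tau> (k i) u = y0" using \<open>v \<in> Y\<close> VXY by auto
          then show False using that t[OF kr[OF i]] \<open>u \<in> X\<close> unfolding pairing_def by (metis insertCI)
        qed
        then have "\<rho> i u = v \<longleftrightarrow> u = \<tau> (k i) y0 \<and> v = \<sigma> i x0"
          unfolding \<rho>_def using uY by auto
        also have "\<dots> \<longleftrightarrow> fst (h i) = u \<and> fst (snd (h i)) = v" using tk[OF i] h(2)[OF i] by auto
        also have "\<dots> \<longleftrightarrow> h i \<in> {u} \<times> {v} \<times> {..<\<mu> u v}"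
          using hF[OF i] unfolding F_def by (cases "h i") auto
        finally show ?thesis .
      qed
      then have "{i\<in>{..<r}. \<rho> i u = v} = {i\<in>{..<r}. h i \<in> {u} \<times> {v} \<times> {..<\<mu> u v}}" by auto
      moreover have "{u} \<times> {v} \<times> {..<\<mu> u v} \<subseteq> F" using that unfolding F_def by auto
      ultimately have "card {i\<in>{..<r}. \<rho> i u = v} = \<mu> u v"
        using card_bij_betw_vimage[OF h(1)] by (simp only: card_cartesian_product) simp
      then show ?thesis using cnt[of "\<lambda>i. \<rho> i u = v"] by simp
    qed
    consider "u \<in> X" "v \<in> Y" | "u \<in> Y" "v \<in> X" | "u \<in> Y" "v \<in> Y" | "u \<in> X" "v \<in> X"
      using uv VXY by auto
    then show ?thesis
    proof cases
      case 1 then show ?thesis by (rule XY)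
    next
      case 2
      have "\<mu> u v = (\<Sum>i<r. pairing_weight (\<rho> i) v u)" using XY[OF 2(2,1)] sym[OF uv] by simp
      also have "\<dots> = (\<Sum>i<r. pairing_weight (\<rho> i) u v)"
      proof (intro sum.cong refl)
        fix i assume "i \<in> {..<r}"
        then have "pairing V (\<rho> i)" using rp by simp
        then have "\<rho> i v = u \<longleftrightarrow> \<rho> i u = v" using uv unfolding pairing_def by metis
        then show "pairing_weight (\<rho> i) v u = (pairing_weight (\<rho> i) u v :: nat)" by simp
      qed
      finally show ?thesis .
    next
      case 3
      have "\<rho> i u = v \<longleftrightarrow> \<sigma> i u = v" if i: "i < r" for i
        using 3 t0[OF kr[OF i]] s0[OF i] VXY Y unfolding \<rho>_def by auto
      then have "(\<Sum>i<r. pairing_weight (\<rho> i) u v) = (\<Sum>i<r. pairing_weight (\<sigma> i) u v)"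
        by (intro sum.cong) auto
      also have "\<dots> = contract X x0 \<mu> u v" using sm[of u v] 3 by simp
      also have "\<dots> = \<mu> u v" using 3 Y by (auto simp: contract_def)
      finally show ?thesis by simp
    next
      case 4
      have "\<rho> i u = v \<longleftrightarrow> \<tau> (k i) u = v" if i: "i < r" for i
        using 4 t0[OF kr[OF i]] s0[OF i] VXY Y unfolding \<rho>_def by auto
      then have "(\<Sum>i<r. pairing_weight (\<rho> i) u v) = (\<Sum>i<r. pairing_weight (\<tau> (k i)) u v)"
        by (intro sum.cong) auto
      also have "\<dots> = (\<Sum>i<r. pairing_weight (\<tau> i) u v)"
        using sum.reindex_bij_betw[OF k, of "\<lambda>i. pairing_weight (\<tau> i) u v"] .
      also have "\<dots> = contract Y y0 \<mu> u v" using tm[of u v] 4 by simp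
      also have "\<dots> = \<mu> u v" using 4 Y by (auto simp: contract_def)
      finally show ?thesis by simp
    qed
  qed
  then show ?thesis unfolding decomposable_def using rp by blast
qed

text \<open>Each contraction replaces at least three vertices by one and so loses at least two; this
  is the reason for the bound in \<open>IH\<close>. For ten vertices it means at most eight.\<close>

lemma decomposable_tight_cut:
  assumes IH: "\<And>(W :: 'a set) \<nu>. card W < card V - 1 \<Longrightarrow> r_weight W \<nu> r \<Longrightarrow> decomposable r W \<nu>"
    and X: "X \<subseteq> V" "odd (card X)" "3 \<le> card X" "3 \<le> card (V - X)" "edge_weight \<mu> X (V - X) = r"
    and "r > 0"
  shows "decomposable r V \<mu>"
proof -
  have fX: "finite X" using X fin_sub by blast
  have c: "card (V - X) = card V - card X" "card X \<le> card V" using X fX fin by (auto simp: card_Diff_subset card_mono)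
  obtain x0 where x0: "x0 \<in> X" using X by fastforce
  have "V - X \<noteq> {}" using X(4) by (metis card.empty not_numeral_le_zero)
  then obtain y0 where y0: "y0 \<in> V - X" by blast
  have odd': "odd (card (V - X))" using even_card assms c by simp
  have dd: "V - (V - X) = X" using X by auto
  have "decomposable r (insert x0 (V - X)) (contract X x0 \<mu>)"
    using x0 X c fin by (intro IH contract_r_weight) auto
  moreover have "r_weight (insert y0 (V - (V - X))) (contract (V - X) y0 \<mu>) r"
    using y0 X odd' cut_compl[OF X(1)] by (intro contract_r_weight) auto
  then have "decomposable r (insert y0 X) (contract (V - X) y0 \<mu>)"
    using y0 X c fX unfolding dd by (intro IH) auto
  ultimately show ?thesis using decomposable_glue X x0 y0 by blast
qed

end

section \<open>At most eight vertices\<close>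

text \<open>The induction runs over the sum of order and degree: contraction lowers the order,
  deletion of a matching lowers the degree. Without nontrivial tight cuts every nontrivial odd cut
  has at least r + 2 = q + 3 edges, so 3 crossings are affordable.\<close>

lemma r_weight_decomposable_card_le_8:
  fixes \<mu> :: "'a \<Rightarrow> 'a \<Rightarrow> nat"
  assumes "r_weight V \<mu> r" "card V \<le> 8"
  shows "decomposable r V \<mu>"
  using assms
proof (induction "card V + r" arbitrary: V \<mu> r rule: less_induct)
  case less
  interpret r_weight V \<mu> r by (rule less.prems)
  show ?case
  proof (cases r)
    case 0
    then show ?thesis using decomposable_0[of V \<mu>] regular_weight_axioms by simp
  next
    case (Suc q)
    show ?thesis
    proof (cases "\<exists>X \<subseteq> V. odd (card X) \<and> 3 \<le> card X \<and> 3 \<le> card (V - X) \<and> edge_weight \<mu> X (V - X) = r")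
      case True
      then obtain X where X: "X \<subseteq> V" "odd (card X)" "3 \<le> card X" "3 \<le> card (V - X)" "edge_weight \<mu> X (V - X) = r"
        by blast
      have IH: "decomposable r W \<nu>" if "card W < card V - 1" "r_weight W \<nu> r" for W :: "'a set" and \<nu>
        using that less.prems by (intro less.hyps) auto
      have "r > 0" using Suc by simp
      with IH X show ?thesis by (intro decomposable_tight_cut)
    next
      case False
      obtain \<sigma> where s: "pairing V \<sigma>" "\<forall>v\<in>V. 0 < \<mu> v (\<sigma> v)" using ex_supported_pairing Suc by blast
      have cr: "edge_weight (pairing_weight \<sigma>) X (V - X) + q \<le> edge_weight \<mu> X (V - X)"
        if X: "X \<subseteq> V" "odd (card X)" for X
      proof -
        note pc = pairing_cut[OF fin s(1) X]
        have fX: "finite X" using X fin_sub by blast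
        have c: "card (V - X) = card V - card X" "card X \<le> card V"
          using X fX fin by (auto simp: card_Diff_subset card_mono)
        have odd': "odd (card (V - X))" using even_card Suc X c by simp
        show ?thesis
        proof (cases "3 \<le> card X \<and> 3 \<le> card (V - X)")
          case True
          then have "r + 2 \<le> edge_weight \<mu> X (V - X)" using cut_not_tight X False by blast
          \<comment> \<open>More than 3 crossings need at least four vertices on each side, hence
            five since both sides are odd, and then ten in all.\<close>
          moreover have "edge_weight (pairing_weight \<sigma>) X (V - X) \<le> 3"
          proof (rule ccontr)
            assume "\<not> ?thesis"
            then have "4 \<le> card X" "4 \<le> card (V - X)" using pc by auto
            moreover have "card X \<noteq> 4" "card (V - X) \<noteq> 4" using X odd' by auto
            ultimately show False using c less.prems by linarith
          qed
          ultimately show ?thesis using Suc by simp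
        next
          case False
          have "card X \<noteq> 2" "card (V - X) \<noteq> 2" using X odd' by auto
          moreover have "card X \<noteq> 0" "card (V - X) \<noteq> 0" using X odd' by (metis dvd_0_right)+

          ultimately have "card X = 1 \<or> card (V - X) = 1" using False by linarith
          then have "edge_weight (pairing_weight \<sigma>) X (V - X) \<le> 1" using pc by auto
          then show ?thesis using cut[OF X] Suc by simp
        qed
      qed
      have rp: "r_weight V (\<lambda>u v. \<mu> u v - pairing_weight \<sigma> u v) q"
        and eq: "\<And>u v. u \<in> V \<Longrightarrow> v \<in> V \<Longrightarrow> \<mu> u v = (\<mu> u v - pairing_weight \<sigma> u v) + pairing_weight \<sigma> u v"
        using remove_pairing[OF _ s cr] r_weight_axioms Suc by blast+
      have "decomposable q V (\<lambda>u v. \<mu> u v - pairing_weight \<sigma> u v)"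
        using rp less.prems Suc by (intro less.hyps) auto
      then show ?thesis using decomposable_Suc[OF _ s(1) eq] Suc by blast
    qed
  qed
qed

lemma r_weight_tight_cut_card_10:
  assumes "r_weight V \<mu> r" "card V \<le> 10" "r > 0"
    and "X \<subseteq> V" "odd (card X)" "3 \<le> card X" "3 \<le> card (V - X)" "edge_weight \<mu> X (V - X) = r"
  shows "decomposable r V \<mu>"
  using r_weight.decomposable_tight_cut[OF assms(1) _ assms(4-8,3)] r_weight_decomposable_card_le_8 assms(2)
  by fastforce

subsection \<open>Ten vertices without tight cuts\<close>

definition supported :: "'a set \<Rightarrow> ('a \<Rightarrow> 'a \<Rightarrow> nat) \<Rightarrow> ('a \<Rightarrow> 'a) \<Rightarrow> bool" where
  "supported V \<mu> \<sigma> \<longleftrightarrow> pairing V \<sigma> \<and> (\<forall>v\<in>V. 0 < \<mu> v (\<sigma> v))"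

context regular_weight
begin

lemma supported_edge_weight:
  assumes "supported V \<mu> \<sigma>" "Z \<subseteq> V" "W \<subseteq> V"
  shows "card {z\<in>Z. \<sigma> z \<in> W} \<le> edge_weight \<mu> Z W"
proof -
  have "edge_weight (pairing_weight \<sigma>) Z W \<le> edge_weight \<mu> Z W"
    unfolding edge_weight_def
  proof (intro sum_mono)
    fix z w assume "z \<in> Z" "w \<in> W"
    then show "pairing_weight \<sigma> z w \<le> \<mu> z w" using assms unfolding supported_def by (auto simp: Suc_le_eq)
  qed
  then show ?thesis using edge_weight_pairing fin_sub assms by metis
qed

text \<open>The bookkeeping for uncrossing. The first four equations give: the cuts of
  \<open>X\<close> and \<open>Y\<close> exceed those of \<open>A\<close> and \<open>B\<close>
  together by twice the weight between \<open>C\<close> and \<open>D\<close>.\<close>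

lemma four_cells:
  assumes X: "X \<subseteq> V" and Y: "Y \<subseteq> V"
  defines "A \<equiv> X \<inter> Y" and "B \<equiv> V - (X \<union> Y)" and "C \<equiv> X - Y" and "D \<equiv> Y - X"
  defines "e \<equiv> edge_weight \<mu>"
  shows "e X (V - X) = e A B + e A D + e B C + e C D"
    and "e Y (V - Y) = e A B + e A C + e B D + e C D"
    and "e A (V - A) = e A B + e A C + e A D"
    and "e B (V - B) = e A B + e B C + e B D"
    and "e A A + e A B + e A C + e A D = r * card A"
    and "e B B + e A B + e B C + e B D = r * card B"
    and "e C C + e A C + e B C + e C D = r * card C"
    and "e D D + e A D + e B D + e C D = r * card D"
proof -
  have s: "A \<subseteq> V" "B \<subseteq> V" "C \<subseteq> V" "D \<subseteq> V" unfolding A_def B_def C_def D_def using X Y by auto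
  note f = s[THEN fin_sub]
  have d: "A \<inter> B = {}" "A \<inter> C = {}" "A \<inter> D = {}" "B \<inter> C = {}" "B \<inter> D = {}" "C \<inter> D = {}"
    unfolding A_def B_def C_def D_def by auto
  have u: "X = A \<union> C" "V - X = B \<union> D" "Y = A \<union> D" "V - Y = B \<union> C"
    "V - A = B \<union> (C \<union> D)" "V - B = A \<union> (C \<union> D)" "V - C = A \<union> (B \<union> D)" "V - D = A \<union> (B \<union> C)"
    unfolding A_def B_def C_def D_def using X Y by auto
  have com: "e B A = e A B" "e C A = e A C" "e D A = e A D" "e C B = e B C" "e D B = e B D" "e D C = e C D"
    unfolding e_def using edge_weight_commute s by auto
  have L: "e (P \<union> Q) Z = e P Z + e Q Z" if "finite P" "finite Q" "P \<inter> Q = {}" for P Q Z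
    unfolding e_def using edge_weight_Un_left that by blast
  have R: "e Z (P \<union> Q) = e Z P + e Z Q" if "finite P" "finite Q" "P \<inter> Q = {}" for P Q Z
    unfolding e_def using edge_weight_Un_right that by blast
  have d': "A \<inter> (C \<union> D) = {}" "B \<inter> (C \<union> D) = {}" "A \<inter> (B \<union> D) = {}" "A \<inter> (B \<union> C) = {}" using d by auto
  note LR = L[OF f(1) f(3) d(2)] L[OF f(1) f(4) d(3)] R[OF f(2) f(4) d(5)] R[OF f(2) f(3) d(4)] R[OF f(3) f(4) d(6)]
    R[OF f(2) finite_UnI[OF f(3) f(4)] d'(2)] R[OF f(1) finite_UnI[OF f(3) f(4)] d'(1)]
    R[OF f(1) finite_UnI[OF f(2) f(4)] d'(3)] R[OF f(1) finite_UnI[OF f(2) f(3)] d'(4)]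
  have "e (A \<union> C) (B \<union> D) = e A B + e A D + e B C + e C D" by (simp add: LR com)
  then show "e X (V - X) = e A B + e A D + e B C + e C D" by (simp only: u(2)) (simp only: u(1))
  have "e (A \<union> D) (B \<union> C) = e A B + e A C + e B D + e C D" by (simp add: LR com)
  then show "e Y (V - Y) = e A B + e A C + e B D + e C D" by (simp only: u(4)) (simp only: u(3))
  show a: "e A (V - A) = e A B + e A C + e A D" by (simp add: u(5) LR)
  show b: "e B (V - B) = e A B + e B C + e B D" by (simp add: u(6) LR com)
  have c: "e C (V - C) = e A C + e B C + e C D" by (simp add: u(7) LR com)
  have d: "e D (V - D) = e A D + e B D + e C D" by (simp add: u(8) LR com)
  show "e A A + e A B + e A C + e A D = r * card A" using edge_weight_split[OF s(1)] a unfolding e_def by simp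
  show "e B B + e A B + e B C + e B D = r * card B" using edge_weight_split[OF s(2)] b unfolding e_def by simp
  show "e C C + e A C + e B C + e C D = r * card C" using edge_weight_split[OF s(3)] c unfolding e_def by simp
  show "e D D + e A D + e B D + e C D = r * card D" using edge_weight_split[OF s(4)] d unfolding e_def by simp
qed

text \<open>Different 2-sets may share a vertex but not an ordered pair of different vertices, and
  diagonal pairs weigh nothing.\<close>

lemma sum_edge_weight_pairs:
  assumes "X \<subseteq> V" "\<And>C. C \<in> \<K> \<Longrightarrow> C \<subseteq> X \<and> card C = 2"
  shows "(\<Sum>C\<in>\<K>. edge_weight \<mu> C C) \<le> edge_weight \<mu> X X"
proof -
  have fX: "finite X" using assms fin_sub by blast
  have fK: "finite \<K>" using assms(2) fX by (meson PowI finite_Pow_iff finite_subset subsetI)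
  define off where "off C = {p \<in> C \<times> C. fst p \<noteq> snd p}" for C :: "'a set"
  have off: "edge_weight \<mu> C C = (\<Sum>p\<in>off C. \<mu> (fst p) (snd p))" if "C \<subseteq> X" for C
  proof -
    have fC: "finite C" using that fX finite_subset by blast
    have "edge_weight \<mu> C C = (\<Sum>p\<in>C \<times> C. \<mu> (fst p) (snd p))"
      by (simp add: edge_weight_def sum.cartesian_product case_prod_beta)
    also have "\<dots> = (\<Sum>p\<in>off C. \<mu> (fst p) (snd p))"
      unfolding off_def using fC zero that assms(1) by (intro sum.mono_neutral_right) auto
    finally show ?thesis .
  qed
  have disj: "off C \<inter> off C' = {}" if C: "C \<in> \<K>" "C' \<in> \<K>" "C \<noteq> C'" for C C'
  proof (rule ccontr)
    assume "off C \<inter> off C' \<noteq> {}"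
    then obtain x y where xy: "x \<in> C" "y \<in> C" "x \<in> C'" "y \<in> C'" "x \<noteq> y" unfolding off_def by auto
    have "C = {x, y}" using assms(2)[OF C(1)] xy by (metis card_2_iff doubleton_eq_iff insertE singletonD)
    moreover have "C' = {x, y}" using assms(2)[OF C(2)] xy by (metis card_2_iff doubleton_eq_iff insertE singletonD)
    ultimately show False using C by simp
  qed
  have "(\<Sum>C\<in>\<K>. edge_weight \<mu> C C) = (\<Sum>C\<in>\<K>. \<Sum>p\<in>off C. \<mu> (fst p) (snd p))"
    using assms(2) off by (intro sum.cong) auto
  also have "\<dots> = (\<Sum>p\<in>(\<Union>C\<in>\<K>. off C). \<mu> (fst p) (snd p))"
  proof (rule sum.UNION_disjoint[symmetric])
    show "\<forall>C\<in>\<K>. finite (off C)"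
      unfolding off_def using assms(2) fX finite_subset by (metis finite_Collect_conjI finite_cartesian_product Collect_mem_eq)
  qed (use fK disj in auto)
  also have "\<dots> \<le> (\<Sum>p\<in>off X. \<mu> (fst p) (snd p))"
    by (intro sum_mono2) (use assms(2) fX in \<open>auto simp: off_def\<close>)
  also have "\<dots> = edge_weight \<mu> X X" using off[of X] by simp
  finally show ?thesis .
qed

end

section \<open>Full sets: the obstructions to deleting a perfect matching\<close>

locale ten_weight = r_weight +
  assumes card_V: "card V = 10"
    and no_tight: "\<And>X. X \<subseteq> V \<Longrightarrow> odd (card X) \<Longrightarrow> 3 \<le> card X \<Longrightarrow> 3 \<le> card (V - X) \<Longrightarrow>
      r + 2 \<le> edge_weight \<mu> X (V - X)"
begin

text \<open>The obstruction to deleting \<open>\<sigma>\<close>: all five vertices of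
  \<open>X\<close> are matched across the cut, so r - 3 of its r + 2 edges would remain, two fewer
  than an (r - 1)-graph requires.\<close>

definition full :: "'a set \<Rightarrow> ('a \<Rightarrow> 'a) \<Rightarrow> bool" where
  "full X \<sigma> \<longleftrightarrow> X \<subseteq> V \<and> card X = 5 \<and> edge_weight \<mu> X (V - X) = r + 2 \<and>
     supported V \<mu> \<sigma> \<and> \<sigma> ` X \<subseteq> V - X"

lemma card_compl: "X \<subseteq> V \<Longrightarrow> card (V - X) = 10 - card X"
  using card_V fin_sub by (simp add: card_Diff_subset)

lemma crossing_cases:
  assumes "pairing V \<sigma>" "X \<subseteq> V" "odd (card X)"
  shows "edge_weight (pairing_weight \<sigma>) X (V - X) \<le> 1 \<or>
    edge_weight (pairing_weight \<sigma>) X (V - X) = 3 \<and> 3 \<le> card X \<and> 3 \<le> card (V - X) \<or>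
    edge_weight (pairing_weight \<sigma>) X (V - X) = 5 \<and> card X = 5 \<and> \<sigma> ` X \<subseteq> V - X"
proof -
  let ?c = "edge_weight (pairing_weight \<sigma>) X (V - X)"
  note pc = pairing_cut[OF fin assms]
  have "?c \<le> 5" using pc(2,3) card_compl[OF assms(2)] by linarith
  moreover have "?c \<noteq> 2" "?c \<noteq> 4" using pc(1) by auto
  moreover have "\<sigma> ` X \<subseteq> V - X \<and> card X = 5" if "?c = 5"
  proof -
    have fX: "finite X" using assms fin_sub by blast
    have c5: "card X = 5" using that pc(2,3) card_compl[OF assms(2)] by linarith
    have "card {x\<in>X. \<sigma> x \<in> V - X} = card X"
      using that c5 edge_weight_pairing[OF fX, of "V - X" \<sigma>] fin by simp
    then have "{x\<in>X. \<sigma> x \<in> V - X} = X" using fX by (intro card_subset_eq) auto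
    then show ?thesis using c5 by blast
  qed
  moreover have "3 \<le> card X \<and> 3 \<le> card (V - X)" if "?c = 3" using that pc(2,3) by simp
  ultimately show ?thesis by linarith
qed

text \<open>With q = r - 1, one crossing needs a cut of r edges, three need r + 2, five need r + 4.
  The last can fail only at r + 2, since r + 3 has the wrong parity, and such a set is full.\<close>

lemma removable:
  assumes s: "supported V \<mu> \<sigma>" and r: "r = Suc q" and nf: "\<And>X. \<not> full X \<sigma>"
    and X: "X \<subseteq> V" "odd (card X)"
  shows "edge_weight (pairing_weight \<sigma>) X (V - X) + q \<le> edge_weight \<mu> X (V - X)"
proof -
  have p: "pairing V \<sigma>" using s unfolding supported_def by blast
  from crossing_cases[OF p X] consider
      "edge_weight (pairing_weight \<sigma>) X (V - X) \<le> 1"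
    | "edge_weight (pairing_weight \<sigma>) X (V - X) = 3" "3 \<le> card X" "3 \<le> card (V - X)"
    | "edge_weight (pairing_weight \<sigma>) X (V - X) = 5" "card X = 5" "\<sigma> ` X \<subseteq> V - X" by blast
  then show ?thesis
  proof cases
    case 1 then show ?thesis using cut[OF X] r by simp
  next
    case 2 then show ?thesis using no_tight[OF X] r by simp
  next
    case 3
    have "edge_weight \<mu> X (V - X) \<noteq> r + 2" using nf[of X] 3 X s unfolding full_def by blast
    moreover have "edge_weight \<mu> X (V - X) \<noteq> r + 3" using cut_parity[OF X] by (auto simp: numeral_3_eq_3)
    moreover have "r + 2 \<le> edge_weight \<mu> X (V - X)" using no_tight[OF X] 3 card_compl[OF X(1)] by simp
    ultimately show ?thesis using 3 r by simp
  qed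
qed

lemma full_compl:
  assumes "full X \<sigma>"
  shows "full (V - X) \<sigma>"
proof -
  have X: "X \<subseteq> V" "card X = 5" "edge_weight \<mu> X (V - X) = r + 2" "supported V \<mu> \<sigma>" "\<sigma> ` X \<subseteq> V - X"
    using assms unfolding full_def by auto
  have p: "\<And>v. v \<in> V \<Longrightarrow> \<sigma> v \<in> V \<and> \<sigma> (\<sigma> v) = v" using X(4) unfolding supported_def pairing_def by blast
  have "inj_on \<sigma> X" using p X(1) by (metis inj_onI subsetD)
  then have "\<sigma> ` X = V - X" using X card_compl fin by (intro card_subset_eq) (auto simp: card_image)
  then have "\<sigma> ` (V - X) \<subseteq> X" using p X(1) by (force simp: image_iff)
  then show ?thesis unfolding full_def using X cut_compl card_compl by (auto simp: double_diff)
qed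

lemma full_image:
  assumes "full X \<sigma>" "x \<in> V"
  shows "x \<in> X \<longleftrightarrow> \<sigma> x \<notin> X"
proof
  show "\<sigma> x \<notin> X" if "x \<in> X" using assms(1) that unfolding full_def by auto
  show "x \<in> X" if "\<sigma> x \<notin> X"
  proof (rule ccontr)
    assume "x \<notin> X"
    then have "\<sigma> x \<in> V - (V - X)" using full_compl[OF assms(1)] assms(2) unfolding full_def by auto
    then show False using that by auto
  qed
qed

lemma supported_props:
  assumes "supported V \<mu> \<sigma>" "v \<in> V"
  shows "\<sigma> v \<in> V" "\<sigma> (\<sigma> v) = v" "\<sigma> v \<noteq> v"
  using assms unfolding supported_def pairing_def by blast+

lemma card_supported_into:
  assumes "supported V \<mu> \<sigma>" "Z \<subseteq> V" "W \<subseteq> V"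
  shows "card {z\<in>Z. \<sigma> z \<in> W} \<le> card W"
proof (rule card_inj_on_le[of \<sigma>])
  show "inj_on \<sigma> {z \<in> Z. \<sigma> z \<in> W}"
  proof (rule inj_onI)
    fix x y assume "x \<in> {z \<in> Z. \<sigma> z \<in> W}" "y \<in> {z \<in> Z. \<sigma> z \<in> W}" "\<sigma> x = \<sigma> y"
    then show "x = y" using supported_props(2)[OF assms(1)] assms(2) by (metis (no_types, lifting) mem_Collect_eq subsetD)
  qed
qed (use assms fin_sub in auto)

text \<open>Otherwise \<open>?A\<close> and \<open>?B\<close> are single vertices with cuts of size
  r, and uncrossing gives only two edges between \<open>?C\<close> and \<open>?D\<close>. But
  \<open>\<sigma>\<close> matches the four vertices of \<open>?C\<close> out of \<open>X\<close>, at
  most one of them into \<open>?B\<close>, so at least three into \<open>?D\<close>.\<close>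

lemma full_inter_ne_1:
  assumes "full X \<sigma>" "full Y \<tau>"
  shows "card (X \<inter> Y) \<noteq> 1"
proof
  assume 1: "card (X \<inter> Y) = 1"
  have X: "X \<subseteq> V" "card X = 5" "edge_weight \<mu> X (V - X) = r + 2" "supported V \<mu> \<sigma>" "\<sigma> ` X \<subseteq> V - X"
    using assms unfolding full_def by auto
  have Y: "Y \<subseteq> V" "card Y = 5" "edge_weight \<mu> Y (V - Y) = r + 2"
    using assms unfolding full_def by auto
  have f: "finite X" "finite Y" using X Y fin_sub by auto
  let ?A = "X \<inter> Y" and ?B = "V - (X \<union> Y)" and ?C = "X - Y" and ?D = "Y - X"
  have cU: "card (X \<union> Y) = 9" using card_Un_Int[OF f] X Y 1 by simp
  have cB: "card ?B = 1" using card_compl[of "X \<union> Y"] X Y cU by simp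
  have cC: "card ?C = 4" using card_Diff_subset_Int[of X Y] X 1 f by simp
  have z: "edge_weight \<mu> Z Z = 0" if "card Z = 1" "Z \<subseteq> V" for Z
    using that zero by (auto simp: card_1_singleton_iff edge_weight_def)
  note fc = four_cells[OF X(1) Y(1)]
  have "edge_weight \<mu> ?A ?A = 0" "edge_weight \<mu> ?B ?B = 0" using z[OF 1] z[OF cB] X(1) by auto
  then have "edge_weight \<mu> ?A ?B + edge_weight \<mu> ?A ?C + edge_weight \<mu> ?A ?D = r"
    "edge_weight \<mu> ?A ?B + edge_weight \<mu> ?B ?C + edge_weight \<mu> ?B ?D = r"
    using fc(5,6) 1 cB by simp_all
  then have "edge_weight \<mu> ?C ?D = 2"
    using fc(1,2) X(3) Y(3) by linarith
  moreover have "3 \<le> card {z\<in>?C. \<sigma> z \<in> ?D}"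
  proof -
    have "card {z\<in>?C. \<sigma> z \<in> ?B} \<le> card ?B"
      using X by (intro card_supported_into) auto
    moreover have "?C = {z\<in>?C. \<sigma> z \<in> ?B} \<union> {z\<in>?C. \<sigma> z \<in> ?D}" using X by auto
    then have "card ?C \<le> card {z\<in>?C. \<sigma> z \<in> ?B} + card {z\<in>?C. \<sigma> z \<in> ?D}" by (metis card_Un_le)
    ultimately show ?thesis using cB cC by simp
  qed
  moreover have "card {z\<in>?C. \<sigma> z \<in> ?D} \<le> edge_weight \<mu> ?C ?D"
    using X Y by (intro supported_edge_weight) auto
  ultimately show False by simp
qed

text \<open>Uncrossing is tight here, so no edge joins \<open>C\<close> and \<open>D\<close>. Hence
  \<open>\<sigma>\<close> matches \<open>C\<close> into \<open>B\<close> and \<open>D\<close> into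
  \<open>A\<close>, and the third vertex of \<open>A\<close> into \<open>B\<close>. This bounds the
  weights between the cells from below, and the weights inside \<open>C\<close> and \<open>D\<close>
  follow by counting degrees.\<close>

lemma full_inter_3:
  assumes "full X \<sigma>" "full Y \<tau>" "card (X \<inter> Y) = 3"
  defines "A \<equiv> X \<inter> Y" and "B \<equiv> V - (X \<union> Y)" and "C \<equiv> X - Y" and "D \<equiv> Y - X"
  shows "edge_weight \<mu> C D = 0" "edge_weight \<mu> A C = edge_weight \<mu> B C" "edge_weight \<mu> A D = edge_weight \<mu> B D"
    "edge_weight \<mu> A (V - A) = r + 2"
    "card B = 3" "card C = 2" "card D = 2" "3 \<le> r"
    "2 * r - 2 \<le> edge_weight \<mu> C C + edge_weight \<mu> D D"
    "edge_weight \<mu> C C + 4 \<le> 2 * r" "edge_weight \<mu> D D + 4 \<le> 2 * r"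
proof -
  have X: "X \<subseteq> V" "card X = 5" "edge_weight \<mu> X (V - X) = r + 2" "supported V \<mu> \<sigma>" "\<sigma> ` X \<subseteq> V - X"
    using assms unfolding full_def by auto
  have Y: "Y \<subseteq> V" "card Y = 5" "edge_weight \<mu> Y (V - Y) = r + 2"
    using assms unfolding full_def by auto
  have f: "finite X" "finite Y" using X Y fin_sub by auto
  have cU: "card (X \<union> Y) = 7" using card_Un_Int[OF f] X Y assms(3) by simp
  have cA: "card A = 3" unfolding A_def by (rule assms(3))
  show cB: "card B = 3" unfolding B_def using card_compl[of "X \<union> Y"] X Y cU by simp
  show cC: "card C = 2" unfolding C_def using card_Diff_subset_Int[of X Y] X assms(3) f by simp
  show cD: "card D = 2" unfolding D_def using card_Diff_subset_Int[of Y X] Y assms(3) f by (simp add: Int_commute)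
  have s: "A \<subseteq> V" "B \<subseteq> V" "C \<subseteq> V" "D \<subseteq> V" unfolding A_def B_def C_def D_def using X Y by auto
  note fc = four_cells[OF X(1) Y(1), folded A_def B_def C_def D_def]
  have "r + 2 \<le> edge_weight \<mu> A (V - A)" using no_tight[OF s(1)] cA card_compl[OF s(1)] by simp
  moreover have "r + 2 \<le> edge_weight \<mu> B (V - B)" using no_tight[OF s(2)] cB card_compl[OF s(2)] by simp
  \<comment> \<open>The cuts of \<open>X\<close> and \<open>Y\<close> sum to 2r + 4 and those of
    \<open>A\<close> and \<open>B\<close> to at least 2r + 4, so the excess, twice the weight
    between \<open>C\<close> and \<open>D\<close>, vanishes.\<close>
  ultimately show cd: "edge_weight \<mu> C D = 0" and acbc: "edge_weight \<mu> A C = edge_weight \<mu> B C"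
    and adbd: "edge_weight \<mu> A D = edge_weight \<mu> B D" and cutA: "edge_weight \<mu> A (V - A) = r + 2"
    using fc(1-4) X(3) Y(3) by linarith+
  have CD: "\<sigma> z \<notin> D" if "z \<in> C" for z
  proof
    assume "\<sigma> z \<in> D"
    then have "\<mu> z (\<sigma> z) \<le> edge_weight \<mu> C D"
      using that s fin_sub by (intro edge_weight_le) auto
    moreover have "0 < \<mu> z (\<sigma> z)" using X(4) that s unfolding supported_def by auto
    ultimately show False using cd by simp
  qed
  have sV: "\<sigma> z \<in> V" "\<sigma> (\<sigma> z) = z" if "z \<in> V" for z using supported_props[OF X(4)] that by auto
  have fi: "\<sigma> z \<notin> X" if "z \<in> X" for z using X(5) that by auto
  have "{z\<in>C. \<sigma> z \<in> B} = C"
    using CD fi sV X(1) unfolding B_def C_def D_def by auto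
  then have bc: "2 \<le> edge_weight \<mu> B C"
    using supported_edge_weight[OF X(4) s(3) s(2)] cC edge_weight_commute[OF s(3) s(2)] by simp
  have "{z\<in>D. \<sigma> z \<in> A} = D"
  proof -
    have "\<sigma> z \<in> A" if z: "z \<in> D" for z
    proof -
      have zV: "z \<in> V" "z \<notin> X" using z Y(1) unfolding D_def by auto
      have "\<sigma> z \<in> X" using full_image[OF assms(1) zV(1)] zV by blast
      moreover have "\<sigma> z \<notin> C" using CD[of "\<sigma> z"] sV[OF zV(1)] z by auto
      ultimately show ?thesis unfolding A_def C_def by auto
    qed
    then show ?thesis by auto
  qed
  then have ad: "2 \<le> edge_weight \<mu> A D"
    using supported_edge_weight[OF X(4) s(4) s(1)] cD edge_weight_commute[OF s(4) s(1)] by simp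
  have ab: "1 \<le> edge_weight \<mu> A B"
  proof -
    have "card {z\<in>A. \<sigma> z \<in> D} \<le> card D"
      using card_supported_into[OF X(4) s(1,4)] .
    moreover have "A \<subseteq> {z\<in>A. \<sigma> z \<in> B} \<union> {z\<in>A. \<sigma> z \<in> D}"
    proof
      fix z assume z: "z \<in> A"
      then have "\<sigma> z \<in> V" "\<sigma> z \<notin> X" using fi sV s(1) unfolding A_def by blast+
      then show "z \<in> {z\<in>A. \<sigma> z \<in> B} \<union> {z\<in>A. \<sigma> z \<in> D}" using z unfolding B_def D_def by blast
    qed
    then have "A = {z\<in>A. \<sigma> z \<in> B} \<union> {z\<in>A. \<sigma> z \<in> D}" by blast
    then have "card A \<le> card {z\<in>A. \<sigma> z \<in> B} + card {z\<in>A. \<sigma> z \<in> D}" by (metis card_Un_le)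
    ultimately have "1 \<le> card {z\<in>A. \<sigma> z \<in> B}" using cA cD by simp
    then show ?thesis using supported_edge_weight[OF X(4) s(1) s(2)] by simp
  qed
  have e: "edge_weight \<mu> A B + edge_weight \<mu> A D + edge_weight \<mu> B C = r + 2" using fc(1) X(3) cd by simp
  then show "3 \<le> r" using ab ad bc by simp
  have CC: "edge_weight \<mu> C C + 2 * edge_weight \<mu> B C = 2 * r" using fc(7) cd acbc cC by simp
  have DD: "edge_weight \<mu> D D + 2 * edge_weight \<mu> A D = 2 * r" using fc(8) cd adbd cD by simp
  show "2 * r - 2 \<le> edge_weight \<mu> C C + edge_weight \<mu> D D" using CC DD e ab by linarith
  show "edge_weight \<mu> C C + 4 \<le> 2 * r" using CC bc by simp
  show "edge_weight \<mu> D D + 4 \<le> 2 * r" using DD ad by simp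
qed

text \<open>If \<open>Y\<close> and \<open>Z\<close> differ, then X, Y and Z pairwise meet exactly
  in the 3-set \<open>A\<close>, and one vertex \<open>w\<close> lies outside all three. Applying
  \<open>full_inter_3\<close> to each pair shows that no edges run between the three remaining
  2-sets and that each of these receives as many edges from \<open>w\<close> as from
  \<open>A\<close>. So the cut of \<open>w\<close> equals that of \<open>A\<close>, which is r + 2,
  while a vertex has degree r.\<close>

lemma full_inter_eq:
  assumes X: "full X \<sigma>" and Y: "full Y \<tau>" and Z: "full Z \<upsilon>"
    and c: "card (X \<inter> Y) = 3" and XYZ: "X \<inter> Y = X \<inter> Z"
  shows "Y = Z"
proof (rule ccontr)
  assume ne: "Y \<noteq> Z"
  have Xp: "X \<subseteq> V" "card X = 5" and Yp: "Y \<subseteq> V" "card Y = 5" and Zp: "Z \<subseteq> V" "card Z = 5"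
    using X Y Z unfolding full_def by auto
  have f: "finite X" "finite Y" "finite Z" using Xp Yp Zp fin_sub by auto
  have sub: "X \<inter> Y \<subseteq> Y \<inter> Z" using XYZ by auto
  have "3 \<le> card (Y \<inter> Z)" using card_mono[OF _ sub] f c by simp
  moreover have "card (Y \<inter> Z) \<noteq> 5"
    using ne Yp Zp f by (metis Int_lower1 Int_lower2 card_subset_eq)
  moreover have "card (Y \<inter> Z) \<le> 5" using card_mono[of Y "Y \<inter> Z"] Yp f by simp
  moreover have "card (Y \<inter> Z) \<noteq> 4"
  proof
    assume "card (Y \<inter> Z) = 4"
    then have "card (Y - Z) = 1" using card_Diff_subset_Int[of Y Z] Yp f by simp
    moreover have "Y \<inter> (V - Z) = Y - Z" using Yp by auto
    ultimately show False using full_inter_ne_1[OF Y full_compl[OF Z]] by simp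
  qed
  ultimately have c3: "card (Y \<inter> Z) = 3" by linarith
  then have eq: "Y \<inter> Z = X \<inter> Y" using sub f c by (metis card_subset_eq finite_Int)
  define A where "A = X \<inter> Y"
  define C where "C = X - Y"
  define D where "D = Y - X"
  define D' where "D' = Z - X"
  define W where "W = V - (X \<union> Y \<union> Z)"
  have cells: "X \<inter> Z = A" "Y \<inter> Z = A" "X - Z = C" "Y - Z = D" "Z - Y = D'"
    "V - (X \<union> Y) = D' \<union> W" "V - (X \<union> Z) = D \<union> W" "V - (Y \<union> Z) = C \<union> W" "V - A = C \<union> (D \<union> (D' \<union> W))"
    "V - W = A \<union> (C \<union> (D \<union> D'))"
    unfolding A_def C_def D_def D'_def W_def using XYZ eq Xp Yp Zp by auto
  have disj: "D' \<inter> W = {}" "D \<inter> W = {}" "C \<inter> W = {}" "C \<inter> (D \<union> (D' \<union> W)) = {}" "D \<inter> (D' \<union> W) = {}"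
     "A \<inter> (C \<union> (D \<union> D')) = {}" "C \<inter> (D \<union> D') = {}" "D \<inter> D' = {}"
    unfolding A_def C_def D_def D'_def W_def using XYZ eq by auto
  have s: "A \<subseteq> V" "C \<subseteq> V" "D \<subseteq> V" "D' \<subseteq> V" "W \<subseteq> V"
    unfolding A_def C_def D_def D'_def W_def using Xp Yp Zp by auto
  note fs = s[THEN fin_sub]
  let ?e = "edge_weight \<mu>"
  note xy = full_inter_3[OF X Y c, folded A_def C_def D_def, unfolded cells]
  have c': "card (X \<inter> Z) = 3" using c XYZ by simp
  note xz = full_inter_3[OF X Z c', folded D'_def, unfolded cells]
  note yz = full_inter_3[OF Y Z c3, unfolded cells]
  have "?e A C = ?e W C"
    using xy(2) edge_weight_Un_left[OF fs(4,5) disj(1), of \<mu> C] xz(1) edge_weight_commute[OF s(2) s(4)] by simp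
  moreover have "?e A D = ?e W D"
    using xy(3) edge_weight_Un_left[OF fs(4,5) disj(1), of \<mu> D] yz(1) edge_weight_commute[OF s(3) s(4)] by simp
  moreover have "?e A D' = ?e W D'"
    using xz(3) edge_weight_Un_left[OF fs(3,5) disj(2), of \<mu> D'] yz(1) by simp
  moreover have "?e A (V - A) = ?e A C + ?e A D + ?e A D' + ?e A W"
    unfolding cells(9) using edge_weight_Un_right[OF fs(2) _ disj(4), of \<mu> A]
      edge_weight_Un_right[OF fs(3) _ disj(5), of \<mu> A] edge_weight_Un_right[OF fs(4,5) disj(1), of \<mu> A] fs by simp
  moreover have "?e W (V - W) = ?e W A + ?e W C + ?e W D + ?e W D'"
    unfolding cells(10) using edge_weight_Un_right[OF fs(1) _ disj(6), of \<mu> W]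
      edge_weight_Un_right[OF fs(2) _ disj(7), of \<mu> W] edge_weight_Un_right[OF fs(3,4) disj(8), of \<mu> W] fs by simp
  moreover have "?e W A = ?e A W" using edge_weight_commute s by blast
  moreover have "?e A (V - A) = r + 2" using full_inter_3(4)[OF X Y c] unfolding A_def .
  ultimately have "?e W (V - W) = r + 2" by linarith
  moreover have "card W = 1"
  proof -
    have "card (D' \<union> W) = card D' + card W" using disj fs by (intro card_Un_disjoint)
    then show ?thesis using xy(5) xz(7) by simp
  qed
  then obtain w where "W = {w}" by (auto simp: card_1_singleton_iff)
  then have "?e W (V - W) = r" using edge_weight_vertex s by simp
  ultimately show False by simp
qed

end

section \<open>Doubling the weight\<close>

context ten_weight
begin

lemma double_r_weight: "r_weight V (\<lambda>u v. 2 * \<mu> u v) (2 * r)"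
proof
  show "(\<Sum>u\<in>V. 2 * \<mu> v u) = 2 * r" if "v \<in> V" for v
    using deg[OF that] by (simp flip: sum_distrib_left)
  show "2 * r \<le> edge_weight (\<lambda>u v. 2 * \<mu> u v) X (V - X)" if "X \<subseteq> V" "odd (card X)" for X
    using cut[OF that] by (simp add: edge_weight_scale)
qed (use fin sym zero in auto)

text \<open>Removing \<open>\<sigma>\<close> from \<open>2\<mu>\<close> leaves 2(r + 2) - 5 = 2r - 1
  edges in the cut of \<open>X\<close>, so that cut is tight and the remainder decomposes. Doubling
  adds no new adjacent pairs; hence the parts are again supported by \<open>\<mu>\<close>.\<close>

lemma double_decomposition:
  assumes X: "full X \<sigma>" and r: "r > 0"
  shows "\<exists>N. (\<forall>i<2 * r - 1. supported V \<mu> (N i)) \<and>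
    (\<forall>u\<in>V. \<forall>v\<in>V. 2 * \<mu> u v = pairing_weight \<sigma> u v + (\<Sum>i<2 * r - 1. pairing_weight (N i) u v))"
proof -
  have Xp: "X \<subseteq> V" "card X = 5" "edge_weight \<mu> X (V - X) = r + 2" "supported V \<mu> \<sigma>" "\<sigma> ` X \<subseteq> V - X"
    using X unfolding full_def by auto
  have p: "pairing V \<sigma>" using Xp unfolding supported_def by auto
  define \<nu> where "\<nu> = (\<lambda>u v. 2 * \<mu> u v - pairing_weight \<sigma> u v)"
  \<comment> \<open>The critical case is five crossings of a cut of size r + 2: 5 + (2r - 1) = 2(r +
    2).\<close>
  have cr: "edge_weight (pairing_weight \<sigma>) Z (V - Z) + (2 * r - 1) \<le> edge_weight (\<lambda>u v. 2 * \<mu> u v) Z (V - Z)"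
    if Z: "Z \<subseteq> V" "odd (card Z)" for Z
    using crossing_cases[OF p Z] cut[OF Z] no_tight[OF Z] r card_compl[OF Z(1)]
    unfolding edge_weight_scale by linarith
  have "r_weight V (\<lambda>u v. 2 * \<mu> u v) (Suc (2 * r - 1))" using double_r_weight r by simp
  moreover have "\<forall>v\<in>V. 0 < 2 * \<mu> v (\<sigma> v)" using Xp(4) unfolding supported_def by simp
  ultimately have rp: "r_weight V \<nu> (2 * r - 1)"
    and eq: "\<And>u v. u \<in> V \<Longrightarrow> v \<in> V \<Longrightarrow> 2 * \<mu> u v = \<nu> u v + pairing_weight \<sigma> u v"
    using remove_pairing[of V "\<lambda>u v. 2 * \<mu> u v" "2 * r - 1" \<sigma>] p cr unfolding \<nu>_def by blast+
  have cX: "edge_weight (pairing_weight \<sigma>) X (V - X) = 5"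
  proof -
    have "{x \<in> X. \<sigma> x \<in> V - X} = X" using Xp(5) by auto
    then show ?thesis using edge_weight_pairing[of X "V - X" \<sigma>] Xp fin fin_sub by simp
  qed
  have "edge_weight (\<lambda>u v. 2 * \<mu> u v) X (V - X) = edge_weight (\<lambda>u v. \<nu> u v + pairing_weight \<sigma> u v) X (V - X)"
    by (intro edge_weight_cong eq) (use Xp in auto)
  then have "edge_weight \<nu> X (V - X) = 2 * r - 1"
    unfolding edge_weight_add edge_weight_scale cX Xp(3) by simp
  then have "decomposable (2 * r - 1) V \<nu>"
    using r_weight_tight_cut_card_10[OF rp, of X] card_V card_compl[OF Xp(1)] Xp r by simp
  then obtain N where N: "\<And>i. i < 2 * r - 1 \<Longrightarrow> pairing V (N i)"
    and Ns: "\<And>u v. u \<in> V \<Longrightarrow> v \<in> V \<Longrightarrow> \<nu> u v = (\<Sum>i<2 * r - 1. pairing_weight (N i) u v)"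
    unfolding decomposable_def by blast
  have "supported V \<mu> (N i)" if i: "i < 2 * r - 1" for i
    unfolding supported_def
  proof (intro conjI ballI N[OF i])
    fix v assume v: "v \<in> V"
    then have w: "N i v \<in> V" using N[OF i] unfolding pairing_def by blast
    have "(1::nat) = pairing_weight (N i) v (N i v)" by simp
    also have "\<dots> \<le> (\<Sum>j<2 * r - 1. pairing_weight (N j) v (N i v))"
      using i by (intro member_le_sum) auto
    also have "\<dots> \<le> 2 * \<mu> v (N i v)" using eq[OF v w] Ns[OF v w] by simp
    finally show "0 < \<mu> v (N i v)" by simp
  qed
  then show ?thesis using eq Ns by (intro exI[of _ N]) auto
qed

text \<open>\<open>\<tau>\<close> is full for a set and for its complement, and these meet
  \<open>X\<close> in sizes that add up to 5. The split 0 + 5 would make \<open>\<tau>\<close> full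
  for \<open>X\<close>, and 1 + 4 is excluded by \<open>full_inter_ne_1\<close>; from 2 + 3 the
  larger one is taken.\<close>

lemma full_inter_3_ex:
  assumes X: "full X \<sigma>" and Y: "full Y \<tau>" and nX: "\<not> full X \<tau>"
  shows "\<exists>Y. full Y \<tau> \<and> card (X \<inter> Y) = 3"
proof -
  have Xp: "X \<subseteq> V" "card X = 5" using X unfolding full_def by auto
  have fX: "finite X" using Xp fin_sub by blast
  have Yp: "Y \<subseteq> V" "card Y = 5" using Y unfolding full_def by auto
  have cc: "card (X \<inter> (V - Y)) = 5 - card (X \<inter> Y)"
  proof -
    have "X \<inter> (V - Y) = X - Y" using Xp by auto
    then show ?thesis using card_Diff_subset_Int[of X Y] fX Xp by simp
  qed
  have le: "card (X \<inter> Y) \<le> 5" using card_mono[of X "X \<inter> Y"] fX Xp by simp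
  have 1: "card (X \<inter> Y) \<noteq> 1" using full_inter_ne_1[OF X Y] .
  have 4: "card (X \<inter> Y) \<noteq> 4" using full_inter_ne_1[OF X full_compl[OF Y]] cc by simp
  have 5: "card (X \<inter> Y) \<noteq> 5"
  proof
    assume "card (X \<inter> Y) = 5"
    then have "X = Y" using Xp Yp fin_sub by (metis Int_lower1 Int_lower2 card_subset_eq)
    then show False using nX Y by simp
  qed
  have 0: "card (X \<inter> Y) \<noteq> 0"
  proof
    assume "card (X \<inter> Y) = 0"
    then have "card (X \<inter> (V - Y)) = 5" using cc by simp
    then have "X \<inter> (V - Y) = X" using fX Xp by (intro card_subset_eq) auto
    moreover have "X \<inter> (V - Y) = V - Y"
      using \<open>card (X \<inter> (V - Y)) = 5\<close> card_compl[OF Yp(1)] Yp fin by (intro card_subset_eq) auto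
    ultimately have "X = V - Y" by simp
    then show False using nX full_compl[OF Y] by simp
  qed
  show ?thesis
  proof (cases "card (X \<inter> Y) = 3")
    case True then show ?thesis using Y by blast
  next
    case False
    then have "card (X \<inter> Y) = 2" using le 0 1 4 5 by linarith
    then show ?thesis using full_compl[OF Y] cc by (intro exI[of _ "V - Y"]) simp
  qed
qed

text \<open>Every part of \<open>2\<mu> - \<sigma>\<close> provides a 2-set inside \<open>X\<close>
  and one outside. No 2-set arises twice, while the number of edges available inside
  \<open>X\<close> and inside its complement is fixed; for large r these edges do not
  suffice.\<close>

theorem all_full_degree_3:
  assumes r: "r > 0" and bad: "\<And>\<sigma>. supported V \<mu> \<sigma> \<Longrightarrow> \<exists>X. full X \<sigma>"
  shows "r = 3"
proof -
  obtain \<sigma> where "supported V \<mu> \<sigma>" using ex_supported_pairing[OF r] unfolding supported_def by blast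
  then obtain X where X: "full X \<sigma>" using bad by blast
  have Xp: "X \<subseteq> V" "card X = 5" "edge_weight \<mu> X (V - X) = r + 2" "supported V \<mu> \<sigma>"
    using X unfolding full_def by auto
  have fX: "finite X" using Xp fin_sub by blast
  define m where "m = 2 * r - 1"
  obtain N where N: "\<And>i. i < m \<Longrightarrow> supported V \<mu> (N i)"
    and Ns: "\<And>u v. u \<in> V \<Longrightarrow> v \<in> V \<Longrightarrow> 2 * \<mu> u v = pairing_weight \<sigma> u v + (\<Sum>i<m. pairing_weight (N i) u v)"
    using double_decomposition[OF X r] unfolding m_def by blast
  have m: "m + 1 = 2 * r" using r unfolding m_def by simp
  define c where "c \<tau> Y = edge_weight (pairing_weight \<tau>) Y (V - Y)" for \<tau> Y
  \<comment> \<open>The 2r matchings that make up \<open>2\<mu>\<close> cross a cut of size r + 2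
    altogether 2r + 4 times.\<close>
  have total: "2 * (r + 2) = c \<sigma> Y + (\<Sum>i<m. c (N i) Y)" if "Y \<subseteq> V" "edge_weight \<mu> Y (V - Y) = r + 2" for Y
  proof -
    have "2 * edge_weight \<mu> Y (V - Y) =
      edge_weight (\<lambda>u v. pairing_weight \<sigma> u v + (\<Sum>i<m. pairing_weight (N i) u v)) Y (V - Y)"
      unfolding edge_weight_scale[symmetric] by (intro edge_weight_cong Ns) (use that in auto)
    then show ?thesis using that unfolding c_def edge_weight_add edge_weight_sum by simp
  qed
  have c1: "1 \<le> c \<tau> Y" if "supported V \<mu> \<tau>" "Y \<subseteq> V" "card Y = 5" for \<tau> Y
    using pairing_cut(1)[OF fin _ that(2)] that unfolding supported_def c_def by (metis One_nat_def Suc_leI odd_numeral odd_pos)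
  have c5: "c \<tau> Y = 5" if "full Y \<tau>" for \<tau> Y
  proof -
    have "{x \<in> Y. \<tau> x \<in> V - Y} = Y" using that unfolding full_def by auto
    then show ?thesis using edge_weight_pairing[of Y "V - Y" \<tau>] that fin fin_sub unfolding full_def c_def by simp
  qed
  \<comment> \<open>Two matchings full for \<open>Y\<close> take 10 crossings and each of the other
    2r - 2 at least one: 2r + 8 crossings, too many. The next fact is the same count for
    \<open>\<sigma>\<close> and \<open>N i\<close> on \<open>X\<close>.\<close>
  have once: "\<not> full Y (N j)" if Y: "full Y (N i)" and ij: "i < m" "j < m" "i \<noteq> j" for Y i j
  proof
    assume Yj: "full Y (N j)"
    have Yp: "Y \<subseteq> V" "card Y = 5" "edge_weight \<mu> Y (V - Y) = r + 2" using Y unfolding full_def by auto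
    have "(\<Sum>k<m. c (N k) Y) = c (N i) Y + (c (N j) Y + (\<Sum>k\<in>{..<m} - {i} - {j}. c (N k) Y))"
      using ij by (simp add: sum.remove[of "{..<m}" i] sum.remove[of "{..<m} - {i}" j])
    moreover have "card ({..<m} - {i} - {j}) \<le> (\<Sum>k\<in>{..<m} - {i} - {j}. c (N k) Y)"
      using sum_bounded_below[of "{..<m} - {i} - {j}" 1 "\<lambda>k. c (N k) Y"] c1 N Yp by simp
    moreover have "card ({..<m} - {i} - {j}) + 2 = m" using ij by simp
    moreover have False
      if "s = a + (b + t)" "k \<le> t" "k + 2 = m" "2 * (r + 2) = z + s" "a = 5" "b = 5" "1 \<le> z"
      for s a b t k z :: nat using that m by presburger
    ultimately show False
      using total[OF Yp(1,3)] c5[OF Y] c5[OF Yj] c1[OF Xp(4) Yp(1,2)] by blast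
  qed
  have once': "\<not> full X (N i)" if i: "i < m" for i
  proof
    assume Xi: "full X (N i)"
    have "(\<Sum>k<m. c (N k) X) = c (N i) X + (\<Sum>k\<in>{..<m} - {i}. c (N k) X)"
      using i by (simp add: sum.remove[of "{..<m}" i])
    moreover have "card ({..<m} - {i}) \<le> (\<Sum>k\<in>{..<m} - {i}. c (N k) X)"
      using sum_bounded_below[of "{..<m} - {i}" 1 "\<lambda>k. c (N k) X"] c1 N Xp by simp
    moreover have "card ({..<m} - {i}) + 1 = m" using i by simp
    moreover have False
      if "s = a + t" "k \<le> t" "k + 1 = m" "2 * (r + 2) = z + s" "a = 5" "z = 5"
      for s a t k z :: nat using that m by presburger
    ultimately show False
      using total[OF Xp(1,3)] c5[OF X] c5[OF Xi] by blast
  qed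
  have "\<exists>Y. full Y (N i) \<and> card (X \<inter> Y) = 3" if i: "i < m" for i
    using bad[OF N[OF i]] full_inter_3_ex[OF X _ once'[OF i]] by blast
  then obtain Y where Y: "\<And>i. i < m \<Longrightarrow> full (Y i) (N i)" and c3: "\<And>i. i < m \<Longrightarrow> card (X \<inter> Y i) = 3" by metis
  have YV: "Y i \<subseteq> V" if "i < m" for i using Y[OF that] unfolding full_def by blast
  note fi = full_inter_3[OF X Y c3]
  have "0 < m" using m r by presburger
  then have r3: "3 \<le> r" using fi(8)[of 0] by blast
  have injC: "inj_on (\<lambda>i. X - Y i) {..<m}"
  proof (rule inj_onI, rule ccontr)
    fix i j assume ij: "i \<in> {..<m}" "j \<in> {..<m}" "X - Y i = X - Y j" "i \<noteq> j"
    then have "X \<inter> Y i = X \<inter> Y j" by blast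
    then have "Y i = Y j" using full_inter_eq[OF X Y Y c3] ij by simp
    then show False using once[of "Y i" i j] Y[of i] Y[of j] ij by simp
  qed
  have injD: "inj_on (\<lambda>i. Y i - X) {..<m}"
  proof (rule inj_onI, rule ccontr)
    fix i j assume ij: "i \<in> {..<m}" "j \<in> {..<m}" "Y i - X = Y j - X" "i \<noteq> j"
    \<comment> \<open>Equal differences \<open>Y i - X\<close> are equal traces of the complements
      on \<open>V - X\<close>, so \<open>full_inter_eq\<close> applies to complements.\<close>
    have e: "(V - X) \<inter> (V - Y k) = V - (X \<union> Y k)" for k by blast
    have eq: "(V - X) \<inter> (V - Y i) = (V - X) \<inter> (V - Y j)" using ij by blast
    have "V - Y i = V - Y j"
    proof (rule full_inter_eq[OF full_compl[OF X] full_compl[OF Y] full_compl[OF Y] _ eq])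
      show "card ((V - X) \<inter> (V - Y i)) = 3" unfolding e using fi(5) ij by simp
    qed (use ij in auto)
    then have "Y i = Y j" using YV ij by (metis double_diff lessThan_iff order_refl)
    then show False using once[of "Y i" i j] Y[of i] Y[of j] ij by simp
  qed
  have "(\<Sum>i<m. edge_weight \<mu> (X - Y i) (X - Y i)) = (\<Sum>C\<in>(\<lambda>i. X - Y i) ` {..<m}. edge_weight \<mu> C C)"
    by (simp add: sum.reindex[OF injC])
  also have "\<dots> \<le> edge_weight \<mu> X X"
    by (rule sum_edge_weight_pairs[OF Xp(1)]) (use fi(6) in auto)
  finally have SC: "(\<Sum>i<m. edge_weight \<mu> (X - Y i) (X - Y i)) \<le> edge_weight \<mu> X X" .
  have "(\<Sum>i<m. edge_weight \<mu> (Y i - X) (Y i - X)) = (\<Sum>C\<in>(\<lambda>i. Y i - X) ` {..<m}. edge_weight \<mu> C C)"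
    by (simp add: sum.reindex[OF injD])
  also have "\<dots> \<le> edge_weight \<mu> (V - X) (V - X)"
    by (rule sum_edge_weight_pairs) (use fi(7) YV in auto)
  finally have SD: "(\<Sum>i<m. edge_weight \<mu> (Y i - X) (Y i - X)) \<le> edge_weight \<mu> (V - X) (V - X)" .
  \<comment> \<open>Each side spans weight 5r - (r + 2) = 2m, which has to cover the bound 2r - 2
    from each of the m pairs of 2-sets.\<close>
  have "m * (2 * r - 2) \<le> (\<Sum>i<m. edge_weight \<mu> (X - Y i) (X - Y i) + edge_weight \<mu> (Y i - X) (Y i - X))"
    using sum_bounded_below[of "{..<m}" "2 * r - 2" "\<lambda>i. edge_weight \<mu> (X - Y i) (X - Y i) + edge_weight \<mu> (Y i - X) (Y i - X)"] fi(9)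
    by simp
  also have "\<dots> \<le> edge_weight \<mu> X X + edge_weight \<mu> (V - X) (V - X)"
    using SC SD by (simp add: sum.distrib)
  also have "\<dots> = 4 * m"
    using edge_weight_split[OF Xp(1)] edge_weight_split[of "V - X"] cut_compl[OF Xp(1)] Xp card_compl[OF Xp(1)] m by simp
  finally have "m * (2 * r - 2) \<le> m * 4" by (simp add: mult.commute)
  then have "2 * r - 2 \<le> 4" using \<open>0 < m\<close> by simp
  then show ?thesis using r3 by simp
qed

end

subsection \<open>The cubic case\<close>

text \<open>Start from \<open>a\<close> with neighbours \<open>b\<close> and \<open>e\<close>. Their
  other neighbours \<open>c\<close> and \<open>d\<close> are new because there is no triangle, and
  they differ because a 4-cycle would isolate the fifth vertex.\<close>

lemma five_cycle:
  assumes X: "card X = 5" and sym: "\<And>u v. E u v \<Longrightarrow> E v u" and irr: "\<And>u. \<not> E u u"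
    and nb: "\<And>a. a \<in> X \<Longrightarrow> \<exists>b\<in>X. \<exists>c\<in>X. b \<noteq> c \<and> (\<forall>z\<in>X. E a z \<longleftrightarrow> z = b \<or> z = c)"
    and tri: "\<And>a b c. a \<in> X \<Longrightarrow> b \<in> X \<Longrightarrow> c \<in> X \<Longrightarrow> E a b \<Longrightarrow> E b c \<Longrightarrow> \<not> E a c"
  shows "\<exists>a b c d e. X = {a, b, c, d, e} \<and> distinct [a, b, c, d, e] \<and>
    E a b \<and> E b c \<and> E c d \<and> E d e \<and> E e a"
proof -
  have fX: "finite X" using X by (metis card.infinite zero_neq_numeral)
  obtain a where a: "a \<in> X" using X by fastforce
  obtain b e where be: "b \<in> X" "e \<in> X" "b \<noteq> e" and na: "\<And>z. z \<in> X \<Longrightarrow> E a z \<longleftrightarrow> z = b \<or> z = e"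
    using nb[OF a] by blast
  have ab: "E a b" "E a e" using na be by auto
  have other: "\<exists>w\<in>X. w \<noteq> v \<and> (\<forall>z\<in>X. E u z \<longleftrightarrow> z = v \<or> z = w)" if uv: "u \<in> X" "v \<in> X" "E u v" for u v
  proof -
    obtain b c where bc: "b \<in> X" "c \<in> X" "b \<noteq> c" and E: "\<And>z. z \<in> X \<Longrightarrow> E u z \<longleftrightarrow> z = b \<or> z = c"
      using nb[OF uv(1)] by blast
    from uv E consider "v = b" | "v = c" by blast
    then show ?thesis
    proof cases
      case 1 then show ?thesis using bc E by (intro bexI[of _ c]) auto
    next
      case 2 then show ?thesis using bc E by (intro bexI[of _ b]) auto
    qed
  qed
  obtain c where c: "c \<in> X" "c \<noteq> a" and nbb: "\<And>z. z \<in> X \<Longrightarrow> E b z \<longleftrightarrow> z = a \<or> z = c"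
    using other[of b a] be a ab sym by blast
  obtain d where d: "d \<in> X" "d \<noteq> a" and ne: "\<And>z. z \<in> X \<Longrightarrow> E e z \<longleftrightarrow> z = a \<or> z = d"
    using other[of e a] be a ab sym by blast
  have bc: "E b c" and ed: "E e d" using nbb ne c d by auto
  have "b \<noteq> c" "e \<noteq> d" "a \<noteq> b" "a \<noteq> e" using bc ed ab irr by auto
  have "c \<noteq> e" using tri[of a b c] a be c ab bc by blast
  have "d \<noteq> b" using tri[of a e d] a be d ab ed by blast
  \<comment> \<open>In the 4-cycle a, b, c, e both neighbours of every vertex are used up, so the
    remaining vertex \<open>z\<close> has none.\<close>
  have "c \<noteq> d"
  proof
    assume cd: "c = d"
    obtain w where w: "w \<in> X" "w \<noteq> b" and nc: "\<And>z. z \<in> X \<Longrightarrow> E c z \<longleftrightarrow> z = b \<or> z = w"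
      using other[of c b] c be bc sym by blast
    have "w = e" using nc[of e] ed cd sym be by blast
    have "X \<noteq> {a, b, c, e}" using X card_length[of "[a, b, c, e]"] by auto
    then obtain z where z: "z \<in> X" "z \<notin> {a, b, c, e}" using a be c by blast
    have sub: "y = z" if "y \<in> X" "E z y" for y
    proof (rule ccontr)
      assume yz: "y \<noteq> z"
      have "E y z" using that sym by blast
      then have "y \<notin> {a, b, c, e}" using z na nbb ne nc \<open>w = e\<close> cd by auto
      then have "card {a, b, c, e, y, z} = 6"
        using z yz \<open>b \<noteq> c\<close> \<open>e \<noteq> d\<close> \<open>a \<noteq> b\<close> \<open>a \<noteq> e\<close> \<open>c \<noteq> e\<close> be c cd by auto
      moreover have "card {a, b, c, e, y, z} \<le> card X" using a be c z that fX by (intro card_mono) auto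
      ultimately show False using X by simp
    qed
    then show False using nb[OF z(1)] irr by blast
  qed
  have dist: "distinct [a, b, c, d, e]"
    using \<open>b \<noteq> c\<close> \<open>e \<noteq> d\<close> \<open>a \<noteq> b\<close> \<open>a \<noteq> e\<close> \<open>c \<noteq> e\<close> \<open>d \<noteq> b\<close> \<open>c \<noteq> d\<close> be c d by auto
  then have c5: "card {a, b, c, d, e} = 5" by simp
  have XE: "X = {a, b, c, d, e}" using c5 X a be c d fX by (intro card_subset_eq[symmetric]) auto
  obtain w where w: "w \<in> X" "w \<noteq> b" and nc: "\<And>z. z \<in> X \<Longrightarrow> E c z \<longleftrightarrow> z = b \<or> z = w"
    using other[of c b] c be bc sym by blast
  have cw: "E c w" using nc w by blast
  have "w \<noteq> a" using cw na[OF c(1)] sym \<open>b \<noteq> c\<close> \<open>c \<noteq> e\<close> by blast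
  moreover have "w \<noteq> e" using cw ne[OF c(1)] sym c \<open>c \<noteq> d\<close> by blast
  moreover have "w \<noteq> c" using cw irr by blast
  ultimately have "w = d" using w XE by blast
  then show ?thesis using XE dist ab bc cw ed sym by blast
qed

section \<open>Full sets in degree three\<close>

context ten_weight
begin

definition cycle5 :: "'a set \<Rightarrow> 'a \<Rightarrow> 'a \<Rightarrow> 'a \<Rightarrow> 'a \<Rightarrow> 'a \<Rightarrow> bool" where
  "cycle5 X a b c d e \<longleftrightarrow> X = {a, b, c, d, e} \<and> distinct [a, b, c, d, e] \<and>
     \<mu> a b = 1 \<and> \<mu> b c = 1 \<and> \<mu> c d = 1 \<and> \<mu> d e = 1 \<and> \<mu> e a = 1 \<and>
     \<mu> a c = 0 \<and> \<mu> b d = 0 \<and> \<mu> c e = 0 \<and> \<mu> d a = 0 \<and> \<mu> e b = 0"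

lemma cycle5_rotate: "cycle5 X a b c d e \<Longrightarrow> cycle5 X b c d e a"
  unfolding cycle5_def by auto

lemma cycle5_start:
  assumes "cycle5 X a b c d e" "y \<in> X"
  shows "\<exists>b c d e. cycle5 X y b c d e"
proof -
  note r1 = cycle5_rotate[OF assms(1)]
  note r2 = cycle5_rotate[OF r1]
  note r3 = cycle5_rotate[OF r2]
  note r4 = cycle5_rotate[OF r3]
  have "y = a \<or> y = b \<or> y = c \<or> y = d \<or> y = e" using assms unfolding cycle5_def by blast
  then show ?thesis using assms(1) r1 r2 r3 r4 by blast
qed

context
  assumes r3: "r = 3"
begin

text \<open>For r = 3 the cut has size 5, exactly the number of crossings of
  \<open>\<sigma>\<close>. Since \<open>\<sigma>\<close> is dominated by \<open>\<mu>\<close>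
  pointwise, the equal sums force equality: the cut consists of the edges of
  \<open>\<sigma>\<close>.\<close>

lemma full_cut_eq:
  assumes "full X \<sigma>" "x \<in> X" "v \<in> V - X"
  shows "\<mu> x v = pairing_weight \<sigma> x v"
proof -
  have X: "X \<subseteq> V" "card X = 5" "edge_weight \<mu> X (V - X) = r + 2" "supported V \<mu> \<sigma>" "\<sigma> ` X \<subseteq> V - X"
    using assms unfolding full_def by auto
  have f: "finite X" "finite (V - X)" using X fin fin_sub by auto
  have "{x \<in> X. \<sigma> x \<in> V - X} = X" using X by auto
  then have "edge_weight (pairing_weight \<sigma>) X (V - X) = edge_weight \<mu> X (V - X)"
    using edge_weight_pairing[OF f, of \<sigma>] X r3 by simp
  then have eq: "(\<Sum>p\<in>X \<times> (V - X). pairing_weight \<sigma> (fst p) (snd p)) = (\<Sum>p\<in>X \<times> (V - X). \<mu> (fst p) (snd p))"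
    by (simp add: edge_weight_def sum.cartesian_product case_prod_beta)
  have le: "pairing_weight \<sigma> (fst p) (snd p) \<le> \<mu> (fst p) (snd p)" if "p \<in> X \<times> (V - X)" for p
    using X that unfolding supported_def by (auto simp: Suc_le_eq)
  have "(x, v) \<in> X \<times> (V - X)" using assms by blast
  from sum_mono_inv[OF eq le this] f
  have "pairing_weight \<sigma> (fst (x, v)) (snd (x, v)) = \<mu> (fst (x, v)) (snd (x, v))" by blast
  then show ?thesis by simp
qed

lemma full_inner_degree:
  assumes "full X \<sigma>" "x \<in> X"
  shows "(\<Sum>y\<in>X. \<mu> x y) = 2"
proof -
  have X: "X \<subseteq> V" "\<sigma> ` X \<subseteq> V - X" using assms unfolding full_def by auto
  have f: "finite (V - X)" using fin by auto
  have "(\<Sum>y\<in>V. \<mu> x y) = (\<Sum>y\<in>V - X. \<mu> x y) + (\<Sum>y\<in>X. \<mu> x y)"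
    using sum.subset_diff[OF X(1) fin] .
  moreover have "(\<Sum>y\<in>V - X. \<mu> x y) = (\<Sum>y\<in>V - X. pairing_weight \<sigma> x y)"
    using full_cut_eq[OF assms] by (intro sum.cong) auto
  moreover have "\<sigma> x \<in> V - X" using X(2) assms(2) by blast
  then have "(\<Sum>y\<in>V - X. pairing_weight \<sigma> x y) = 1"
    using f by (simp add: of_bool_def sum.delta)
  ultimately show ?thesis using deg[of x] X assms r3 by auto
qed

text \<open>The cut has at least 5 of the total degree 9, so at most two edges lie inside. This
  excludes triangles, and double edges indirectly.\<close>

lemma three_set_inner:
  assumes "P \<subseteq> V" "card P = 3"
  shows "edge_weight \<mu> P P \<le> 4"
  using no_tight[OF assms(1)] card_compl[OF assms(1)] edge_weight_split[OF assms(1)] assms r3 by simp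

text \<open>A double edge uses up the inner degree 2 of both its ends, so the other three vertices
  of \<open>X\<close> have all their inner degree among themselves, which is weight 6 instead of at
  most 4.\<close>

lemma full_simple:
  assumes "full X \<sigma>" "a \<in> X" "b \<in> X"
  shows "\<mu> a b \<le> 1"
proof (rule ccontr)
  assume "\<not> ?thesis"
  then have ab: "2 \<le> \<mu> a b" by simp
  have X: "X \<subseteq> V" "card X = 5" using assms unfolding full_def by auto
  have fX: "finite X" using X fin_sub by blast
  have ne: "a \<noteq> b" using ab zero X assms by auto
  define P where "P = X - {a, b}"
  have P: "P \<subseteq> V" "card P = 3" "finite P" "a \<notin> P" "b \<notin> P" "X = insert a (insert b P)"
    using X assms ne fX unfolding P_def by (auto simp: card_Diff_subset)
  have only: "\<mu> a z = 0" "\<mu> b z = 0" if "z \<in> P" for z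
  proof -
    have "\<mu> a z + \<mu> a b \<le> (\<Sum>y\<in>X. \<mu> a y)"
      using P that ne by (simp add: sum.remove[OF P(3) that])
    then show "\<mu> a z = 0" using full_inner_degree[OF assms(1,2)] ab by simp
    have "\<mu> b z + \<mu> b a \<le> (\<Sum>y\<in>X. \<mu> b y)"
      using P that ne by (simp add: sum.remove[OF P(3) that])
    moreover have "\<mu> b a = \<mu> a b" using sym X assms by blast
    ultimately show "\<mu> b z = 0" using full_inner_degree[OF assms(1,3)] ab by simp
  qed
  have "(\<Sum>y\<in>P. \<mu> z y) = 2" if z: "z \<in> P" for z
  proof -
    have "(\<Sum>y\<in>X. \<mu> z y) = (\<Sum>y\<in>P. \<mu> z y) + \<mu> z a + \<mu> z b"
      using P ne by simp
    moreover have "\<mu> z a = 0" "\<mu> z b = 0"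
      using only[OF z] sym[of z a] sym[of z b] X P z assms by auto
    ultimately show ?thesis using full_inner_degree[OF assms(1), of z] z P by simp
  qed
  then have "edge_weight \<mu> P P = 6" using P by (simp add: edge_weight_def)
  then show False using three_set_inner[OF P(1,2)] by simp
qed

lemma full_cycle5:
  assumes "full X \<sigma>"
  shows "\<exists>a b c d e. cycle5 X a b c d e"
proof -
  have X: "X \<subseteq> V" "card X = 5" using assms unfolding full_def by auto
  have fX: "finite X" using X fin_sub by blast
  define E where "E u v \<longleftrightarrow> u \<in> X \<and> v \<in> X \<and> \<mu> u v = 1" for u v
  have le1: "\<mu> u v \<le> 1" if "u \<in> X" "v \<in> X" for u v using full_simple[OF assms that] .
  have sE: "E v u" if "E u v" for u v using that sym X unfolding E_def by (metis subsetD)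
  have c2: "card {z\<in>X. \<mu> u z = 1} = 2" if "u \<in> X" for u
  proof -
    have "(\<Sum>z\<in>X. \<mu> u z) = (\<Sum>z\<in>X. of_bool (\<mu> u z = 1))"
      using le1[OF that] by (intro sum.cong refl) (auto simp: le_Suc_eq)
    then show ?thesis using full_inner_degree[OF assms that] fX by (simp add: of_bool_def sum.If_cases Int_def)
  qed
  have "\<exists>a b c d e. X = {a, b, c, d, e} \<and> distinct [a, b, c, d, e] \<and>
    E a b \<and> E b c \<and> E c d \<and> E d e \<and> E e a"
  proof (rule five_cycle[OF X(2)])
    show "\<not> E u u" for u using zero X unfolding E_def by auto
    show "\<exists>b\<in>X. \<exists>c\<in>X. b \<noteq> c \<and> (\<forall>z\<in>X. E a z \<longleftrightarrow> z = b \<or> z = c)" if a: "a \<in> X" for a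
    proof -
      obtain b c where "{z\<in>X. \<mu> a z = 1} = {b, c}" "b \<noteq> c" using c2[OF a] by (auto simp: card_2_iff)
      then show ?thesis using a unfolding E_def by blast
    qed
    show "\<not> E a c" if "E a b" "E b c" for a b c
    proof
      assume "E a c"
      have dd: "distinct [a, b, c]" using that \<open>E a c\<close> zero X unfolding E_def by auto
      moreover have "{a, b, c} \<subseteq> V" using that X unfolding E_def by auto
      ultimately have "edge_weight \<mu> {a, b, c} {a, b, c} \<le> 4" by (intro three_set_inner) auto
      moreover have "\<mu> a b = 1" "\<mu> b c = 1" "\<mu> a c = 1" "\<mu> b a = 1" "\<mu> c b = 1" "\<mu> c a = 1"
        using that \<open>E a c\<close> sE unfolding E_def by auto
      ultimately show False using dd by (simp add: edge_weight_def)
    qed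
  qed (use sE in blast)
  then obtain a b c d e where X5: "X = {a, b, c, d, e}" and dist: "distinct [a, b, c, d, e]"
    and E: "E a b" "E b c" "E c d" "E d e" "E e a" by blast
  have m: "\<mu> a b = 1" "\<mu> b c = 1" "\<mu> c d = 1" "\<mu> d e = 1" "\<mu> e a = 1"
    "\<mu> b a = 1" "\<mu> c b = 1" "\<mu> d c = 1" "\<mu> e d = 1" "\<mu> a e = 1"
    using E sE unfolding E_def by auto
  have s: "\<mu> a a + \<mu> a b + \<mu> a c + \<mu> a d + \<mu> a e = 2" "\<mu> b a + \<mu> b b + \<mu> b c + \<mu> b d + \<mu> b e = 2"
    "\<mu> c a + \<mu> c b + \<mu> c c + \<mu> c d + \<mu> c e = 2" "\<mu> d a + \<mu> d b + \<mu> d c + \<mu> d d + \<mu> d e = 2"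
    "\<mu> e a + \<mu> e b + \<mu> e c + \<mu> e d + \<mu> e e = 2"
    using full_inner_degree[OF assms, of a] full_inner_degree[OF assms, of b] full_inner_degree[OF assms, of c]
      full_inner_degree[OF assms, of d] full_inner_degree[OF assms, of e] dist unfolding X5
    by (simp_all add: add.assoc)
  have "\<mu> a c = 0" "\<mu> b d = 0" "\<mu> c e = 0" "\<mu> d a = 0" "\<mu> e b = 0"
    using s m by linarith+
  then have "cycle5 X a b c d e" unfolding cycle5_def using X5 dist m by simp
  then show ?thesis by blast
qed

context
  assumes bad: "\<And>\<sigma>. supported V \<mu> \<sigma> \<Longrightarrow> \<exists>X. full X \<sigma>"
begin

text \<open>
  The perfect matching through the spoke at \<open>a\<close> is full for some other cut; this forces the spokes
  at the two vertices of the cycle that are far from \<open>a\<close> to end next to \<open>\<sigma> a\<close>.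
\<close>

lemma spokes_adjacent:
  assumes X: "full X \<sigma>" and c: "cycle5 X a b c d e"
  shows "\<mu> (\<sigma> a) (\<sigma> c) = 1"
proof -
  have Xp: "X \<subseteq> V" "card X = 5" "supported V \<mu> \<sigma>" "\<sigma> ` X \<subseteq> V - X" using X unfolding full_def by auto
  have Xe: "X = {a, b, c, d, e}" and dX: "distinct [a, b, c, d, e]" using c unfolding cycle5_def by auto
  define p where "p = \<sigma> a"
  have pY: "p \<in> V - X" unfolding p_def using Xp Xe by auto
  obtain a' b' c' d' e' where "cycle5 (V - X) a' b' c' d' e'" using full_cycle5[OF full_compl[OF X]] by blast
  then obtain q s t u where c': "cycle5 (V - X) p q s t u" using cycle5_start[OF _ pY] by blast
  have Ye: "V - X = {p, q, s, t, u}" and dY: "distinct [p, q, s, t, u]" using c' unfolding cycle5_def by auto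
  have "V = X \<union> (V - X)" using Xp(1) by blast
  also have "\<dots> = {a, b, c, d, e} \<union> {p, q, s, t, u}" by (rule arg_cong2[OF Xe Ye])
  finally have Ve: "V = {a, b, c, d, e, p, q, s, t, u}" by (simp only: Un_insert_left Un_empty_left)
  have "X \<inter> (V - X) = {}" by blast
  then have "{a, b, c, d, e} \<inter> {p, q, s, t, u} = {}" by (simp only: Ye) (simp only: Xe)
  then have dV: "distinct [a, b, c, d, e, p, q, s, t, u]" using dX dY by auto
  have mX: "\<mu> a b = 1" "\<mu> b c = 1" "\<mu> c d = 1" "\<mu> d e = 1" "\<mu> e a = 1"
     "\<mu> a c = 0" "\<mu> b d = 0" "\<mu> c e = 0" "\<mu> d a = 0" "\<mu> e b = 0" using c unfolding cycle5_def by auto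
  have mY: "\<mu> p q = 1" "\<mu> q s = 1" "\<mu> s t = 1" "\<mu> t u = 1" "\<mu> u p = 1"
     "\<mu> p s = 0" "\<mu> q t = 0" "\<mu> s u = 0" "\<mu> t p = 0" "\<mu> u q = 0" using c' unfolding cycle5_def by auto
  have mX': "\<mu> c b = 1" "\<mu> e d = 1" "\<mu> c a = 0" "\<mu> d b = 0" "\<mu> e c = 0" "\<mu> a d = 0" "\<mu> b e = 0" "\<mu> d c = 1"
    using mX sym Ve by (metis insertCI)+
  have mY': "\<mu> s q = 1" "\<mu> u t = 1" "\<mu> s p = 0" "\<mu> t q = 0" "\<mu> u s = 0" "\<mu> p t = 0" "\<mu> q u = 0" "\<mu> t s = 1" "\<mu> p u = 1"
    using mY sym Ve by (metis insertCI)+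
  have z: "\<mu> v v = 0" if "v \<in> V" for v using zero that .
  have ap: "\<mu> a p = 1" using full_cut_eq[OF X, of a p] pY Xe unfolding p_def by simp
  then have pa: "\<mu> p a = 1" using sym[of a p] Ve by simp
  \<comment> \<open>The spoke at \<open>a\<close> together with the two edges on each 5-cycle that
    match the other four vertices.\<close>
  define M where "M = (\<lambda>v. if v = a then p else if v = p then a else if v = b then c else if v = c then b
    else if v = d then e else if v = e then d else if v = q then s else if v = s then q
    else if v = t then u else t)"
  have M: "M a = p" "M p = a" "M b = c" "M c = b" "M d = e" "M e = d" "M q = s" "M s = q" "M t = u" "M u = t"
    using dV unfolding M_def by auto
  have sM: "supported V \<mu> M"
    unfolding supported_def pairing_def
  proof (intro conjI ballI)
    fix v assume "v \<in> V"
    then have v: "v = a \<or> v = b \<or> v = c \<or> v = d \<or> v = e \<or> v = p \<or> v = q \<or> v = s \<or> v = t \<or> v = u"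
      using Ve by blast
    show "M v \<in> V" using v M Ve by auto
    show "M v \<noteq> v" using v M dV by auto
    show "M (M v) = v" using v M by auto
    show "0 < \<mu> v (M v)" using v M mX mY mX' mY' ap pa by auto
  qed
  have "\<not> full X M" unfolding full_def using M Xe by auto
  then obtain Z where Z: "full Z M" "card (X \<inter> Z) = 3" using bad[OF sM] full_inter_3_ex[OF X] by blast
  note f3 = full_inter_3[OF X Z]
  have ZV: "Z \<subseteq> V" using Z unfolding full_def by auto
  note fi = full_image[OF Z(1)]
  have in_V: "a \<in> V" "b \<in> V" "c \<in> V" "d \<in> V" "e \<in> V" "p \<in> V" "q \<in> V" "s \<in> V" "t \<in> V" "u \<in> V" using Ve by auto
  have bc: "b \<in> Z \<longleftrightarrow> c \<notin> Z" using fi[of b] M in_V by auto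
  have de: "d \<in> Z \<longleftrightarrow> e \<notin> Z" using fi[of d] M in_V by auto
  have qs: "q \<in> Z \<longleftrightarrow> s \<notin> Z" using fi[of q] M in_V by auto
  have tu: "t \<in> Z \<longleftrightarrow> u \<notin> Z" using fi[of t] M in_V by auto
  \<comment> \<open>\<open>Z\<close> contains one of \<open>b\<close>, \<open>c\<close> and one of
    \<open>d\<close>, \<open>e\<close>, so the third common vertex with \<open>X\<close> is
    \<open>a\<close>.\<close>
  have aZ: "a \<in> Z"
  proof (rule ccontr)
    assume "a \<notin> Z"
    then have "X \<inter> Z \<subseteq> {if b \<in> Z then b else c, if d \<in> Z then d else e}" using Xe bc de by auto
    then have "card (X \<inter> Z) \<le> card {if b \<in> Z then b else c, if d \<in> Z then d else e}" by (intro card_mono) auto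
    also have "\<dots> \<le> 2" by (simp add: card_insert_if)
    finally show False using Z(2) by simp
  qed
  then have pZ: "p \<notin> Z" using fi[of a] M in_V by auto
  have C: "X - Z = {if b \<in> Z then c else b, if d \<in> Z then e else d}" unfolding Xe using aZ bc de by auto
  have D: "Z - X = {if q \<in> Z then q else s, if t \<in> Z then t else u}"
  proof -
    have "Z - X = (V - X) \<inter> Z" using ZV by blast
    then show ?thesis unfolding Ye using pZ qs tu by auto
  qed
  have CC: "2 \<le> edge_weight \<mu> (X - Z) (X - Z)" "2 \<le> edge_weight \<mu> (Z - X) (Z - X)"
    using f3(9-11) r3 by simp_all
  \<comment> \<open>For r = 3 the bounds of \<open>full_inter_3\<close> leave exactly one edge in
    \<open>X - Z\<close> and one in \<open>Z - X\<close>. The only adjacent choices are {c, d} and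
    {s, t}; since no edge joins these two sets, the spoke at \<open>c\<close> can end only at
    \<open>q\<close> or \<open>u\<close>.\<close>
  have "c \<notin> Z \<and> d \<notin> Z"
    using CC(1) mX mX' z[OF in_V(2)] z[OF in_V(3)] z[OF in_V(4)] z[OF in_V(5)] dX bc de
    unfolding C by (auto simp: edge_weight_def split: if_splits)
  moreover have "s \<in> Z \<and> t \<in> Z"
    using CC(2) mY mY' z[OF in_V(7)] z[OF in_V(8)] z[OF in_V(9)] z[OF in_V(10)] dY qs tu
    unfolding D by (auto simp: edge_weight_def split: if_splits)
  ultimately have sub: "c \<in> X - Z" "s \<in> Z - X" "t \<in> Z - X" using Xe Ye by auto
  have no: "\<sigma> c \<noteq> v" if "v \<in> Z - X" for v
  proof
    assume "\<sigma> c = v"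
    have "\<mu> c v \<le> edge_weight \<mu> (X - Z) (Z - X)"
      using sub that Xp ZV fin_sub by (intro edge_weight_le) auto
    moreover have "0 < \<mu> c v" using Xp(3) in_V \<open>\<sigma> c = v\<close> unfolding supported_def by auto
    ultimately show False using f3(1) by simp
  qed
  have "\<sigma> c \<in> V - X" using Xp(4) Xe by auto
  moreover have "\<sigma> c \<noteq> p"
    using supported_props(2)[OF Xp(3)] in_V dV unfolding p_def by (metis distinct_length_2_or_more)
  ultimately have "\<sigma> c = q \<or> \<sigma> c = u" using no sub Ye by auto
  then show ?thesis using mY mY' unfolding p_def[symmetric] by auto
qed

end

end

end

subsection \<open>Relabelling\<close>

lemma pairing_reindex:
  assumes h: "bij_betw h W V" and s: "pairing V \<sigma>"
  shows "pairing W (\<lambda>i. inv_into W h (\<sigma> (h i)))"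
  unfolding pairing_def
proof (intro ballI)
  fix i assume i: "i \<in> W"
  have hW: "h i \<in> V" using h i unfolding bij_betw_def by blast
  then have s': "\<sigma> (h i) \<in> V" "\<sigma> (h i) \<noteq> h i" "\<sigma> (\<sigma> (h i)) = h i" using s unfolding pairing_def by blast+
  have hi: "h (inv_into W h v) = v" "inv_into W h v \<in> W" if "v \<in> V" for v
    using h that unfolding bij_betw_def by (auto intro: f_inv_into_f inv_into_into)
  have "inv_into W h (h i) = i" using h i unfolding bij_betw_def by (simp add: inv_into_f_f)
  then show "inv_into W h (\<sigma> (h i)) \<in> W \<and> inv_into W h (\<sigma> (h i)) \<noteq> i \<and>
    inv_into W h (\<sigma> (h (inv_into W h (\<sigma> (h i))))) = i"
    using hi[OF s'(1)] s' by metis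
qed

lemma pairing_weight_reindex:
  assumes h: "bij_betw h W V" and s: "pairing V \<sigma>" and "i \<in> W" "j \<in> W"
  shows "inv_into W h (\<sigma> (h i)) = j \<longleftrightarrow> \<sigma> (h i) = h j"
proof -
  have "\<sigma> (h i) \<in> h ` W" using assms unfolding bij_betw_def pairing_def by auto
  moreover have "inj_on h W" using h unfolding bij_betw_def by blast
  ultimately show ?thesis using assms(4) by (metis f_inv_into_f inv_into_f_f)
qed

lemma decomposable_reindex:
  assumes h: "bij_betw h W V" and d: "decomposable r V \<mu>"
  shows "decomposable r W (\<lambda>i j. \<mu> (h i) (h j))"
proof -
  obtain f where f: "\<And>k. k < r \<Longrightarrow> pairing V (f k)"
    and m: "\<And>u v. u \<in> V \<Longrightarrow> v \<in> V \<Longrightarrow> \<mu> u v = (\<Sum>k<r. pairing_weight (f k) u v)"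
    using d unfolding decomposable_def by blast
  define g where "g k = (\<lambda>i. inv_into W h (f k (h i)))" for k
  have "\<mu> (h i) (h j) = (\<Sum>k<r. pairing_weight (g k) i j)" if ij: "i \<in> W" "j \<in> W" for i j
  proof -
    have "\<mu> (h i) (h j) = (\<Sum>k<r. pairing_weight (f k) (h i) (h j))"
      using m h ij unfolding bij_betw_def by auto
    also have "\<dots> = (\<Sum>k<r. pairing_weight (g k) i j)"
      using pairing_weight_reindex[OF h f ij] unfolding g_def by (intro sum.cong) auto
    finally show ?thesis .
  qed
  moreover have "pairing W (g k)" if "k < r" for k
    unfolding g_def using pairing_reindex[OF h f[OF that]] .
  ultimately show ?thesis unfolding decomposable_def by blast
qed

lemma decomposable_reindex_inv:
  assumes h: "bij_betw h W V" and d: "decomposable r W (\<lambda>i j. \<mu> (h i) (h j))"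
  shows "decomposable r V \<mu>"
proof -
  have h': "bij_betw (inv_into W h) V W" using bij_betw_inv_into[OF h] .
  have "decomposable r V (\<lambda>u v. \<mu> (h (inv_into W h u)) (h (inv_into W h v)))"
    using decomposable_reindex[OF h' d] by simp
  then show ?thesis
    by (rule decomposable_cong) (use h in \<open>auto simp: bij_betw_def f_inv_into_f\<close>)
qed

lemma edge_weight_reindex:
  assumes "inj_on h (X \<union> Y)"
  shows "edge_weight (\<lambda>i j. \<mu> (h i) (h j)) X Y = edge_weight \<mu> (h ` X) (h ` Y)"
proof -
  have "inj_on h X" "inj_on h Y" using assms by (auto intro: inj_on_subset)
  then show ?thesis by (simp add: edge_weight_def sum.reindex)
qed

lemma r_weight_reindex:
  assumes h: "bij_betw h W V" and rw: "r_weight V \<mu> r"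
  shows "r_weight W (\<lambda>i j. \<mu> (h i) (h j)) r"
proof -
  interpret r_weight V \<mu> r by fact
  have hV: "h i \<in> V" if "i \<in> W" for i using h that unfolding bij_betw_def by auto
  have inj: "inj_on h W" and im: "h ` W = V" using h unfolding bij_betw_def by auto
  show ?thesis
  proof
    show "finite W" using bij_betw_finite[OF h] fin by simp
    show "\<mu> (h i) (h j) = \<mu> (h j) (h i)" if "i \<in> W" "j \<in> W" for i j using that hV sym by simp
    show "\<mu> (h i) (h i) = 0" if "i \<in> W" for i using that hV zero by simp
    show "(\<Sum>j\<in>W. \<mu> (h i) (h j)) = r" if "i \<in> W" for i
      using sum.reindex_bij_betw[OF h, of "\<lambda>v. \<mu> (h i) v"] deg hV[OF that] by simp
    show "r \<le> edge_weight (\<lambda>i j. \<mu> (h i) (h j)) X (W - X)" if X: "X \<subseteq> W" "odd (card X)" for X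
    proof -
      have "inj_on h X" using inj X inj_on_subset by blast
      then have "odd (card (h ` X))" using X by (simp add: card_image)
      moreover have "h ` X \<subseteq> V" using X im by blast
      ultimately have "r \<le> edge_weight \<mu> (h ` X) (V - h ` X)" using cut by blast
      moreover have "h ` (W - X) = V - h ` X" using inj_on_image_set_diff[OF inj, of W X] X im by auto
      moreover have "inj_on h (X \<union> (W - X))" using inj X by (simp add: Un_absorb1)
      ultimately show ?thesis using edge_weight_reindex[of h X "W - X" \<mu>] by simp
    qed
  qed
qed

lemma decomposable_add_pairings:
  assumes "decomposable k V \<nu>" "\<And>i. i < m \<Longrightarrow> pairing V (\<tau> i)"
  shows "decomposable (k + m) V (\<lambda>u v. \<nu> u v + (\<Sum>i<m. pairing_weight (\<tau> i) u v))"
  using assms(2)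
proof (induction m)
  case 0 then show ?case using assms(1) by simp
next
  case (Suc m)
  then have "decomposable (k + m) V (\<lambda>u v. \<nu> u v + (\<Sum>i<m. pairing_weight (\<tau> i) u v))" by simp
  then have "decomposable (Suc (k + m)) V (\<lambda>u v. \<nu> u v + (\<Sum>i<Suc m. pairing_weight (\<tau> i) u v))"
    by (rule decomposable_Suc[where \<sigma> = "\<tau> m"]) (use Suc.prems in auto)
  then show ?case by simp
qed

subsection \<open>A drawing of the Petersen graph\<close>

text \<open>
  The Petersen graph drawn as a hexagon \<open>4, \<dots>, 9\<close> whose antipodal pairs are joined through
  \<open>0\<close>, \<open>1\<close> and \<open>3\<close>, with a centre \<open>2\<close> adjacent to these three.
\<close>

definition hex_edges :: "(nat \<times> nat) set" where
  "hex_edges = {(0,2), (0,4), (0,7), (1,2), (1,5), (1,8), (2,3), (3,6), (3,9),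
     (4,5), (5,6), (6,7), (7,8), (8,9), (4,9)}"

definition hex :: "nat \<Rightarrow> nat \<Rightarrow> bool" where
  "hex i j \<longleftrightarrow> (i, j) \<in> hex_edges \<or> (j, i) \<in> hex_edges"

lemma hex_sym: "hex i j = hex j i"
  by (auto simp: hex_def)

lemma hex_neighbours:
  "hex 0 j \<longleftrightarrow> j = 2 \<or> j = 4 \<or> j = 7"
  "hex 1 j \<longleftrightarrow> j = 2 \<or> j = 5 \<or> j = 8"
  "hex 2 j \<longleftrightarrow> j = 0 \<or> j = 1 \<or> j = 3"
  "hex 3 j \<longleftrightarrow> j = 2 \<or> j = 6 \<or> j = 9"
  "hex 4 j \<longleftrightarrow> j = 0 \<or> j = 5 \<or> j = 9"
  "hex 5 j \<longleftrightarrow> j = 1 \<or> j = 4 \<or> j = 6"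
  "hex 6 j \<longleftrightarrow> j = 3 \<or> j = 5 \<or> j = 7"
  "hex 7 j \<longleftrightarrow> j = 0 \<or> j = 6 \<or> j = 8"
  "hex 8 j \<longleftrightarrow> j = 1 \<or> j = 7 \<or> j = 9"
  "hex 9 j \<longleftrightarrow> j = 3 \<or> j = 4 \<or> j = 8"
  by (auto simp: hex_def hex_edges_def)

lemmas hex_simps = hex_neighbours hex_neighbours(2)[unfolded One_nat_def]

lemma All_less_10: "(\<forall>i<10. P i) \<longleftrightarrow> P 0 \<and> P 1 \<and> P 2 \<and> P 3 \<and> P 4 \<and> P 5 \<and> P 6 \<and> P 7 \<and> P 8 \<and> P (9::nat)"
proof
  assume P: "P 0 \<and> P 1 \<and> P 2 \<and> P 3 \<and> P 4 \<and> P 5 \<and> P 6 \<and> P 7 \<and> P 8 \<and> P 9"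
  have "i = 0 \<or> i = 1 \<or> i = 2 \<or> i = 3 \<or> i = 4 \<or> i = 5 \<or> i = 6 \<or> i = 7 \<or> i = 8 \<or> i = 9" if "i < 10" for i :: nat
    using that by presburger
  then show "\<forall>i<10. P i" using P by metis
qed auto

lemma sum_less_10: "(\<Sum>i<10::nat. f i) = f 0 + f 1 + f 2 + f 3 + f 4 + f 5 + f 6 + f 7 + f 8 + (f 9 :: nat)"
proof -
  have "{..<10::nat} = {0, 1, 2, 3, 4, 5, 6, 7, 8, 9}" by auto
  then show ?thesis by (simp add: add.assoc)
qed

abbreviation hex_weight :: "nat \<Rightarrow> nat \<Rightarrow> nat" where
  "hex_weight \<equiv> (\<lambda>i j. of_bool (hex i j))"

lemma edge_weight_all:
  assumes "X \<subseteq> V" "Y \<subseteq> V" "finite V"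
  shows "edge_weight \<mu> X Y = (\<Sum>i\<in>V. \<Sum>j\<in>V. if i \<in> X \<and> j \<in> Y then \<mu> i j else 0)"
proof -
  have "(\<Sum>j\<in>Y. \<mu> i j) = (\<Sum>j\<in>V. if j \<in> Y then \<mu> i j else 0)" for i
    using assms by (subst sum.inter_restrict[symmetric]) (auto simp: Int_absorb1)
  then have "edge_weight \<mu> X Y = (\<Sum>i\<in>X. \<Sum>j\<in>V. if j \<in> Y then \<mu> i j else 0)"
    by (simp add: edge_weight_def)
  also have "\<dots> = (\<Sum>i\<in>V. if i \<in> X then (\<Sum>j\<in>V. if j \<in> Y then \<mu> i j else 0) else 0)"
    using assms by (subst sum.inter_restrict[symmetric]) (auto simp: Int_absorb1)
  also have "\<dots> = (\<Sum>i\<in>V. \<Sum>j\<in>V. if i \<in> X \<and> j \<in> Y then \<mu> i j else 0)"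
    by (intro sum.cong) auto
  finally show ?thesis .
qed

lemma hex_sum:
  fixes g :: "nat \<Rightarrow> nat \<Rightarrow> nat"
  shows "(\<Sum>i<10. \<Sum>j<10. of_bool (hex i j) * g i j) =
    (g 0 2 + g 2 0) + (g 0 4 + g 4 0) + (g 0 7 + g 7 0) +
    (g 1 2 + g 2 1) + (g 1 5 + g 5 1) + (g 1 8 + g 8 1) +
    (g 2 3 + g 3 2) + (g 3 6 + g 6 3) + (g 3 9 + g 9 3) +
    (g 4 5 + g 5 4) + (g 5 6 + g 6 5) + (g 6 7 + g 7 6) +
    (g 7 8 + g 8 7) + (g 8 9 + g 9 8) + (g 4 9 + g 9 4)"
proof -
  have "(\<Sum>j<10. of_bool (hex 0 j) * g 0 j) = g 0 2 + g 0 4 + g 0 7"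
    "(\<Sum>j<10. of_bool (hex 1 j) * g 1 j) = g 1 2 + g 1 5 + g 1 8"
    "(\<Sum>j<10. of_bool (hex 2 j) * g 2 j) = g 2 0 + g 2 1 + g 2 3"
    "(\<Sum>j<10. of_bool (hex 3 j) * g 3 j) = g 3 2 + g 3 6 + g 3 9"
    "(\<Sum>j<10. of_bool (hex 4 j) * g 4 j) = g 4 0 + g 4 5 + g 4 9"
    "(\<Sum>j<10. of_bool (hex 5 j) * g 5 j) = g 5 1 + g 5 4 + g 5 6"
    "(\<Sum>j<10. of_bool (hex 6 j) * g 6 j) = g 6 3 + g 6 5 + g 6 7"
    "(\<Sum>j<10. of_bool (hex 7 j) * g 7 j) = g 7 0 + g 7 6 + g 7 8"
    "(\<Sum>j<10. of_bool (hex 8 j) * g 8 j) = g 8 1 + g 8 7 + g 8 9"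
    "(\<Sum>j<10. of_bool (hex 9 j) * g 9 j) = g 9 3 + g 9 4 + g 9 8"
    unfolding sum_less_10 hex_neighbours by simp_all
  then show ?thesis unfolding sum_less_10[of "\<lambda>i. \<Sum>j<10. of_bool (hex i j) * g i j"] by linarith
qed

definition differ :: "nat set \<Rightarrow> nat \<Rightarrow> nat \<Rightarrow> nat" where
  "differ X i j = of_bool ((i \<in> X) \<noteq> (j \<in> X))"

text \<open>The cut as fifteen 0-1 terms, one for each edge, so that cut bounds become a case split
  on membership.\<close>

lemma hex_cut:
  assumes "X \<subseteq> {..<10}"
  shows "edge_weight hex_weight X ({..<10} - X) =
    differ X 0 2 + differ X 0 4 + differ X 0 7 + differ X 1 2 + differ X 1 5 + differ X 1 8 +
    differ X 2 3 + differ X 3 6 + differ X 3 9 + differ X 4 5 + differ X 5 6 + differ X 6 7 +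
    differ X 7 8 + differ X 8 9 + differ X 4 9"
proof -
  define g :: "nat \<Rightarrow> nat \<Rightarrow> nat" where "g i j = of_bool (i \<in> X \<and> j \<notin> X)" for i j
  have d: "differ X i j = g i j + g j i" for i j
    by (auto simp: differ_def g_def)
  have "edge_weight hex_weight X ({..<10} - X) =
      (\<Sum>i<10. \<Sum>j<10. if i \<in> X \<and> j \<in> {..<10} - X then hex_weight i j else 0)"
    using assms by (intro edge_weight_all) auto
  also have "\<dots> = (\<Sum>i<10. \<Sum>j<10. of_bool (hex i j) * g i j)"
    unfolding g_def by (intro sum.cong) auto
  finally show ?thesis unfolding hex_sum d .
qed

lemma card_less_10:
  assumes "X \<subseteq> {..<10::nat}"
  shows "card X = of_bool (0 \<in> X) + of_bool (1 \<in> X) + of_bool (2 \<in> X) + of_bool (3 \<in> X) + of_bool (4 \<in> X) +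
    of_bool (5 \<in> X) + of_bool (6 \<in> X) + of_bool (7 \<in> X) + of_bool (8 \<in> X) + of_bool (9 \<in> X)"
proof -
  have "card X = (\<Sum>i<10. if i \<in> X then 1 else 0)"
    using assms by (subst sum.inter_restrict[symmetric]) (auto simp: Int_absorb1)
  then show ?thesis by (simp add: sum_less_10 of_bool_def)
qed

text \<open>The drawing consists of the 5-cycles 0, 4, 5, 1, 2 and 3, 6, 7, 8, 9 and five edges
  between them. A cycle split by \<open>X\<close> contributes at least 2. If both are split, this
  gives 4; if one is, one of its vertices disagrees with the other cycle and adds a third edge; if
  none is, oddness puts exactly one cycle into \<open>X\<close> and all five connecting edges are
  cut.\<close>

lemma hex_r_weight: "r_weight {..<10} hex_weight 3"
proof
  show "finite {..<10::nat}" by simp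
  show "hex_weight i j = hex_weight j i" for i j by (simp add: hex_sym)
  show "hex_weight i i = 0" for i by (auto simp: hex_def hex_edges_def)
  have "\<forall>i<10. (\<Sum>j<10. hex_weight i j) = 3"
    by (simp add: All_less_10 sum_less_10 hex_simps)
  then show "(\<Sum>j\<in>{..<10}. hex_weight i j) = 3" if "i \<in> {..<10}" for i using that by blast
  show "3 \<le> edge_weight hex_weight X ({..<10} - X)" if X: "X \<subseteq> {..<10}" "odd (card X)" for X
  proof -
    have odd: "odd (card X)" by (rule X(2))
    consider "((0 \<in> X) = (4 \<in> X)) \<and> ((4 \<in> X) = (5 \<in> X)) \<and> ((5 \<in> X) = (1 \<in> X)) \<and> ((1 \<in> X) = (2 \<in> X))"
      | "2 \<le> differ X 0 4 + differ X 4 5 + differ X 1 5 + differ X 1 2 + differ X 0 2"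
      unfolding differ_def
      by (cases "0 \<in> X"; cases "4 \<in> X"; cases "5 \<in> X"; cases "1 \<in> X"; cases "2 \<in> X"; simp)
    note outer = this
    consider "((3 \<in> X) = (6 \<in> X)) \<and> ((6 \<in> X) = (7 \<in> X)) \<and> ((7 \<in> X) = (8 \<in> X)) \<and> ((8 \<in> X) = (9 \<in> X))"
      | "2 \<le> differ X 3 6 + differ X 6 7 + differ X 7 8 + differ X 8 9 + differ X 3 9"
      unfolding differ_def
      by (cases "3 \<in> X"; cases "6 \<in> X"; cases "7 \<in> X"; cases "8 \<in> X"; cases "9 \<in> X"; simp)
    note inner = this
    show ?thesis
    proof (rule outer; rule inner)
      assume "2 \<le> differ X 0 4 + differ X 4 5 + differ X 1 5 + differ X 1 2 + differ X 0 2"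
        "2 \<le> differ X 3 6 + differ X 6 7 + differ X 7 8 + differ X 8 9 + differ X 3 9"
      then show ?thesis unfolding hex_cut[OF X(1)] by linarith
    next
      assume o: "((0 \<in> X) = (4 \<in> X)) \<and> ((4 \<in> X) = (5 \<in> X)) \<and> ((5 \<in> X) = (1 \<in> X)) \<and> ((1 \<in> X) = (2 \<in> X))"
        and i: "((3 \<in> X) = (6 \<in> X)) \<and> ((6 \<in> X) = (7 \<in> X)) \<and> ((7 \<in> X) = (8 \<in> X)) \<and> ((8 \<in> X) = (9 \<in> X))"
      show ?thesis using odd o i unfolding hex_cut[OF X(1)] card_less_10[OF X(1)] differ_def
        by (cases "2 \<in> X"; cases "9 \<in> X"; simp)
    next
      assume o: "((0 \<in> X) = (4 \<in> X)) \<and> ((4 \<in> X) = (5 \<in> X)) \<and> ((5 \<in> X) = (1 \<in> X)) \<and> ((1 \<in> X) = (2 \<in> X))"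
        and i: "2 \<le> differ X 3 6 + differ X 6 7 + differ X 7 8 + differ X 8 9 + differ X 3 9"
      show ?thesis using o i unfolding hex_cut[OF X(1)] differ_def
        by (cases "2 \<in> X"; cases "3 \<in> X"; cases "6 \<in> X"; cases "7 \<in> X"; cases "8 \<in> X"; cases "9 \<in> X"; simp)
    next
      assume o: "2 \<le> differ X 0 4 + differ X 4 5 + differ X 1 5 + differ X 1 2 + differ X 0 2"
        and i: "((3 \<in> X) = (6 \<in> X)) \<and> ((6 \<in> X) = (7 \<in> X)) \<and> ((7 \<in> X) = (8 \<in> X)) \<and> ((8 \<in> X) = (9 \<in> X))"
      show ?thesis using o i unfolding hex_cut[OF X(1)] differ_def
        by (cases "9 \<in> X"; cases "0 \<in> X"; cases "1 \<in> X"; cases "2 \<in> X"; cases "4 \<in> X"; cases "5 \<in> X"; simp)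
    qed
  qed
qed

text \<open>A full set and its complement are 5-cycles joined by the spokes \<open>\<sigma>\<close>.
  What remains is how the second cycle is wound relative to the first.\<close>

lemma ten_weight_r3_hex:
  assumes "ten_weight V \<mu> 3" and bad: "\<And>\<sigma>. supported V \<mu> \<sigma> \<Longrightarrow> \<exists>X. ten_weight.full V \<mu> 3 X \<sigma>"
  shows "\<exists>h. bij_betw h {..<10} V \<and> (\<forall>i<10. \<forall>j<10. \<mu> (h i) (h j) = hex_weight i j)"
proof -
  interpret ten_weight V \<mu> 3 by fact
  obtain \<sigma> where sp: "supported V \<mu> \<sigma>" using ex_supported_pairing unfolding supported_def by auto
  then obtain X where X: "full X \<sigma>" using bad by blast
  have Xp: "X \<subseteq> V" "card X = 5" "\<sigma> ` X \<subseteq> V - X" using X unfolding full_def by auto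
  obtain a b c d e where c5: "cycle5 X a b c d e" using full_cycle5[OF refl X] by blast
  note c5' = cycle5_rotate[OF c5]
  note c5'' = cycle5_rotate[OF c5']
  note c5''' = cycle5_rotate[OF c5'']
  note c5'''' = cycle5_rotate[OF c5''']
  note sa = spokes_adjacent[OF refl bad X]
  have Xe: "X = {a, b, c, d, e}" and dX: "distinct [a, b, c, d, e]" using c5 unfolding cycle5_def by auto
  have inX: "a \<in> X" "b \<in> X" "c \<in> X" "d \<in> X" "e \<in> X" using Xe by auto
  have inY: "\<sigma> x \<in> V - X" if "x \<in> X" for x using Xp(3) that by blast
  have injs: "\<sigma> x = \<sigma> y \<longleftrightarrow> x = y" if "x \<in> X" "y \<in> X" for x y
    using supported_props(2)[OF sp] Xp(1) that by (metis subsetD)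
  have "\<sigma> ` X = V - X"
  proof (rule card_subset_eq)
    have "inj_on \<sigma> X" using injs by (intro inj_onI) blast
    then show "card (\<sigma> ` X) = card (V - X)" using Xp card_compl by (simp add: card_image)
  qed (use fin Xp in auto)
  then have Ye: "V - X = {\<sigma> a, \<sigma> b, \<sigma> c, \<sigma> d, \<sigma> e}" using Xe by auto
  have dY: "distinct [\<sigma> a, \<sigma> b, \<sigma> c, \<sigma> d, \<sigma> e]" using dX injs inX by simp
  have dXY: "x \<noteq> \<sigma> y" if "x \<in> X" "y \<in> X" for x y using inY[OF that(2)] that by auto
  have cross: "\<mu> x (\<sigma> y) = of_bool (x = y)" if "x \<in> X" "y \<in> X" for x y
    using full_cut_eq[OF refl X that(1) inY[OF that(2)]] injs that by auto
  have cross': "\<mu> (\<sigma> y) x = of_bool (x = y)" if "x \<in> X" "y \<in> X" for x y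
    using cross[OF that] sym[of "\<sigma> y" x] inY[OF that(2)] Xp(1) that by auto
  have mX: "\<mu> a b = 1" "\<mu> b c = 1" "\<mu> c d = 1" "\<mu> d e = 1" "\<mu> e a = 1"
     "\<mu> a c = 0" "\<mu> b d = 0" "\<mu> c e = 0" "\<mu> d a = 0" "\<mu> e b = 0" using c5 unfolding cycle5_def by auto
  have symX: "\<mu> y x = k" if "\<mu> x y = k" "x \<in> V" "y \<in> V" for x y k using sym that by metis
  have inV: "a \<in> V" "b \<in> V" "c \<in> V" "d \<in> V" "e \<in> V" using inX Xp by auto
  have mX': "\<mu> b a = 1" "\<mu> c b = 1" "\<mu> d c = 1" "\<mu> e d = 1" "\<mu> a e = 1"
     "\<mu> c a = 0" "\<mu> d b = 0" "\<mu> e c = 0" "\<mu> a d = 0" "\<mu> b e = 0"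
    using mX[THEN symX] inV by auto
  have inV': "\<sigma> a \<in> V" "\<sigma> b \<in> V" "\<sigma> c \<in> V" "\<sigma> d \<in> V" "\<sigma> e \<in> V" using inY inX by blast+
  have mY: "\<mu> (\<sigma> a) (\<sigma> c) = 1" "\<mu> (\<sigma> b) (\<sigma> d) = 1" "\<mu> (\<sigma> c) (\<sigma> e) = 1" "\<mu> (\<sigma> d) (\<sigma> a) = 1" "\<mu> (\<sigma> e) (\<sigma> b) = 1"
    using sa[OF _ c5] sa[OF _ c5'] sa[OF _ c5''] sa[OF _ c5'''] sa[OF _ c5''''] by auto
  have mY': "\<mu> (\<sigma> c) (\<sigma> a) = 1" "\<mu> (\<sigma> d) (\<sigma> b) = 1" "\<mu> (\<sigma> e) (\<sigma> c) = 1" "\<mu> (\<sigma> a) (\<sigma> d) = 1" "\<mu> (\<sigma> b) (\<sigma> e) = 1"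
    using mY[THEN symX] inV' by auto
  have "(\<Sum>y\<in>V - X. \<mu> x y) = 2" if "x \<in> V - X" for x
    using full_inner_degree[OF refl full_compl[OF X] that] .
  then have row: "\<mu> x (\<sigma> a) + (\<mu> x (\<sigma> b) + (\<mu> x (\<sigma> c) + (\<mu> x (\<sigma> d) + \<mu> x (\<sigma> e)))) = 2" if "x \<in> V - X" for x
    using that dY unfolding Ye by simp
  have rows: "\<mu> (\<sigma> a) (\<sigma> b) = 0 \<and> \<mu> (\<sigma> a) (\<sigma> e) = 0" "\<mu> (\<sigma> b) (\<sigma> a) = 0 \<and> \<mu> (\<sigma> b) (\<sigma> c) = 0"
     "\<mu> (\<sigma> c) (\<sigma> b) = 0 \<and> \<mu> (\<sigma> c) (\<sigma> d) = 0" "\<mu> (\<sigma> d) (\<sigma> c) = 0 \<and> \<mu> (\<sigma> d) (\<sigma> e) = 0"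
     "\<mu> (\<sigma> e) (\<sigma> d) = 0 \<and> \<mu> (\<sigma> e) (\<sigma> a) = 0"
    using row[OF inY[OF inX(1)]] row[OF inY[OF inX(2)]] row[OF inY[OF inX(3)]] row[OF inY[OF inX(4)]]
      row[OF inY[OF inX(5)]] mY mY' by linarith+
  have z: "\<mu> v v = 0" if "v \<in> V" for v using zero that .
  \<comment> \<open>The cycle a, b, c, d, e takes positions 0, 4, 5, 1, 2, and the spoke ends of e,
    c, a, d, b, which also form a cycle, take positions 3, 6, 7, 8, 9.\<close>
  define h where "h = (!) [a, d, e, \<sigma> e, b, c, \<sigma> c, \<sigma> a, \<sigma> d, \<sigma> b]"
  have "distinct [a, d, e, \<sigma> e, b, c, \<sigma> c, \<sigma> a, \<sigma> d, \<sigma> b]"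
    using dX dY dXY inX by auto
  then have "bij_betw h {..<10} (set [a, d, e, \<sigma> e, b, c, \<sigma> c, \<sigma> a, \<sigma> d, \<sigma> b])"
    unfolding h_def by (rule bij_betw_nth) auto
  moreover have "set [a, d, e, \<sigma> e, b, c, \<sigma> c, \<sigma> a, \<sigma> d, \<sigma> b] = X \<union> (V - X)"
    unfolding Ye unfolding Xe by auto
  ultimately have "bij_betw h {..<10} V" using Xp(1) by (simp add: Un_absorb1)
  moreover have "\<forall>i<10. \<forall>j<10. \<mu> (h i) (h j) = hex_weight i j"
    unfolding h_def
    using mX mX' mY mY' rows z[OF inV(1)] z[OF inV(2)] z[OF inV(3)] z[OF inV(4)] z[OF inV(5)]
      z[OF inV'(1)] z[OF inV'(2)] z[OF inV'(3)] z[OF inV'(4)] z[OF inV'(5)] cross cross' inX dX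
    by (simp add: All_less_10 hex_simps) blast
  ultimately show ?thesis by blast
qed

subsection \<open>The Petersen graph as a Kneser graph\<close>

definition pairs5 :: "nat set set" where
  "pairs5 = {A. A \<subseteq> {..<5} \<and> card A = 2}"

definition kneser :: "('a \<Rightarrow> nat set) \<Rightarrow> 'a \<Rightarrow> 'a \<Rightarrow> nat" where
  "kneser f = (\<lambda>u v. of_bool (f u \<inter> f v = {}))"

text \<open>The labelling is parametrised by an ordering of the 5-set, so that any two nonadjacent
  vertices of the Kneser graph can be moved to positions 0 and 1.\<close>

definition hex_label :: "nat \<Rightarrow> nat \<Rightarrow> nat \<Rightarrow> nat \<Rightarrow> nat \<Rightarrow> nat \<Rightarrow> nat set" where
  "hex_label p q s t u = (!) [{p,q}, {p,s}, {t,u}, {q,s}, {s,t}, {q,u}, {p,t}, {s,u}, {q,t}, {p,u}]"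

lemma hex_label_adjacent:
  assumes "distinct [p, q, s, t, u]"
  shows "\<forall>i<10. \<forall>j<10. (hex_label p q s t u i \<inter> hex_label p q s t u j = {}) = hex i j"
proof -
  have "distinct [u, t, s, q, p]" using assms by auto
  with assms show ?thesis unfolding hex_label_def by (simp add: All_less_10 hex_simps)
qed

lemma card_pairs5: "card pairs5 = 10" "finite pairs5"
proof -
  have "card pairs5 = 5 choose 2" unfolding pairs5_def by (simp add: n_subsets)
  then show "card pairs5 = 10" by (simp add: eval_nat_numeral)
  show "finite pairs5" unfolding pairs5_def by simp
qed

lemma hex_label_bij:
  assumes d: "distinct [p, q, s, t, u]" and U: "{..<5} = {p, q, s, t, u}"
  shows "bij_betw (hex_label p q s t u) {..<10} pairs5"
proof -
  let ?L = "[{p,q}, {p,s}, {t,u}, {q,s}, {s,t}, {q,u}, {p,t}, {s,u}, {q,t}, {p,u}]"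
  have "distinct ?L" using d by (auto simp: doubleton_eq_iff)
  then have "bij_betw (hex_label p q s t u) {..<10} (set ?L)"
    unfolding hex_label_def by (rule bij_betw_nth) auto
  moreover have "set ?L = pairs5"
  proof (rule card_subset_eq)
    show "finite pairs5" by (rule card_pairs5)
    show "set ?L \<subseteq> pairs5" unfolding pairs5_def U using d by auto
    show "card (set ?L) = card pairs5" using distinct_card[OF \<open>distinct ?L\<close>] card_pairs5 by simp
  qed
  ultimately show ?thesis by simp
qed

lemma pairs5_labels:
  assumes "A \<in> pairs5" "B \<in> pairs5" "A \<noteq> B" "A \<inter> B \<noteq> {}"
  shows "\<exists>p q s t u. distinct [p, q, s, t, u] \<and> {..<5} = {p, q, s, t, u} \<and> A = {p, q} \<and> B = {p, s}"
proof -
  obtain p where p: "p \<in> A" "p \<in> B" using assms by blast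
  have cA: "card A = 2" "A \<subseteq> {..<5}" and cB: "card B = 2" "B \<subseteq> {..<5}" using assms unfolding pairs5_def by auto
  obtain q where q: "A = {p, q}" "q \<noteq> p" using cA p by (auto simp: card_2_iff)
  obtain s where s: "B = {p, s}" "s \<noteq> p" using cB p by (auto simp: card_2_iff)
  have qs: "q \<noteq> s" using assms(3) q s by auto
  have sub: "{p, q, s} \<subseteq> {..<5}" using cA cB q s by auto
  have "card ({..<5} - {p, q, s}) = 2" using sub q s qs by (subst card_Diff_subset) auto
  then obtain t u where tu: "{..<5} - {p, q, s} = {t, u}" "t \<noteq> u" by (auto simp: card_2_iff)
  have "t \<in> {..<5} - {p, q, s}" "u \<in> {..<5} - {p, q, s}" using tu by auto
  then have "distinct [p, q, s, t, u]" using q s qs tu by auto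
  moreover have "{..<5} = {p, q, s} \<union> ({..<5} - {p, q, s})" using sub by blast
  then have "{..<5} = {p, q, s, t, u}" unfolding tu by auto
  ultimately show ?thesis using q s by blast
qed

lemma pairs5_no_triangle:
  assumes "A \<in> pairs5" "B \<in> pairs5" "C \<in> pairs5" "A \<inter> B = {}" "B \<inter> C = {}"
  shows "A \<inter> C \<noteq> {}"
proof
  assume "A \<inter> C = {}"
  have f: "finite A" "finite B" "finite C" and c: "card A = 2" "card B = 2" "card C = 2"
    and sub: "A \<union> B \<union> C \<subseteq> {..<5}"
    using assms finite_subset[of _ "{..<5::nat}"] unfolding pairs5_def by auto
  have "card (A \<union> B \<union> C) = 6"
    using f c assms \<open>A \<inter> C = {}\<close> by (simp add: card_Un_disjoint Int_Un_distrib2)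
  then show False using card_mono[OF _ sub] by simp
qed

text \<open>\<open>A \<union> C\<close> has at least three of the five elements, so at most one
  2-set avoids it. With the absence of triangles this gives girth at least 5.\<close>

lemma pairs5_common_neighbour:
  assumes "A \<in> pairs5" "B \<in> pairs5" "C \<in> pairs5" "D \<in> pairs5"
    "A \<inter> B = {}" "B \<inter> C = {}" "C \<inter> D = {}" "D \<inter> A = {}" "A \<noteq> C"
  shows "B = D"
proof -
  have f: "finite A" "finite B" "finite C" "finite D" and c: "card A = 2" "card B = 2" "card C = 2" "card D = 2"
    and sub: "A \<union> C \<subseteq> {..<5}" and BD: "B \<subseteq> {..<5} - (A \<union> C)" "D \<subseteq> {..<5} - (A \<union> C)"
    using assms finite_subset[of _ "{..<5::nat}"] unfolding pairs5_def by auto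
  have "card A < card (A \<union> C)"
    using f c assms(9) by (intro psubset_card_mono) (auto dest: card_subset_eq)
  moreover have "card ({..<5} - (A \<union> C)) = 5 - card (A \<union> C)"
    using sub f by (simp add: card_Diff_subset)
  ultimately have "card ({..<5} - (A \<union> C)) \<le> 2" using c by simp
  then have "B = {..<5} - (A \<union> C)" "D = {..<5} - (A \<union> C)"
    using BD c card_seteq[of "{..<5} - (A \<union> C)"] by (metis finite_Diff finite_lessThan)+
  then show ?thesis by simp
qed

section \<open>Indecomposable weights of small degree on ten vertices\<close>

lemma nondecomposable_ten_weight:
  assumes "r_weight V \<mu> r" "card V = 10" "\<not> decomposable r V \<mu>"
  shows "ten_weight V \<mu> r"
proof -
  interpret r_weight V \<mu> r by fact
  have "r > 0" using assms(3) decomposable_0[of V \<mu>] regular_weight_axioms by (cases r) auto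
  show ?thesis
  proof
    show "card V = 10" by (rule assms(2))
    show "r + 2 \<le> edge_weight \<mu> X (V - X)"
      if X: "X \<subseteq> V" "odd (card X)" "3 \<le> card X" "3 \<le> card (V - X)" for X
    proof (rule cut_not_tight[OF X(1,2)])
      show "edge_weight \<mu> X (V - X) \<noteq> r"
        using r_weight_tight_cut_card_10[OF assms(1) _ \<open>r > 0\<close> X] assms(2,3) by auto
    qed
  qed
qed

lemma remove_not_full:
  assumes "r_weight V \<mu> (Suc q)" "card V = 10" "\<not> decomposable (Suc q) V \<mu>"
    and s: "supported V \<mu> \<sigma>" and nf: "\<And>X. \<not> ten_weight.full V \<mu> (Suc q) X \<sigma>"
  shows "r_weight V (\<lambda>u v. \<mu> u v - pairing_weight \<sigma> u v) q"
    and "\<not> decomposable q V (\<lambda>u v. \<mu> u v - pairing_weight \<sigma> u v)"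
    and "\<And>u v. u \<in> V \<Longrightarrow> v \<in> V \<Longrightarrow> \<mu> u v = (\<mu> u v - pairing_weight \<sigma> u v) + pairing_weight \<sigma> u v"
proof -
  interpret ten_weight V \<mu> "Suc q" using nondecomposable_ten_weight assms by blast
  have p: "pairing V \<sigma>" "\<forall>v\<in>V. 0 < \<mu> v (\<sigma> v)" using s unfolding supported_def by auto
  have cr: "\<And>X. X \<subseteq> V \<Longrightarrow> odd (card X) \<Longrightarrow>
      edge_weight (pairing_weight \<sigma>) X (V - X) + q \<le> edge_weight \<mu> X (V - X)"
    using removable[OF s refl nf] by blast
  show "r_weight V (\<lambda>u v. \<mu> u v - pairing_weight \<sigma> u v) q" by (rule remove_pairing(1)[OF r_weight_axioms p]) (rule cr)
  show eq: "\<mu> u v = (\<mu> u v - pairing_weight \<sigma> u v) + pairing_weight \<sigma> u v" if "u \<in> V" "v \<in> V" for u v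
    by (rule remove_pairing(2)[OF r_weight_axioms p _ that]) (rule cr)
  show "\<not> decomposable q V (\<lambda>u v. \<mu> u v - pairing_weight \<sigma> u v)"
    using decomposable_Suc[OF _ p(1) eq] assms(3) by blast
qed

text \<open>By \<open>all_full_degree_3\<close> it happens only in degree 3 that all matchings are
  obstructed, so for degree 1 and 2 one can always be deleted.\<close>

lemma r_weight_decomposable_le_2:
  assumes "r_weight V \<mu> r" "card V = 10" "r \<le> 2"
  shows "decomposable r V \<mu>"
  using assms
proof (induction r arbitrary: \<mu>)
  case 0
  then show ?case using decomposable_0 unfolding r_weight_def by blast
next
  case (Suc q)
  show ?case
  proof (rule ccontr)
    assume nd: "\<not> ?case"
    then interpret ten_weight V \<mu> "Suc q" using nondecomposable_ten_weight Suc by blast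
    obtain \<sigma> where s: "supported V \<mu> \<sigma>" "\<And>X. \<not> full X \<sigma>"
      using all_full_degree_3 Suc.prems(3) by fastforce
    show False
      using remove_not_full[OF Suc.prems(1,2) nd s] Suc.IH Suc.prems by simp
  qed
qed

text \<open>A matching without a full set could be deleted, and the rest has degree 2 and
  decomposes. So every matching is obstructed, which determines the graph.\<close>

lemma nondecomposable_3_kneser:
  assumes "r_weight V \<mu> 3" "card V = 10" "\<not> decomposable 3 V \<mu>"
  shows "\<exists>f. bij_betw f V pairs5 \<and> (\<forall>u\<in>V. \<forall>v\<in>V. \<mu> u v = kneser f u v)"
proof -
  have tw: "ten_weight V \<mu> 3" using nondecomposable_ten_weight assms by blast
  have "\<exists>X. ten_weight.full V \<mu> 3 X \<sigma>" if s: "supported V \<mu> \<sigma>" for \<sigma>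
  proof (rule ccontr)
    assume "\<not> ?thesis"
    then have nf: "\<And>X. \<not> ten_weight.full V \<mu> (Suc 2) X \<sigma>" by simp
    note r = remove_not_full[of V \<mu> 2, OF _ assms(2) _ s nf]
    show False
      using r(1,2) r_weight_decomposable_le_2[of V _ 2] assms by simp
  qed
  then obtain h where h: "bij_betw h {..<10} V" and hm: "\<forall>i<10. \<forall>j<10. \<mu> (h i) (h j) = hex_weight i j"
    using ten_weight_r3_hex[OF tw] by blast
  define g where "g = hex_label 0 1 2 3 4"
  have d: "distinct [0, 1, 2, 3, 4 :: nat]" by simp
  have U: "{..<5} = {0, 1, 2, 3, 4 :: nat}" by auto
  have g: "bij_betw g {..<10} pairs5" unfolding g_def by (rule hex_label_bij[OF d U])
  define f where "f = g \<circ> inv_into {..<10} h"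
  have "bij_betw f V pairs5"
    unfolding f_def using bij_betw_trans[OF bij_betw_inv_into[OF h] g] .
  moreover have "\<mu> u v = kneser f u v" if "u \<in> V" "v \<in> V" for u v
  proof -
    obtain i j where ij: "i < 10" "j < 10" "u = h i" "v = h j" using h \<open>u \<in> V\<close> \<open>v \<in> V\<close> unfolding bij_betw_def by auto
    have "inv_into {..<10} h u = i" "inv_into {..<10} h v = j"
      using h ij unfolding bij_betw_def by (auto simp: inv_into_f_f)
    then have "f u = g i" "f v = g j" unfolding f_def by auto
    then show ?thesis using hm hex_label_adjacent[OF d] ij unfolding kneser_def g_def by auto
  qed
  ultimately show ?thesis by blast
qed

subsection \<open>Petersen graphs plus perfect matchings\<close>

lemma r_weight_add_pairing:
  assumes "r_weight V \<mu> r" "pairing V \<sigma>"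
  shows "r_weight V (\<lambda>u v. \<mu> u v + pairing_weight \<sigma> u v) (Suc r)"
proof -
  interpret r_weight V \<mu> r by fact
  interpret s: regular_weight V "pairing_weight \<sigma>" 1 using pairing_regular_weight fin assms by blast
  show ?thesis
  proof
    show "finite V" by (rule fin)
    show "\<mu> u v + pairing_weight \<sigma> u v = \<mu> v u + pairing_weight \<sigma> v u" if "u \<in> V" "v \<in> V" for u v
      using sym[OF that] s.sym[OF that] by simp
    show "\<mu> v v + pairing_weight \<sigma> v v = 0" if "v \<in> V" for v using zero[OF that] s.zero[OF that] by simp
    show "(\<Sum>u\<in>V. \<mu> v u + pairing_weight \<sigma> v u) = Suc r" if "v \<in> V" for v
      unfolding sum.distrib deg[OF that] s.deg[OF that] by simp
    show "Suc r \<le> edge_weight (\<lambda>u v. \<mu> u v + pairing_weight \<sigma> u v) X (V - X)" if X: "X \<subseteq> V" "odd (card X)" for X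
    proof -
      have "1 \<le> edge_weight (pairing_weight \<sigma>) X (V - X)"
        using pairing_cut(1)[OF fin assms(2) X] by (metis One_nat_def Suc_leI odd_pos)
      then show ?thesis unfolding edge_weight_add using cut[OF X] by linarith
    qed
  qed
qed

text \<open>\<open>N\<close> trades the added matching for another one through the new edge 01. A
  full set for \<open>N\<close> would have a cut of size 6 and separate all pairs of
  \<open>N\<close>; \<open>split\<close> rules this out. So \<open>N\<close> can be deleted, and
  what remains is indecomposable of degree 3, that is, a Petersen graph again, in a new labelling
  \<open>f\<close>.\<close>

lemma hex_plus_minus:
  assumes s: "pairing {..<10} s" "s 0 = 1"
    and nd: "\<not> decomposable 4 {..<10} (\<lambda>i j. hex_weight i j + pairing_weight s i j)"
    and N: "pairing {..<10} N" "N 0 = 1" "\<And>i. 2 \<le> i \<Longrightarrow> i < 10 \<Longrightarrow> hex i (N i)"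
    and split: "\<And>X. X \<subseteq> {..<10} \<Longrightarrow> (\<And>i. i < 10 \<Longrightarrow> i \<in> X \<longleftrightarrow> N i \<notin> X) \<Longrightarrow>
      7 \<le> edge_weight hex_weight X ({..<10} - X)"
  shows "\<exists>f. bij_betw f {..<10} pairs5 \<and> (\<forall>i<10. \<forall>j<10.
    hex_weight i j + pairing_weight s i j = kneser f i j + pairing_weight N i j)"
proof -
  let ?V = "{..<10::nat}" and ?\<kappa> = "\<lambda>i j. hex_weight i j + pairing_weight s i j"
  have rk: "r_weight ?V ?\<kappa> (Suc 3)" using r_weight_add_pairing[OF hex_r_weight s(1)] .
  have nd': "\<not> decomposable (Suc 3) ?V ?\<kappa>" using nd by simp
  interpret ten_weight ?V ?\<kappa> "Suc 3" using nondecomposable_ten_weight[OF rk _ nd'] by simp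
  have "s (s 0) = 0" "N (N 0) = 0" using s(1) N(1) unfolding pairing_def by auto
  then have 1: "s 1 = 0" "N 1 = 0" using s N by auto
  have sup: "supported ?V ?\<kappa> N"
    unfolding supported_def
  proof (intro conjI N(1) ballI)
    fix i :: nat assume "i \<in> ?V"
    then consider "i = 0" | "i = 1" | "2 \<le> i" "i < 10" by fastforce
    then show "0 < hex_weight i (N i) + pairing_weight s i (N i)"
      by cases (use s N 1 in auto)
  qed
  have "\<not> full X N" for X
  proof
    assume X: "full X N"
    then have Xp: "X \<subseteq> ?V" "edge_weight ?\<kappa> X (?V - X) = 6" unfolding full_def by auto
    have "7 \<le> edge_weight hex_weight X (?V - X)"
      using Xp(1) full_image[OF X] by (intro split) auto
    also have "\<dots> \<le> edge_weight ?\<kappa> X (?V - X)" unfolding edge_weight_add by simp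
    finally show False using Xp by simp
  qed
  note r = remove_not_full[OF rk _ nd' sup this, simplified card_lessThan]
  obtain f where f: "bij_betw f ?V pairs5"
    and fm: "\<And>i j. i \<in> ?V \<Longrightarrow> j \<in> ?V \<Longrightarrow> ?\<kappa> i j - pairing_weight N i j = kneser f i j"
    using nondecomposable_3_kneser[OF r(1) _ r(2)] by auto
  have "?\<kappa> i j = kneser f i j + pairing_weight N i j" if "i < 10" "j < 10" for i j
    using r(3)[of i j] fm[of i j] that by simp
  then show ?thesis using f by blast
qed

text \<open>Otherwise two different deletions both leave Petersen graphs. These have no parallel
  edges and no cycles of length 3 or 4, which determines enough of \<open>s\<close> for a
  contradiction.\<close>

lemma hex_plus_decomposable:
  assumes s: "pairing {..<10} s" "s 0 = 1"
  shows "decomposable 4 {..<10} (\<lambda>i j. hex_weight i j + pairing_weight s i j)"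
proof (rule ccontr)
  assume nd: "\<not> ?thesis"
  have sp: "s i < 10" "s i \<noteq> i" "s (s i) = i" if "i < 10" for i using s(1) that unfolding pairing_def by auto
  have s1: "s 1 = 0" using sp(3)[of 0] s(2) by simp
  \<comment> \<open>\<open>N1\<close> and \<open>N2\<close> consist of 01, 23 and one of the two
    perfect matchings of the hexagon.\<close>
  define N1 where "N1 = (!) [1, 0, 3, 2, 5, 4, 7, 6, 9, 8 :: nat]"
  define N2 where "N2 = (!) [1, 0, 3, 2, 9, 6, 5, 8, 7, 4 :: nat]"
  have N1: "N1 0 = 1" "N1 1 = 0" "N1 2 = 3" "N1 3 = 2" "N1 4 = 5" "N1 5 = 4" "N1 6 = 7" "N1 7 = 6" "N1 8 = 9" "N1 9 = 8"
    and N2: "N2 0 = 1" "N2 1 = 0" "N2 2 = 3" "N2 3 = 2" "N2 4 = 9" "N2 5 = 6" "N2 6 = 5" "N2 7 = 8" "N2 8 = 7" "N2 9 = 4"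
    unfolding N1_def N2_def by simp_all
  have "\<forall>i<10. N1 i < 10 \<and> N1 i \<noteq> i \<and> N1 (N1 i) = i" "\<forall>i<10. N2 i < 10 \<and> N2 i \<noteq> i \<and> N2 (N2 i) = i"
    unfolding All_less_10 N1 N2 by simp_all
  then have p: "pairing {..<10} N1" "pairing {..<10} N2" unfolding pairing_def by auto
  have "\<forall>i<10. 2 \<le> i \<longrightarrow> hex i (N1 i)" "\<forall>i<10. 2 \<le> i \<longrightarrow> hex i (N2 i)"
    unfolding All_less_10 N1 N2 hex_neighbours by simp_all
  then have e: "\<And>i. 2 \<le> i \<Longrightarrow> i < 10 \<Longrightarrow> hex i (N1 i)" "\<And>i. 2 \<le> i \<Longrightarrow> i < 10 \<Longrightarrow> hex i (N2 i)" by blast+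
  have c1: "7 \<le> edge_weight hex_weight X ({..<10} - X)"
    if X: "X \<subseteq> {..<10}" "\<And>i. i < 10 \<Longrightarrow> i \<in> X \<longleftrightarrow> N1 i \<notin> X" for X
    using X(2)[of 0] X(2)[of 2] X(2)[of 4] X(2)[of 6] X(2)[of 8] unfolding hex_cut[OF X(1)] N1 differ_def
    by (cases "1 \<in> X"; cases "3 \<in> X"; cases "5 \<in> X"; cases "7 \<in> X"; cases "9 \<in> X"; simp)
  have c2: "7 \<le> edge_weight hex_weight X ({..<10} - X)"
    if X: "X \<subseteq> {..<10}" "\<And>i. i < 10 \<Longrightarrow> i \<in> X \<longleftrightarrow> N2 i \<notin> X" for X
    using X(2)[of 0] X(2)[of 2] X(2)[of 4] X(2)[of 5] X(2)[of 7] unfolding hex_cut[OF X(1)] N2 differ_def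
    by (cases "1 \<in> X"; cases "3 \<in> X"; cases "9 \<in> X"; cases "6 \<in> X"; cases "8 \<in> X"; simp)
  obtain f where f: "bij_betw f {..<10} pairs5" and fm: "\<And>i j. i < 10 \<Longrightarrow> j < 10 \<Longrightarrow>
      hex_weight i j + pairing_weight s i j = kneser f i j + pairing_weight N1 i j"
    using hex_plus_minus[OF s nd p(1) N1(1) e(1) c1] by blast
  obtain g where gm: "\<And>i j. i < 10 \<Longrightarrow> j < 10 \<Longrightarrow>
      hex_weight i j + pairing_weight s i j = kneser g i j + pairing_weight N2 i j"
    using hex_plus_minus[OF s nd p(2) N2(1) e(2) c2] by blast
  \<comment> \<open>Adjacency in the Petersen graph that remains after deleting \<open>N1\<close>.
    It contains the edges of the drawing and of \<open>s\<close> outside \<open>N1\<close>.\<close>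
  define A where "A i j \<longleftrightarrow> f i \<inter> f j = {}" for i j
  have kA: "kneser f i j = of_bool (A i j)" for i j unfolding A_def kneser_def by simp
  have Ahex: "A i j" if "i < 10" "j < 10" "hex i j" "N1 i \<noteq> j" for i j
    using fm[OF that(1,2)] that(3,4) unfolding kA by (cases "A i j") simp_all
  have As: "A i (s i)" if "i < 10" "N1 i \<noteq> s i" for i
    using fm[OF that(1) sp(1)[OF that(1)]] that(2) unfolding kA by (cases "A i (s i)") simp_all
  have le1: "kneser k i j \<le> 1" for k :: "nat \<Rightarrow> nat set" and i j unfolding kneser_def by simp
  \<comment> \<open>An edge of \<open>s\<close> parallel to one of the drawing has multiplicity 2,
    and both deletions have to reduce it to 1.\<close>
  have double: "N1 i = s i \<and> N2 i = s i" if "i < 10" "hex i (s i)" for i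
    using fm[OF that(1) sp(1)[OF that(1)]] gm[OF that(1) sp(1)[OF that(1)]] that(2)
      le1[of f i "s i"] le1[of g i "s i"]
    by (cases "N1 i = s i"; cases "N2 i = s i") simp_all
  have fp: "f i \<in> pairs5" if "i < 10" for i using f that unfolding bij_betw_def by auto
  have fi: "f i = f j \<longleftrightarrow> i = j" if "i < 10" "j < 10" for i j
    using f that unfolding bij_betw_def inj_on_def by auto
  have tri: False if "i < 10" "j < 10" "k < 10" "A i j" "A j k" "A i k" for i j k
    using pairs5_no_triangle[OF fp[OF that(1)] fp[OF that(2)] fp[OF that(3)]] that(4-6) unfolding A_def by blast
  have quad: False if "i < 10" "j < 10" "k < 10" "l < 10" "A i j" "A j k" "A k l" "A l i" "i \<noteq> k" "j \<noteq> l" for i j k l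
    using pairs5_common_neighbour[OF fp[OF that(1)] fp[OF that(2)] fp[OF that(3)] fp[OF that(4)]] that fi
    unfolding A_def by metis
  have H: "A 0 2" "A 2 0" "A 0 4" "A 4 0" "A 0 7" "A 7 0" "A 1 2" "A 2 1" "A 1 5" "A 5 1" "A 1 8" "A 8 1"
    "A 3 6" "A 6 3" "A 3 9" "A 9 3" "A 5 6" "A 6 5" "A 7 8" "A 8 7" "A 4 9" "A 9 4"
    by (rule Ahex; simp add: hex_neighbours N1 del: One_nat_def)+
  have sne: "s i \<noteq> j" if "s j \<noteq> i" "i < 10" for i j using sp(3)[OF that(2)] that(1) by metis
  have "s 2 \<noteq> 0" "s 2 \<noteq> 1" by (rule sne; simp add: s(2) s1 del: One_nat_def)+
  then have "s 2 \<in> {3, 4, 5, 6, 7, 8, 9}" using sp(1,2)[of 2] by auto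
  \<comment> \<open>Every other partner of 2 closes a triangle or a 4-cycle with edges outside
    \<open>N1\<close>.\<close>
  then have s2: "s 2 = 3"
    using As[of 2] tri[of 2 0 4] tri[of 2 0 7] tri[of 2 1 5] tri[of 2 1 8] quad[of 2 6 5 1] quad[of 2 9 4 0] H N1 by auto
  have "s 4 \<noteq> 0" "s 4 \<noteq> 1" "s 4 \<noteq> 2" "s 4 \<noteq> 3"
  proof -
    have s3: "s 3 = 2" using sp(3)[of 2] s2 by simp
    show "s 4 \<noteq> 0" "s 4 \<noteq> 1" "s 4 \<noteq> 2" "s 4 \<noteq> 3"
      by (rule sne; simp add: s(2) s1 s2 s3 del: One_nat_def)+
  qed
  then have "s 4 \<in> {5, 6, 7, 8, 9}" using sp(1,2)[of 4] by auto
  moreover have "s 4 \<noteq> 9" using double[of 4] N1 by (auto simp: hex_neighbours)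
  \<comment> \<open>The partners 6, 7 and 8 close short cycles. The remaining partner 5 makes 45 a
    double edge, but \<open>N2\<close> matches 4 with 9.\<close>
  ultimately have s4: "s 4 = 5"
    using As[of 4] tri[of 4 0 7] quad[of 4 8 7 0] quad[of 4 6 3 9] H N1 by auto
  then show False using double[of 4] N2 by (auto simp: hex_neighbours)
qed

text \<open>The graph with m added matchings in terms of weights: \<open>f\<close> identifies V with
  the 2-subsets, and the multiset of matchings becomes an indexed family of pairings along Petersen
  edges.\<close>

definition petersen_plus :: "nat \<Rightarrow> 'a set \<Rightarrow> ('a \<Rightarrow> 'a \<Rightarrow> nat) \<Rightarrow> bool" where
  "petersen_plus m V \<mu> \<longleftrightarrow> (\<exists>f \<tau>. bij_betw f V pairs5 \<and>
     (\<forall>i<m. pairing V (\<tau> i) \<and> (\<forall>v\<in>V. f v \<inter> f (\<tau> i v) = {})) \<and>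
     (\<forall>u\<in>V. \<forall>v\<in>V. \<mu> u v = kneser f u v + (\<Sum>i<m. pairing_weight (\<tau> i) u v)))"

lemma hex_drawing:
  assumes f: "bij_betw f V pairs5" and d: "distinct [p, q, s, t, u]" and U: "{..<5} = {p, q, s, t, u}"
  defines "h \<equiv> inv_into V f \<circ> hex_label p q s t u"
  shows "bij_betw h {..<10} V" "\<And>i. i < 10 \<Longrightarrow> f (h i) = hex_label p q s t u i"
    "\<And>i j. i < 10 \<Longrightarrow> j < 10 \<Longrightarrow> kneser f (h i) (h j) = hex_weight i j"
proof -
  have L: "bij_betw (hex_label p q s t u) {..<10} pairs5" by (rule hex_label_bij[OF d U])
  show "bij_betw h {..<10} V"
    unfolding h_def using bij_betw_trans[OF L bij_betw_inv_into[OF f]] .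
  show fh: "f (h i) = hex_label p q s t u i" if "i < 10" for i
  proof -
    have "hex_label p q s t u i \<in> f ` V" using L f that unfolding bij_betw_def by auto
    then show ?thesis unfolding h_def by (simp add: f_inv_into_f)
  qed
  show "kneser f (h i) (h j) = hex_weight i j" if "i < 10" "j < 10" for i j
    using hex_label_adjacent[OF d] that unfolding kneser_def by (simp add: fh)
qed

text \<open>\<open>x\<close> and \<open>\<sigma> x\<close> have intersecting labels, so the drawing
  can be chosen with these vertices at positions 0 and 1.\<close>

lemma kneser_plus_decomposable:
  assumes f: "bij_betw f V pairs5" and s: "pairing V \<sigma>" and x: "x \<in> V" "f x \<inter> f (\<sigma> x) \<noteq> {}"
  shows "decomposable 4 V (\<lambda>u v. kneser f u v + pairing_weight \<sigma> u v)"
proof -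
  have sx: "\<sigma> x \<in> V" "\<sigma> x \<noteq> x" using s x unfolding pairing_def by auto
  have "f x \<in> pairs5" "f (\<sigma> x) \<in> pairs5" using f x sx unfolding bij_betw_def by auto
  moreover have "f x \<noteq> f (\<sigma> x)" using f x sx unfolding bij_betw_def inj_on_def by blast
  ultimately obtain p q s' t u where d: "distinct [p, q, s', t, u]" and U: "{..<5} = {p, q, s', t, u}"
    and fx: "f x = {p, q}" "f (\<sigma> x) = {p, s'}"
    using pairs5_labels[OF _ _ _ x(2)] by metis
  define h where "h = inv_into V f \<circ> hex_label p q s' t u"
  note hd = hex_drawing[OF f d U, folded h_def]
  have inj: "v = h i" if "v \<in> V" "i < 10" "f v = f (h i)" for v i
  proof -
    have "h i \<in> V" using hd(1) that(2) unfolding bij_betw_def by auto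
    then show ?thesis using f that unfolding bij_betw_def inj_on_def by blast
  qed
  have h0: "x = h 0" using fx hd(2)[of 0] by (intro inj x) (auto simp: hex_label_def)
  have h1: "\<sigma> x = h 1" using fx hd(2)[of 1] by (intro inj sx) (auto simp: hex_label_def)
  define g where "g = (\<lambda>i. inv_into {..<10} h (\<sigma> (h i)))"
  have pg: "pairing {..<10} g" unfolding g_def by (rule pairing_reindex[OF hd(1) s])
  have "g 0 = 1"
    unfolding g_def using pairing_weight_reindex[OF hd(1) s, of 0 1] h0 h1 by simp
  then have "decomposable 4 {..<10} (\<lambda>i j. hex_weight i j + pairing_weight g i j)"
    using hex_plus_decomposable pg by blast
  then have "decomposable 4 {..<10} (\<lambda>i j. kneser f (h i) (h j) + pairing_weight \<sigma> (h i) (h j))"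
    by (rule decomposable_cong) (use hd(3) pairing_weight_reindex[OF hd(1) s] in \<open>auto simp: g_def\<close>)
  then show ?thesis by (rule decomposable_reindex_inv[OF hd(1)])
qed

text \<open>If some matching is not obstructed, it is deleted and the induction hypothesis describes
  the rest. It remains to see that the deleted matching runs along Petersen edges as well.\<close>

theorem nondecomposable_petersen_plus:
  assumes "r_weight V \<mu> r" "card V = 10" "\<not> decomposable r V \<mu>"
  shows "3 \<le> r \<and> petersen_plus (r - 3) V \<mu>"
  using assms
proof (induction r arbitrary: \<mu>)
  case 0
  then show ?case using decomposable_0 unfolding r_weight_def by blast
next
  case (Suc q)
  note nd = Suc.prems(3)
  interpret ten_weight V \<mu> "Suc q" using nondecomposable_ten_weight Suc.prems by blast
  show ?case
  proof (cases "\<forall>\<sigma>. supported V \<mu> \<sigma> \<longrightarrow> (\<exists>X. full X \<sigma>)")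
    case True
    then have "Suc q = 3" using all_full_degree_3 by blast
    then show ?thesis
      using nondecomposable_3_kneser[of V \<mu>] Suc.prems unfolding petersen_plus_def by auto
  next
    case False
    then obtain \<sigma> where s: "supported V \<mu> \<sigma>" "\<And>X. \<not> full X \<sigma>" by blast
    have p: "pairing V \<sigma>" using s unfolding supported_def by blast
    define \<nu> where "\<nu> = (\<lambda>u v. \<mu> u v - pairing_weight \<sigma> u v)"
    note r = remove_not_full[OF Suc.prems s, folded \<nu>_def]
    have IH: "3 \<le> q" "petersen_plus (q - 3) V \<nu>" using Suc.IH[OF r(1) card_V r(2)] by auto
    then obtain f \<tau> where f: "bij_betw f V pairs5"
      and t: "\<And>i. i < q - 3 \<Longrightarrow> pairing V (\<tau> i) \<and> (\<forall>v\<in>V. f v \<inter> f (\<tau> i v) = {})"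
      and m: "\<And>u v. u \<in> V \<Longrightarrow> v \<in> V \<Longrightarrow> \<nu> u v = kneser f u v + (\<Sum>i<q - 3. pairing_weight (\<tau> i) u v)"
      unfolding petersen_plus_def by blast
    have m': "\<mu> u v = kneser f u v + pairing_weight \<sigma> u v + (\<Sum>i<q - 3. pairing_weight (\<tau> i) u v)"
      if "u \<in> V" "v \<in> V" for u v
      using r(3)[OF that] m[OF that] unfolding \<nu>_def by linarith
    have adj: "\<forall>v\<in>V. f v \<inter> f (\<sigma> v) = {}"
    proof (rule ccontr)
      assume "\<not> ?thesis"
      then obtain x where "x \<in> V" "f x \<inter> f (\<sigma> x) \<noteq> {}" by blast
      then have "decomposable 4 V (\<lambda>u v. kneser f u v + pairing_weight \<sigma> u v)"
        using kneser_plus_decomposable[OF f p] by blast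
      \<comment> \<open>A matching containing a non-edge makes the Petersen part decomposable
        together with it, and the other q - 3 added matchings are parts themselves.\<close>
      then have "decomposable (4 + (q - 3)) V
          (\<lambda>u v. kneser f u v + pairing_weight \<sigma> u v + (\<Sum>i<q - 3. pairing_weight (\<tau> i) u v))"
        by (rule decomposable_add_pairings) (use t in blast)
      moreover have "4 + (q - 3) = Suc q" using IH by simp
      ultimately have "decomposable (Suc q) V \<mu>" using m' decomposable_cong by fastforce
      then show False using nd by simp
    qed
    define \<tau>' where "\<tau>' = \<tau>(q - 3 := \<sigma>)"
    have q: "Suc q - 3 = Suc (q - 3)" using IH by simp
    have "\<forall>i<Suc q - 3. pairing V (\<tau>' i) \<and> (\<forall>v\<in>V. f v \<inter> f (\<tau>' i v) = {})"
      unfolding q \<tau>'_def using t p adj by (auto simp: less_Suc_eq)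
    moreover have "\<mu> u v = kneser f u v + (\<Sum>i<Suc q - 3. pairing_weight (\<tau>' i) u v)" if "u \<in> V" "v \<in> V" for u v
      using m'[OF that] unfolding q \<tau>'_def by simp
    ultimately have "petersen_plus (Suc q - 3) V \<mu>"
      unfolding petersen_plus_def using f by blast
    then show ?thesis using IH by simp
  qed
qed

section \<open>Indecomposability modulo 4\<close>

text \<open>
  \<open>e07\<close>, \<open>e49\<close>, \<open>e56\<close>, \<open>e18\<close> and \<open>e23\<close> are the edges between the disjoint 5-cycles \<open>0, 4, 5, 1, 2\<close>
  and \<open>3, 6, 7, 8, 9\<close> of the hexagon drawing.
\<close>

lemma hex_matching_spokes:
  fixes e02 e04 e07 e12 e15 e18 e23 e36 e39 e45 e56 e67 e78 e89 e49 :: bool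
  assumes "of_bool e02 + of_bool e04 + of_bool e07 = (1::nat)"
   "of_bool e12 + of_bool e15 + of_bool e18 = (1::nat)"
   "of_bool e02 + of_bool e12 + of_bool e23 = (1::nat)"
   "of_bool e23 + of_bool e36 + of_bool e39 = (1::nat)"
   "of_bool e04 + of_bool e45 + of_bool e49 = (1::nat)"
   "of_bool e15 + of_bool e45 + of_bool e56 = (1::nat)"
   "of_bool e36 + of_bool e56 + of_bool e67 = (1::nat)"
   "of_bool e07 + of_bool e67 + of_bool e78 = (1::nat)"
   "of_bool e18 + of_bool e78 + of_bool e89 = (1::nat)"
   "of_bool e39 + of_bool e49 + of_bool e89 = (1::nat)"
  shows "(of_bool e07 + of_bool e49 + of_bool e56 + of_bool e18 + of_bool e23) mod 4 = (1::nat)"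
  using assms by (cases e02; cases e04; cases e12; cases e15; simp split: if_splits; cases e45; cases e36; simp split: if_splits)

definition spokes :: "(nat \<Rightarrow> nat \<Rightarrow> nat) \<Rightarrow> nat" where
  "spokes \<mu> = \<mu> 0 7 + \<mu> 4 9 + \<mu> 5 6 + \<mu> 1 8 + \<mu> 2 3"

lemma hex_pairing_spokes:
  assumes s: "pairing {..<10} s" and e: "\<And>i. i < 10 \<Longrightarrow> hex i (s i)"
  shows "spokes (pairing_weight s) mod 4 = 1"
proof -
  have inv: "s i = j \<longleftrightarrow> s j = i" if "i < 10" "j < 10" for i j
    using s that unfolding pairing_def by auto
  have three: "of_bool (x = a) + of_bool (x = b) + of_bool (x = c) = (1::nat)"
    if "x = a \<or> x = b \<or> x = c" "a \<noteq> b" "a \<noteq> c" "b \<noteq> c" for x a b c :: nat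
    using that by auto
  have v: "of_bool (s 0 = 2) + of_bool (s 0 = 4) + of_bool (s 0 = 7) = (1::nat)"
    "of_bool (s 1 = 2) + of_bool (s 1 = 5) + of_bool (s 1 = 8) = (1::nat)"
    "of_bool (s 2 = 0) + of_bool (s 2 = 1) + of_bool (s 2 = 3) = (1::nat)"
    "of_bool (s 3 = 2) + of_bool (s 3 = 6) + of_bool (s 3 = 9) = (1::nat)"
    "of_bool (s 4 = 0) + of_bool (s 4 = 5) + of_bool (s 4 = 9) = (1::nat)"
    "of_bool (s 5 = 1) + of_bool (s 5 = 4) + of_bool (s 5 = 6) = (1::nat)"
    "of_bool (s 6 = 3) + of_bool (s 6 = 5) + of_bool (s 6 = 7) = (1::nat)"
    "of_bool (s 7 = 0) + of_bool (s 7 = 6) + of_bool (s 7 = 8) = (1::nat)"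
    "of_bool (s 8 = 1) + of_bool (s 8 = 7) + of_bool (s 8 = 9) = (1::nat)"
    "of_bool (s 9 = 3) + of_bool (s 9 = 4) + of_bool (s 9 = 8) = (1::nat)"
    by (rule three, rule hex_neighbours[THEN iffD1, OF e], simp, simp, simp, simp)+
  have i: "s 2 = 0 \<longleftrightarrow> s 0 = 2" "s 2 = 1 \<longleftrightarrow> s 1 = 2" "s 3 = 2 \<longleftrightarrow> s 2 = 3" "s 4 = 0 \<longleftrightarrow> s 0 = 4" "s 5 = 1 \<longleftrightarrow> s 1 = 5"
    "s 5 = 4 \<longleftrightarrow> s 4 = 5" "s 6 = 3 \<longleftrightarrow> s 3 = 6" "s 6 = 5 \<longleftrightarrow> s 5 = 6" "s 7 = 0 \<longleftrightarrow> s 0 = 7" "s 7 = 6 \<longleftrightarrow> s 6 = 7"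
    "s 8 = 1 \<longleftrightarrow> s 1 = 8" "s 8 = 7 \<longleftrightarrow> s 7 = 8" "s 9 = 3 \<longleftrightarrow> s 3 = 9" "s 9 = 4 \<longleftrightarrow> s 4 = 9" "s 9 = 8 \<longleftrightarrow> s 8 = 9"
    by (rule inv; simp)+
  show ?thesis unfolding spokes_def
    by (rule hex_matching_spokes[OF v(1) v(2) v(3)[unfolded i] v(4)[unfolded i] v(5)[unfolded i] v(6)[unfolded i]
      v(7)[unfolded i] v(8)[unfolded i] v(9)[unfolded i] v(10)[unfolded i]])
qed

lemma sum_mod_4:
  fixes a :: "nat \<Rightarrow> nat"
  shows "(\<And>i. i < n \<Longrightarrow> a i mod 4 = 1) \<Longrightarrow> (\<Sum>i<n. a i) mod 4 = n mod 4"
proof (induction n)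
  case (Suc n)
  have "(\<Sum>i<Suc n. a i) mod 4 = ((\<Sum>i<n. a i) mod 4 + a n mod 4) mod 4" by (simp add: mod_add_eq)
  also have "\<dots> = (n mod 4 + 1) mod 4" using Suc by simp
  finally show ?case by (simp add: mod_simps)
qed simp

lemma spokes_add: "spokes (\<lambda>i j. \<mu> i j + \<nu> i j) = spokes \<mu> + spokes \<nu>"
  by (simp add: spokes_def)

lemma spokes_sum: "spokes (\<lambda>i j. \<Sum>k<n. \<nu> k i j) = (\<Sum>k<n. spokes (\<nu> k))"
  by (simp add: spokes_def sum.distrib)

text \<open>All matchings involved run along edges of the drawing and so contain 1 modulo 4 of the
  five edges between the two cycles. These edges are counted once by the construction and once by
  the supposed decomposition.\<close>

lemma hex_plus_pairings_nondecomposable: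
  assumes t: "\<And>k. k < m \<Longrightarrow> pairing {..<10} (\<tau> k)" "\<And>k i. k < m \<Longrightarrow> i < 10 \<Longrightarrow> hex i (\<tau> k i)"
  shows "\<not> decomposable (m + 3) {..<10} (\<lambda>i j. hex_weight i j + (\<Sum>k<m. pairing_weight (\<tau> k) i j))"
proof
  let ?\<mu> = "\<lambda>i j. hex_weight i j + (\<Sum>k<m. pairing_weight (\<tau> k) i j)"
  assume "decomposable (m + 3) {..<10} ?\<mu>"
  then obtain N where N: "\<And>k. k < m + 3 \<Longrightarrow> pairing {..<10} (N k)"
    and eq: "\<And>i j. i < 10 \<Longrightarrow> j < 10 \<Longrightarrow> ?\<mu> i j = (\<Sum>k<m + 3. pairing_weight (N k) i j)"
    unfolding decomposable_def by (metis lessThan_iff)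
  \<comment> \<open>The total weight of a non-edge of the drawing is 0, so no part of the
    decomposition can use it.\<close>
  have Nhex: "hex i (N k i)" if k: "k < m + 3" and i: "i < 10" for k i
  proof (rule ccontr)
    assume nh: "\<not> hex i (N k i)"
    have "N k i < 10" using N[OF k] i unfolding pairing_def by auto
    then have "?\<mu> i (N k i) = (\<Sum>l<m + 3. pairing_weight (N l) i (N k i))" using eq i by blast
    moreover have "pairing_weight (N k) i (N k i) \<le> (\<Sum>l<m + 3. pairing_weight (N l) i (N k i))"
      using k by (intro member_le_sum[of k "{..<m + 3}" "\<lambda>l. pairing_weight (N l) i (N k i)"]) auto
    moreover have "(\<Sum>l<m. pairing_weight (\<tau> l) i (N k i)) = 0"
    proof (intro sum.neutral ballI)
      fix l assume "l \<in> {..<m}"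
      then have "hex i (\<tau> l i)" using t(2) i by simp
      then have "\<tau> l i \<noteq> N k i" using nh by metis
      then show "pairing_weight (\<tau> l) i (N k i) = (0::nat)" by simp
    qed
    ultimately show False using nh by simp
  qed
  define a where "a = (\<Sum>k<m. spokes (pairing_weight (\<tau> k)))"
  define b where "b = (\<Sum>k<m + 3. spokes (pairing_weight (N k)))"
  have "spokes ?\<mu> = 5 + (\<Sum>k<m. spokes (pairing_weight (\<tau> k)))"
  proof -
    have "spokes hex_weight = 5" unfolding spokes_def hex_neighbours by simp
    then show ?thesis unfolding spokes_add spokes_sum by simp
  qed
  moreover have "spokes ?\<mu> = (\<Sum>k<m + 3. spokes (pairing_weight (N k)))"
  proof -
    have "spokes ?\<mu> = spokes (\<lambda>i j. \<Sum>k<m + 3. pairing_weight (N k) i j)"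
      unfolding spokes_def by (intro arg_cong2[where f = "(+)"] eq) simp_all
    then show ?thesis unfolding spokes_sum .
  qed
  moreover have "(\<Sum>k<m. spokes (pairing_weight (\<tau> k))) mod 4 = m mod 4"
    by (rule sum_mod_4) (use hex_pairing_spokes t in auto)
  moreover have "(\<Sum>k<m + 3. spokes (pairing_weight (N k))) mod 4 = (m + 3) mod 4"
    by (rule sum_mod_4) (use hex_pairing_spokes N Nhex in auto)
  ultimately have "b = 5 + a" "a mod 4 = m mod 4" "b mod 4 = (m + 3) mod 4"
    unfolding a_def b_def by simp_all
  \<comment> \<open>The two counts differ by 2 modulo 4.\<close>
  then have "(m + 3) mod 4 = (5 + m) mod 4" by (metis mod_add_right_eq)
  then show False by presburger
qed

lemma r_weight_cong:
  assumes "r_weight V \<nu> r" "\<And>u v. u \<in> V \<Longrightarrow> v \<in> V \<Longrightarrow> \<nu> u v = \<mu> u v"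
  shows "r_weight V \<mu> r"
proof -
  interpret r_weight V \<nu> r by fact
  show ?thesis
  proof
    show "finite V" by (rule fin)
    show "\<mu> u v = \<mu> v u" if "u \<in> V" "v \<in> V" for u v using sym assms(2) that by metis
    show "\<mu> v v = 0" if "v \<in> V" for v using zero assms(2) that by metis
    show "(\<Sum>u\<in>V. \<mu> v u) = r" if "v \<in> V" for v using deg[OF that] assms(2) that by simp
    show "r \<le> edge_weight \<mu> X (V - X)" if X: "X \<subseteq> V" "odd (card X)" for X
    proof -
      have "edge_weight \<nu> X (V - X) = edge_weight \<mu> X (V - X)"
        by (intro edge_weight_cong assms(2)) (use X in auto)
      then show ?thesis using cut[OF X] by simp
    qed
  qed
qed

theorem petersen_plus_nondecomposable:
  assumes "petersen_plus m V \<mu>"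
  shows "r_weight V \<mu> (m + 3)" "card V = 10" "\<not> decomposable (m + 3) V \<mu>"
proof -
  obtain f \<tau> where f: "bij_betw f V pairs5"
    and t: "\<And>i. i < m \<Longrightarrow> pairing V (\<tau> i)" "\<And>i v. i < m \<Longrightarrow> v \<in> V \<Longrightarrow> f v \<inter> f (\<tau> i v) = {}"
    and mu: "\<And>u v. u \<in> V \<Longrightarrow> v \<in> V \<Longrightarrow> \<mu> u v = kneser f u v + (\<Sum>i<m. pairing_weight (\<tau> i) u v)"
    using assms unfolding petersen_plus_def by blast
  show "card V = 10" using bij_betw_same_card[OF f] card_pairs5 by simp
  have d: "distinct [0, 1, 2, 3, 4 :: nat]" by simp
  have U: "{..<5} = {0, 1, 2, 3, 4 :: nat}" by auto
  define h where "h = inv_into V f \<circ> hex_label 0 1 2 3 4"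
  note hd = hex_drawing[OF f d U, folded h_def]
  have hV: "h i \<in> V" if "i < 10" for i using hd(1) that unfolding bij_betw_def by auto
  define g where "g = (\<lambda>k i. inv_into {..<10} h (\<tau> k (h i)))"
  have g: "pairing {..<10} (g k)" if "k < m" for k
    unfolding g_def by (rule pairing_reindex[OF hd(1) t(1)[OF that]])
  have pw: "pairing_weight (\<tau> k) (h i) (h j) = pairing_weight (g k) i j" if "k < m" "i < 10" "j < 10" for k i j
    using pairing_weight_reindex[OF hd(1) t(1)[OF that(1)], of i j] that unfolding g_def by simp
  have ghex: "hex i (g k i)" if "k < m" "i < 10" for k i
  proof -
    have gi: "g k i < 10" using g[OF that(1)] that(2) unfolding pairing_def by auto
    have "\<tau> k (h i) = h (g k i)" using pairing_weight_reindex[OF hd(1) t(1)[OF that(1)], of i "g k i"] that gi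
      unfolding g_def by simp
    then have "kneser f (h i) (h (g k i)) = 1" using t(2)[OF that(1) hV[OF that(2)]] unfolding kneser_def by simp
    then show ?thesis using hd(3)[OF that(2) gi] by (cases "hex i (g k i)") simp_all
  qed
  let ?\<nu> = "\<lambda>i j. hex_weight i j + (\<Sum>k<m. pairing_weight (g k) i j)"
  have eq: "\<mu> (h i) (h j) = ?\<nu> i j" if "i \<in> {..<10}" "j \<in> {..<10}" for i j
    using mu[OF hV hV, of i j] hd(3)[of i j] pw[of _ i j] that by simp
  show "\<not> decomposable (m + 3) V \<mu>"
  proof
    assume "decomposable (m + 3) V \<mu>"
    then have "decomposable (m + 3) {..<10} (\<lambda>i j. \<mu> (h i) (h j))" by (rule decomposable_reindex[OF hd(1)])
    then have "decomposable (m + 3) {..<10} ?\<nu>" by (rule decomposable_cong) (use eq in simp)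
    then show False using hex_plus_pairings_nondecomposable[of m g] g ghex by blast
  qed
  have "r_weight {..<10} ?\<nu> (m + 3)"
    using g
  proof (induction m)
    case 0 then show ?case using hex_r_weight by simp
  next
    case (Suc m)
    then have "r_weight {..<10} (\<lambda>i j. hex_weight i j + (\<Sum>k<m. pairing_weight (g k) i j)) (m + 3)" by simp
    from r_weight_add_pairing[OF this, of "g m"] Suc.prems show ?case by (simp add: add.assoc)
  qed
  moreover have h': "bij_betw (inv_into {..<10} h) V {..<10}" by (rule bij_betw_inv_into[OF hd(1)])
  ultimately have "r_weight V (\<lambda>u v. ?\<nu> (inv_into {..<10} h u) (inv_into {..<10} h v)) (m + 3)"
    using r_weight_reindex by blast
  moreover have "?\<nu> (inv_into {..<10} h u) (inv_into {..<10} h v) = \<mu> u v" if "u \<in> V" "v \<in> V" for u v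
  proof -
    have "inv_into {..<10} h w \<in> {..<10}" "h (inv_into {..<10} h w) = w" if "w \<in> V" for w
      using hd(1) that unfolding bij_betw_def by (auto intro: inv_into_into f_inv_into_f)
    then show ?thesis using eq that by metis
  qed
  ultimately show "r_weight V \<mu> (m + 3)" by (rule r_weight_cong)
qed

subsection \<open>Multigraphs as weights\<close>

definition edge_mult :: "('v, 'e) mgraph \<Rightarrow> 'v \<Rightarrow> 'v \<Rightarrow> nat" where
  "edge_mult G u v = card {e \<in> edges G. ends G e = {u, v}}"

lemma multigraphD:
  assumes "multigraph G"
  shows "finite (verts G)" "verts G \<noteq> {}" "finite (edges G)"
    "\<And>e. e \<in> edges G \<Longrightarrow> ends G e \<subseteq> verts G" "\<And>e. e \<in> edges G \<Longrightarrow> card (ends G e) = 2"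
  using assms unfolding multigraph_def by auto

lemma other_end:
  assumes "multigraph G" "e \<in> edges G" "v \<in> ends G e"
  shows "\<exists>w\<in>verts G. w \<noteq> v \<and> ends G e = {v, w}"
proof -
  obtain x y where xy: "ends G e = {x, y}" "x \<noteq> y"
    using multigraphD(5)[OF assms(1,2)] by (auto simp: card_2_iff)
  moreover have "x \<in> verts G" "y \<in> verts G" using multigraphD(4)[OF assms(1,2)] xy by auto
  ultimately show ?thesis using assms(3) by (metis insertE insert_commute singletonD)
qed

text \<open>As \<open>X\<close> and \<open>Y\<close> are disjoint, an edge between them comes from
  only one ordered pair.\<close>

lemma edge_weight_edge_mult:
  assumes G: "multigraph G" and X: "X \<subseteq> verts G" and Y: "Y \<subseteq> verts G" and XY: "X \<inter> Y = {}"
  shows "edge_weight (edge_mult G) X Y = card {e \<in> edges G. \<exists>x\<in>X. \<exists>y\<in>Y. ends G e = {x, y}}"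
proof -
  note m = multigraphD[OF G]
  define S where "S p = {e \<in> edges G. ends G e = {fst p, snd p}}" for p
  have f: "finite X" "finite Y" using X Y m(1) finite_subset by blast+
  have "edge_weight (edge_mult G) X Y = (\<Sum>p\<in>X \<times> Y. card (S p))"
    by (simp add: edge_weight_def edge_mult_def S_def sum.cartesian_product case_prod_beta)
  also have "\<dots> = card (\<Union>p\<in>X \<times> Y. S p)"
  proof (rule card_UN_disjoint[symmetric])
    show "\<forall>p\<in>X \<times> Y. finite (S p)" using m(3) unfolding S_def by auto
    show "\<forall>p\<in>X \<times> Y. \<forall>q\<in>X \<times> Y. p \<noteq> q \<longrightarrow> S p \<inter> S q = {}"
      using XY unfolding S_def by (auto simp: doubleton_eq_iff)
  qed (use f in simp)
  also have "(\<Union>p\<in>X \<times> Y. S p) = {e \<in> edges G. \<exists>x\<in>X. \<exists>y\<in>Y. ends G e = {x, y}}"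
    unfolding S_def by fastforce
  finally show ?thesis .
qed

lemma edge_mult_sym_weight:
  assumes "multigraph G"
  shows "sym_weight (verts G) (edge_mult G)"
proof
  show "finite (verts G)" using multigraphD[OF assms] by blast
  show "edge_mult G u v = edge_mult G v u" for u v by (simp add: edge_mult_def insert_commute)
  show "edge_mult G v v = 0" for v
  proof -
    have "{e \<in> edges G. ends G e = {v, v}} = {}"
    proof -
      have "ends G e \<noteq> {v, v}" if "e \<in> edges G" for e using multigraphD(5)[OF assms that] by auto
      then show ?thesis by blast
    qed
    then show ?thesis by (simp only: edge_mult_def card.empty)
  qed
qed

lemma sum_edge_mult_degree:
  assumes G: "multigraph G" and v: "v \<in> verts G"
  shows "(\<Sum>u\<in>verts G. edge_mult G v u) = degree G v"
proof -
  interpret sym_weight "verts G" "edge_mult G" by (rule edge_mult_sym_weight[OF G])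
  have "(\<Sum>u\<in>verts G. edge_mult G v u) = edge_mult G v v + (\<Sum>u\<in>verts G - {v}. edge_mult G v u)"
    using fin v by (rule sum.remove)
  also have "\<dots> = edge_weight (edge_mult G) {v} (verts G - {v})" using zero[OF v] by (simp add: edge_weight_def)
  also have "\<dots> = card {e \<in> edges G. \<exists>x\<in>{v}. \<exists>y\<in>verts G - {v}. ends G e = {x, y}}"
    by (rule edge_weight_edge_mult[OF G]) (use v in auto)
  also have "{e \<in> edges G. \<exists>x\<in>{v}. \<exists>y\<in>verts G - {v}. ends G e = {x, y}} = {e \<in> edges G. v \<in> ends G e}"
    using other_end[OF G] by fastforce
  finally show ?thesis by (simp add: degree_def)
qed

lemma card_boundary:
  assumes G: "multigraph G" and X: "X \<subseteq> verts G"
  shows "card (boundary G X) = edge_weight (edge_mult G) X (verts G - X)"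
proof -
  have "card (ends G e \<inter> X) = 1 \<longleftrightarrow> (\<exists>x\<in>X. \<exists>y\<in>verts G - X. ends G e = {x, y})" if e: "e \<in> edges G" for e
  proof
    assume "card (ends G e \<inter> X) = 1"
    then obtain x where x: "ends G e \<inter> X = {x}" by (auto simp: card_1_singleton_iff)
    then obtain y where "y \<in> verts G" "y \<noteq> x" "ends G e = {x, y}" using other_end[OF G e, of x] by blast
    then show "\<exists>x\<in>X. \<exists>y\<in>verts G - X. ends G e = {x, y}" using x by blast
  next
    assume "\<exists>x\<in>X. \<exists>y\<in>verts G - X. ends G e = {x, y}"
    then obtain x y where "x \<in> X" "y \<notin> X" "ends G e = {x, y}" by blast
    then have "ends G e \<inter> X = {x}" by auto
    then show "card (ends G e \<inter> X) = 1" by simp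
  qed
  then have "boundary G X = {e \<in> edges G. \<exists>x\<in>X. \<exists>y\<in>verts G - X. ends G e = {x, y}}"
    unfolding boundary_def by blast
  then show ?thesis using edge_weight_edge_mult[OF G X, of "verts G - X"] by simp
qed

lemma r_graph_iff:
  "r_graph r G \<longleftrightarrow> multigraph G \<and> r_weight (verts G) (edge_mult G) r"
proof
  assume "r_graph r G"
  then have G: "multigraph G" and deg: "\<And>v. v \<in> verts G \<Longrightarrow> degree G v = r"
    and cut: "\<And>X. X \<subseteq> verts G \<Longrightarrow> odd (card X) \<Longrightarrow> r \<le> card (boundary G X)"
    unfolding r_graph_def regular_def by auto
  interpret sym_weight "verts G" "edge_mult G" by (rule edge_mult_sym_weight[OF G])
  have "r_weight (verts G) (edge_mult G) r"
  proof
    show "(\<Sum>u\<in>verts G. edge_mult G v u) = r" if "v \<in> verts G" for v using sum_edge_mult_degree[OF G that] deg[OF that] by simp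
    show "r \<le> edge_weight (edge_mult G) X (verts G - X)" if "X \<subseteq> verts G" "odd (card X)" for X
      using cut[OF that] card_boundary[OF G that(1)] by simp
  qed
  then show "multigraph G \<and> r_weight (verts G) (edge_mult G) r" using G by blast
next
  assume "multigraph G \<and> r_weight (verts G) (edge_mult G) r"
  then have G: "multigraph G" and "r_weight (verts G) (edge_mult G) r" by auto
  then interpret r_weight "verts G" "edge_mult G" r by blast
  show "r_graph r G"
    unfolding r_graph_def regular_def
    using G deg cut sum_edge_mult_degree[OF G] card_boundary[OF G] by auto
qed

section \<open>Disjoint perfect matchings and edge colourings\<close>

definition packing :: "('v, 'e) mgraph \<Rightarrow> nat \<Rightarrow> (nat \<Rightarrow> 'e set) \<Rightarrow> bool" where
  "packing G k M \<longleftrightarrow> (\<forall>i<k. perfect_matching G (M i)) \<and> (\<forall>i<k. \<forall>j<k. i \<noteq> j \<longrightarrow> M i \<inter> M j = {})"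

lemma perfect_matching_pairing:
  assumes G: "multigraph G" and M: "perfect_matching G M"
  shows "\<exists>\<sigma>. pairing (verts G) \<sigma> \<and>
    (\<forall>u\<in>verts G. \<forall>v\<in>verts G. pairing_weight \<sigma> u v = card {e \<in> M. ends G e = {u, v}})"
proof -
  have ME: "M \<subseteq> edges G" and uniq: "\<And>v e e'. v \<in> verts G \<Longrightarrow> e \<in> M \<Longrightarrow> v \<in> ends G e \<Longrightarrow> e' \<in> M \<Longrightarrow> v \<in> ends G e' \<Longrightarrow> e = e'"
    using M unfolding perfect_matching_def by blast+
  have "\<exists>w\<in>verts G. w \<noteq> v \<and> (\<exists>e\<in>M. ends G e = {v, w})" if v: "v \<in> verts G" for v
  proof -
    obtain e where "e \<in> M" "v \<in> ends G e" using M v unfolding perfect_matching_def by blast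
    then show ?thesis using other_end[OF G, of e v] ME by blast
  qed
  then obtain \<sigma> where s: "\<And>v. v \<in> verts G \<Longrightarrow> \<sigma> v \<in> verts G \<and> \<sigma> v \<noteq> v \<and> (\<exists>e\<in>M. ends G e = {v, \<sigma> v})"
    by metis
  have only: "v = \<sigma> u" if uv: "u \<in> verts G" "e \<in> M" "ends G e = {u, v}" for u v e
  proof -
    obtain e' where e': "e' \<in> M" "ends G e' = {u, \<sigma> u}" using s[OF uv(1)] by blast
    then have "e = e'" using uniq[OF uv(1,2)] uv(3) by blast
    then show ?thesis using uv(3) e'(2) by (metis doubleton_eq_iff)
  qed
  have "\<sigma> (\<sigma> v) = v" if v: "v \<in> verts G" for v
  proof -
    obtain e where "e \<in> M" "ends G e = {v, \<sigma> v}" using s[OF v] by blast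
    then show ?thesis using only[of "\<sigma> v" e v] s[OF v] by (simp add: insert_commute)
  qed
  then have "pairing (verts G) \<sigma>" using s unfolding pairing_def by blast
  moreover have "pairing_weight \<sigma> u v = card {e \<in> M. ends G e = {u, v}}" if uv: "u \<in> verts G" "v \<in> verts G" for u v
  proof (cases "\<sigma> u = v")
    case True
    then obtain e where e: "e \<in> M" "ends G e = {u, v}" using s[OF uv(1)] by blast
    then have "{e \<in> M. ends G e = {u, v}} = {e}" using uniq[OF uv(1)] by blast
    then show ?thesis using True by simp
  next
    case False
    then have "{e \<in> M. ends G e = {u, v}} = {}" using only[OF uv(1)] by blast
    then show ?thesis using False by (simp only: card.empty) simp
  qed
  ultimately show ?thesis by blast
qed

lemma packing_pairings:
  assumes G: "multigraph G" and M: "packing G k M"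
  shows "\<exists>\<sigma>. (\<forall>i<k. pairing (verts G) (\<sigma> i)) \<and>
    (\<forall>u\<in>verts G. \<forall>v\<in>verts G. (\<Sum>i<k. pairing_weight (\<sigma> i) u v) \<le> edge_mult G u v)"
proof -
  have "\<forall>i<k. \<exists>\<sigma>. pairing (verts G) \<sigma> \<and>
    (\<forall>u\<in>verts G. \<forall>v\<in>verts G. pairing_weight \<sigma> u v = card {e \<in> M i. ends G e = {u, v}})"
    using perfect_matching_pairing[OF G] M unfolding packing_def by blast
  then obtain \<sigma> where s: "\<And>i. i < k \<Longrightarrow> pairing (verts G) (\<sigma> i)"
    and c: "\<And>i u v. i < k \<Longrightarrow> u \<in> verts G \<Longrightarrow> v \<in> verts G \<Longrightarrow> pairing_weight (\<sigma> i) u v = card {e \<in> M i. ends G e = {u, v}}"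
    by metis
  have ME: "M i \<subseteq> edges G" if "i < k" for i using M that unfolding packing_def perfect_matching_def by blast
  have "(\<Sum>i<k. pairing_weight (\<sigma> i) u v) \<le> edge_mult G u v" if "u \<in> verts G" "v \<in> verts G" for u v
  proof -
    have "(\<Sum>i<k. pairing_weight (\<sigma> i) u v) = (\<Sum>i<k. card {e \<in> M i. ends G e = {u, v}})"
      using c that by (intro sum.cong) auto
    also have "\<dots> = card (\<Union>i<k. {e \<in> M i. ends G e = {u, v}})"
    proof (rule card_UN_disjoint[symmetric])
      show "\<forall>i\<in>{..<k}. finite {e \<in> M i. ends G e = {u, v}}"
        using ME multigraphD(3)[OF G] finite_subset by fastforce
      show "\<forall>i\<in>{..<k}. \<forall>j\<in>{..<k}. i \<noteq> j \<longrightarrow> {e \<in> M i. ends G e = {u, v}} \<inter> {e \<in> M j. ends G e = {u, v}} = {}"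
        using M unfolding packing_def by blast
    qed simp
    also have "\<dots> \<le> edge_mult G u v"
      unfolding edge_mult_def using ME multigraphD(3)[OF G] by (intro card_mono) auto
    finally show ?thesis .
  qed
  then show ?thesis using s by blast
qed

text \<open>Pairings know only pairs of vertices, so concrete edges have to be chosen. For each
  2-set \<open>P\<close> the indices of the pairings that use \<open>P\<close> are no more numerous
  than the parallel edges on \<open>P\<close>, and an injection \<open>g P\<close> keeps the
  resulting matchings disjoint.\<close>

lemma pairings_packing:
  assumes G: "multigraph G" and s: "\<And>i. i < k \<Longrightarrow> pairing (verts G) (\<sigma> i)"
    and le: "\<And>u v. u \<in> verts G \<Longrightarrow> v \<in> verts G \<Longrightarrow> (\<Sum>i<k. pairing_weight (\<sigma> i) u v) \<le> edge_mult G u v"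
  shows "\<exists>M. packing G k M"
proof -
  have sp: "\<sigma> i v \<in> verts G" "\<sigma> i v \<noteq> v" "\<sigma> i (\<sigma> i v) = v" if "i < k" "v \<in> verts G" for i v
    using s[OF that(1)] that(2) unfolding pairing_def by blast+
  define I where "I P = {i. i < k \<and> (\<exists>u\<in>verts G. P = {u, \<sigma> i u})}" for P
  define J where "J P = {e \<in> edges G. ends G e = P}" for P
  have same: "{u, \<sigma> i u} = {v, \<sigma> i v}" if "i < k" "u \<in> verts G" "v \<in> verts G" "v \<in> {u, \<sigma> i u}" for i u v
    using that sp by (metis insertE insert_commute singletonD)
  have "card (I P) \<le> card (J P)" for P
  proof (cases "I P = {}")
    case False
    then obtain i u where iu: "i < k" "u \<in> verts G" "P = {u, \<sigma> i u}" unfolding I_def by blast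
    define v where "v = \<sigma> i u"
    have v: "v \<in> verts G" "v \<noteq> u" "P = {u, v}" using iu sp unfolding v_def by auto
    have "j \<in> I P \<longleftrightarrow> j < k \<and> \<sigma> j u = v" for j
    proof
      assume "j \<in> I P"
      then obtain w where "j < k" "w \<in> verts G" "P = {w, \<sigma> j w}" unfolding I_def by blast
      then have "P = {u, \<sigma> j u}" using same[of j w u] iu by auto
      then show "j < k \<and> \<sigma> j u = v" using v \<open>j < k\<close> by (metis doubleton_eq_iff)
    next
      assume "j < k \<and> \<sigma> j u = v"
      then show "j \<in> I P" using v iu(2) unfolding I_def by blast
    qed
    then have "I P = {j\<in>{..<k}. \<sigma> j u = v}" by auto
    then have "card (I P) = (\<Sum>j<k. pairing_weight (\<sigma> j) u v)"
      by (simp add: of_bool_def sum.If_cases Int_def)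
    also have "\<dots> \<le> card (J P)" using le[OF iu(2) v(1)] unfolding edge_mult_def J_def v(3) .
    finally show ?thesis .
  qed simp
  moreover have "finite (I P)" "finite (J P)" for P
    using multigraphD(3)[OF G] unfolding I_def J_def by auto
  ultimately have "\<exists>g. g ` I P \<subseteq> J P \<and> inj_on g (I P)" for P by (intro card_le_inj) auto
  then obtain g where g: "\<And>P. g P ` I P \<subseteq> J P" "\<And>P. inj_on (g P) (I P)" by metis
  define M where "M i = {g {v, \<sigma> i v} i |v. v \<in> verts G}" for i
  have gi: "g {v, \<sigma> i v} i \<in> edges G" "ends G (g {v, \<sigma> i v} i) = {v, \<sigma> i v}" "i \<in> I {v, \<sigma> i v}"
    if "i < k" "v \<in> verts G" for i v
  proof -
    show i: "i \<in> I {v, \<sigma> i v}" using that unfolding I_def by blast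
    then have "g {v, \<sigma> i v} i \<in> J {v, \<sigma> i v}" using g(1) by blast
    then show "g {v, \<sigma> i v} i \<in> edges G" "ends G (g {v, \<sigma> i v} i) = {v, \<sigma> i v}" unfolding J_def by auto
  qed
  have "perfect_matching G (M i)" if i: "i < k" for i
    unfolding perfect_matching_def
  proof (intro conjI ballI)
    show "M i \<subseteq> edges G" using gi(1)[OF i] unfolding M_def by blast
    fix v assume v: "v \<in> verts G"
    show "\<exists>!e. e \<in> M i \<and> v \<in> ends G e"
    proof (intro ex1I conjI)
      show "g {v, \<sigma> i v} i \<in> M i" using v unfolding M_def by blast
      show "v \<in> ends G (g {v, \<sigma> i v} i)" using gi(2)[OF i v] by simp
      fix e assume e: "e \<in> M i \<and> v \<in> ends G e"
      then obtain w where w: "w \<in> verts G" "e = g {w, \<sigma> i w} i" unfolding M_def by blast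
      then have "v \<in> {w, \<sigma> i w}" using e gi(2)[OF i w(1)] by simp
      then show "e = g {v, \<sigma> i v} i" using same[OF i w(1) v] w(2) by simp
    qed
  qed
  moreover have "M i \<inter> M j = {}" if ij: "i < k" "j < k" "i \<noteq> j" for i j
  proof (rule ccontr)
    assume "M i \<inter> M j \<noteq> {}"
    then obtain u v where uv: "u \<in> verts G" "v \<in> verts G" "g {u, \<sigma> i u} i = g {v, \<sigma> j v} j" unfolding M_def by blast
    then have P: "{u, \<sigma> i u} = {v, \<sigma> j v}" using gi(2)[OF ij(1) uv(1)] gi(2)[OF ij(2) uv(2)] by simp
    then show False
      using g(2)[of "{u, \<sigma> i u}"] uv(3) gi(3)[OF ij(1) uv(1)] gi(3)[OF ij(2) uv(2)] ij(3) unfolding inj_on_def by metis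
  qed
  ultimately show ?thesis unfolding packing_def by blast
qed

text \<open>Sets of matchings and indexed families count alike: the graph has a vertex, so perfect
  matchings are nonempty, and disjoint ones are different. The maximum exists because there are
  finitely many edge sets.\<close>

lemma le_pm_packing_number:
  assumes G: "multigraph G"
  shows "k \<le> pm_packing_number G \<longleftrightarrow> (\<exists>M. packing G k M)"
proof -
  define \<F> where "\<F> = {F. (\<forall>M \<in> F. perfect_matching G M) \<and> pairwise disjnt F}"
  have sub: "F \<subseteq> Pow (edges G)" if "F \<in> \<F>" for F using that unfolding \<F>_def perfect_matching_def by blast
  have fin: "finite (Pow (edges G))" using multigraphD(3)[OF G] by simp
  have eq: "{card F | F. (\<forall>M \<in> F. perfect_matching G M) \<and> pairwise disjnt F} = card ` \<F>" unfolding \<F>_def by blast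
  have S: "finite (card ` \<F>)" "card ` \<F> \<noteq> {}"
  proof -
    have "\<F> \<subseteq> Pow (Pow (edges G))" using sub by blast
    then show "finite (card ` \<F>)" using fin by (meson finite_Pow_iff finite_imageI finite_subset)
    have "{} \<in> \<F>" unfolding \<F>_def by (simp add: pairwise_def)
    then show "card ` \<F> \<noteq> {}" by blast
  qed
  show ?thesis
  proof
    assume k: "k \<le> pm_packing_number G"
    have "pm_packing_number G \<in> card ` \<F>" unfolding pm_packing_number_def eq using Max_in[OF S] .
    then obtain F where F: "F \<in> \<F>" "k \<le> card F" using k by auto
    have "finite F" using sub[OF F(1)] fin finite_subset by blast
    then obtain h where h: "bij_betw h {0..<card F} F" using ex_bij_betw_nat_finite by blast
    have hF: "h i \<in> F" if "i < k" for i using h that F(2) unfolding bij_betw_def by auto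
    have hne: "h i \<noteq> h j" if "i < k" "j < k" "i \<noteq> j" for i j
      using h that F(2) unfolding bij_betw_def inj_on_def by (metis atLeastLessThan_iff le0 order_less_le_trans)
    have FP: "perfect_matching G N" "N' \<in> F \<Longrightarrow> N \<noteq> N' \<Longrightarrow> N \<inter> N' = {}" if "N \<in> F" for N N'
      using F(1) that unfolding \<F>_def pairwise_def disjnt_def by auto
    have "packing G k h"
      unfolding packing_def
    proof (intro conjI allI impI)
      show "perfect_matching G (h i)" if "i < k" for i using FP(1)[OF hF[OF that]] .
      show "h i \<inter> h j = {}" if "i < k" "j < k" "i \<noteq> j" for i j
        using FP(2)[OF hF[OF that(1)] hF[OF that(2)] hne[OF that]] .
    qed
    then show "\<exists>M. packing G k M" by blast
  next
    assume "\<exists>M. packing G k M"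
    then obtain M where M: "packing G k M" by blast
    obtain v where v: "v \<in> verts G" using multigraphD(2)[OF G] by blast
    have "M i \<noteq> {}" if "i < k" for i using M v that unfolding packing_def perfect_matching_def by blast
    then have "inj_on M {..<k}" using M unfolding packing_def inj_on_def by (metis Int_absorb lessThan_iff)
    then have "card (M ` {..<k}) = k" by (simp add: card_image)
    moreover have "M ` {..<k} \<in> \<F>"
    proof -
      have pm: "perfect_matching G N" if "N \<in> M ` {..<k}" for N using M that unfolding packing_def by auto
      have disj: "N \<inter> N' = {}" if N: "N \<in> M ` {..<k}" "N' \<in> M ` {..<k}" "N \<noteq> N'" for N N'
      proof -
        obtain i j where "i < k" "j < k" "N = M i" "N' = M j" using N by auto
        then show ?thesis using M N(3) unfolding packing_def by metis
      qed
      show ?thesis using pm disj unfolding \<F>_def pairwise_def disjnt_def by simp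
    qed
    ultimately have "k \<in> card ` \<F>" by (metis image_eqI)
    then show "k \<le> pm_packing_number G" unfolding pm_packing_number_def eq using Max_ge[OF S(1)] by blast
  qed
qed

context regular_weight
begin

text \<open>Both sides have row sums r, so the pointwise inequality is an equality.\<close>

lemma pairings_decomposable:
  assumes s: "\<And>i. i < r \<Longrightarrow> pairing V (\<sigma> i)"
    and le: "\<And>u v. u \<in> V \<Longrightarrow> v \<in> V \<Longrightarrow> (\<Sum>i<r. pairing_weight (\<sigma> i) u v) \<le> \<mu> u v"
  shows "decomposable r V \<mu>"
proof -
  have "\<mu> u v = (\<Sum>i<r. pairing_weight (\<sigma> i) u v)" if uv: "u \<in> V" "v \<in> V" for u v
  proof -
    have "(\<Sum>v\<in>V. \<Sum>i<r. pairing_weight (\<sigma> i) u v) = (\<Sum>i<r. \<Sum>v\<in>V. pairing_weight (\<sigma> i) u v)"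
      by (rule sum.swap)
    also have "\<dots> = (\<Sum>i<r. 1)"
      using regular_weight.deg[OF pairing_regular_weight[OF fin s] uv(1)] by (intro sum.cong) auto
    also have "\<dots> = (\<Sum>v\<in>V. \<mu> u v)" using deg[OF uv(1)] by simp
    finally show ?thesis
      using sum_mono_inv[of "\<lambda>v. \<Sum>i<r. pairing_weight (\<sigma> i) u v" V "\<mu> u" v] le[OF uv(1)] uv(2) fin by simp
  qed
  then show ?thesis unfolding decomposable_def using s by blast
qed

text \<open>What r - 1 pairings leave is symmetric, loopless and 1-regular, hence a pairing
  itself.\<close>

lemma pairings_decomposable_Suc:
  assumes r: "r = Suc q" and s: "\<And>i. i < q \<Longrightarrow> pairing V (\<sigma> i)"
    and le: "\<And>u v. u \<in> V \<Longrightarrow> v \<in> V \<Longrightarrow> (\<Sum>i<q. pairing_weight (\<sigma> i) u v) \<le> \<mu> u v"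
  shows "decomposable r V \<mu>"
proof -
  define \<nu> where "\<nu> u v = \<mu> u v - (\<Sum>i<q. pairing_weight (\<sigma> i) u v)" for u v
  have eq: "\<mu> u v = \<nu> u v + (\<Sum>i<q. pairing_weight (\<sigma> i) u v)" if "u \<in> V" "v \<in> V" for u v
    using le[OF that] unfolding \<nu>_def by simp
  have row: "(\<Sum>v\<in>V. \<nu> u v) = 1" if u: "u \<in> V" for u
  proof -
    have "(\<Sum>v\<in>V. \<mu> u v) = (\<Sum>v\<in>V. \<nu> u v) + (\<Sum>v\<in>V. \<Sum>i<q. pairing_weight (\<sigma> i) u v)"
      using eq[OF u] by (simp flip: sum.distrib)
    also have "(\<Sum>v\<in>V. \<Sum>i<q. pairing_weight (\<sigma> i) u v) = (\<Sum>i<q. \<Sum>v\<in>V. pairing_weight (\<sigma> i) u v)"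
      by (rule sum.swap)
    also have "\<dots> = (\<Sum>i<q. 1)"
      using regular_weight.deg[OF pairing_regular_weight[OF fin s] u] by (intro sum.cong) auto
    finally show ?thesis using deg[OF u] r by simp
  qed
  have sym': "\<nu> u v = \<nu> v u" if "u \<in> V" "v \<in> V" for u v
  proof -
    have "(\<Sum>i<q. pairing_weight (\<sigma> i) u v) = (\<Sum>i<q. pairing_weight (\<sigma> i) v u :: nat)"
      using s that unfolding pairing_def by (intro sum.cong) (auto simp: of_bool_def)
    then show ?thesis using sym[OF that] unfolding \<nu>_def by simp
  qed
  have ex: "\<exists>v\<in>V. \<nu> u v = 1 \<and> (\<forall>w\<in>V. w \<noteq> v \<longrightarrow> \<nu> u w = 0)" if u: "u \<in> V" for u
    using row[OF u] fin by (metis One_nat_def sum_eq_Suc0_iff)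
  then obtain \<tau> where t: "\<And>u. u \<in> V \<Longrightarrow> \<tau> u \<in> V" "\<And>u. u \<in> V \<Longrightarrow> \<nu> u (\<tau> u) = 1"
    "\<And>u w. u \<in> V \<Longrightarrow> w \<in> V \<Longrightarrow> w \<noteq> \<tau> u \<Longrightarrow> \<nu> u w = 0"
    by metis
  have "pairing V \<tau>"
    unfolding pairing_def
  proof (intro ballI conjI)
    fix u assume u: "u \<in> V"
    show "\<tau> u \<in> V" using t u by blast
    have "\<nu> u u = 0" using zero[OF u] unfolding \<nu>_def by simp
    then show "\<tau> u \<noteq> u" using t(2)[OF u] by auto
    show "\<tau> (\<tau> u) = u" using t sym' u by (metis zero_neq_one)
  qed
  moreover have "\<nu> u v = pairing_weight \<tau> u v" if "u \<in> V" "v \<in> V" for u v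
    using t that by (cases "\<tau> u = v") auto
  ultimately have "\<mu> u v = (\<Sum>i<q. pairing_weight (\<sigma> i) u v) + pairing_weight \<tau> u v" if "u \<in> V" "v \<in> V" for u v
    using eq that by simp
  then show ?thesis
    unfolding r using \<open>pairing V \<tau>\<close> s
    by (intro decomposable_Suc[where \<nu> = "\<lambda>u v. \<Sum>i<q. pairing_weight (\<sigma> i) u v"]) (auto simp: decomposable_def)
qed

end

lemma packing_iff_decomposable:
  assumes "r_graph r G"
  shows "(\<exists>M. packing G r M) \<longleftrightarrow> decomposable r (verts G) (edge_mult G)"
proof -
  have G: "multigraph G" and "r_weight (verts G) (edge_mult G) r" using assms r_graph_iff by blast+
  then interpret r_weight "verts G" "edge_mult G" r by blast
  show ?thesis
  proof
    assume "\<exists>M. packing G r M"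
    then show "decomposable r (verts G) (edge_mult G)" using packing_pairings[OF G] pairings_decomposable by metis
  next
    assume "decomposable r (verts G) (edge_mult G)"
    then obtain \<sigma> where "\<And>i. i < r \<Longrightarrow> pairing (verts G) (\<sigma> i)"
      "\<And>u v. u \<in> verts G \<Longrightarrow> v \<in> verts G \<Longrightarrow> edge_mult G u v = (\<Sum>i<r. pairing_weight (\<sigma> i) u v)"
      unfolding decomposable_def by blast
    then show "\<exists>M. packing G r M" by (intro pairings_packing[OF G]) auto
  qed
qed

text \<open>With r colours every vertex of degree r sees each colour exactly once. Conversely, r
  disjoint perfect matchings exhaust the r edges at a vertex and so cover all edges.\<close>

lemma colouring_iff_packing:
  assumes "r_graph r G"
  shows "(\<exists>c. proper_edge_colouring G c \<and> c ` edges G \<subseteq> {..<r}) \<longleftrightarrow> (\<exists>M. packing G r M)"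
proof -
  have G: "multigraph G" and deg: "\<And>v. v \<in> verts G \<Longrightarrow> card {e \<in> edges G. v \<in> ends G e} = r"
    using assms unfolding r_graph_def regular_def degree_def by auto
  have fE: "finite {e \<in> edges G. v \<in> ends G e}" for v using multigraphD(3)[OF G] by simp
  show ?thesis
  proof
    assume "\<exists>c. proper_edge_colouring G c \<and> c ` edges G \<subseteq> {..<r}"
    then obtain c where c: "proper_edge_colouring G c" "c ` edges G \<subseteq> {..<r}" by blast
    have inj: "inj_on c {e \<in> edges G. v \<in> ends G e}" for v
      using c(1) unfolding proper_edge_colouring_def inj_on_def by blast
    have "perfect_matching G {e \<in> edges G. c e = i}" if i: "i < r" for i
      unfolding perfect_matching_def
    proof (intro conjI ballI)
      fix v assume v: "v \<in> verts G"
      have "c ` {e \<in> edges G. v \<in> ends G e} = {..<r}"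
        using c(2) card_image[OF inj, of v] deg[OF v] by (intro card_subset_eq) auto
      then obtain e where "e \<in> edges G" "v \<in> ends G e" "c e = i" using i by (metis (no_types, lifting) imageE lessThan_iff mem_Collect_eq)
      then show "\<exists>!e. e \<in> {e \<in> edges G. c e = i} \<and> v \<in> ends G e"
        using inj[of v] unfolding inj_on_def by blast
    qed auto
    then have "packing G r (\<lambda>i. {e \<in> edges G. c e = i})" unfolding packing_def by auto
    then show "\<exists>M. packing G r M" by blast
  next
    assume "\<exists>M. packing G r M"
    then obtain M where pm: "\<And>i. i < r \<Longrightarrow> perfect_matching G (M i)"
      and disj: "\<And>i j. i < r \<Longrightarrow> j < r \<Longrightarrow> i \<noteq> j \<Longrightarrow> M i \<inter> M j = {}" unfolding packing_def by blast
    have ME: "M i \<subseteq> edges G" if "i < r" for i using pm[OF that] unfolding perfect_matching_def by blast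
    have cover: "\<exists>i<r. e \<in> M i" if e: "e \<in> edges G" for e
    proof -
      have "ends G e \<noteq> {}" using multigraphD(5)[OF G e] by auto
      then obtain v where v: "v \<in> ends G e" "v \<in> verts G" using multigraphD(4)[OF G e] by blast
      have "\<forall>i<r. \<exists>e. e \<in> M i \<and> v \<in> ends G e" using pm v(2) unfolding perfect_matching_def by blast
      then obtain d where d: "\<And>i. i < r \<Longrightarrow> d i \<in> M i \<and> v \<in> ends G (d i)" by metis
      have "inj_on d {..<r}" using d disj unfolding inj_on_def by (metis disjoint_iff lessThan_iff)
      then have "card (d ` {..<r}) = card {e \<in> edges G. v \<in> ends G e}" using deg[OF v(2)] by (simp add: card_image)
      moreover have "d ` {..<r} \<subseteq> {e \<in> edges G. v \<in> ends G e}" using d ME by blast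
      ultimately have "d ` {..<r} = {e \<in> edges G. v \<in> ends G e}" using fE by (intro card_subset_eq)
      then obtain i where "i < r" "e = d i" using e v(1) by (metis (no_types, lifting) imageE lessThan_iff mem_Collect_eq)
      then show ?thesis using d by blast
    qed
    then obtain c where c: "\<And>e. e \<in> edges G \<Longrightarrow> c e < r \<and> e \<in> M (c e)" by metis
    have "proper_edge_colouring G c"
      unfolding proper_edge_colouring_def
    proof (intro ballI impI notI)
      fix e f assume ef: "e \<in> edges G" "f \<in> edges G" "e \<noteq> f \<and> ends G e \<inter> ends G f \<noteq> {}" "c e = c f"
      then obtain v where v: "v \<in> ends G e" "v \<in> ends G f" "v \<in> verts G" using multigraphD(4)[OF G ef(1)] by blast
      have "e \<in> M (c e)" "f \<in> M (c e)" "c e < r" using c[OF ef(1)] c[OF ef(2)] ef(4) by auto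
      then show False using pm v ef(3) unfolding perfect_matching_def by blast
    qed
    moreover have "c ` edges G \<subseteq> {..<r}" using c by blast
    ultimately show "\<exists>c. proper_edge_colouring G c \<and> c ` edges G \<subseteq> {..<r}" by blast
  qed
qed

lemma class_1_iff_decomposable:
  assumes "r_graph r G"
  shows "class_1 G \<longleftrightarrow> decomposable r (verts G) (edge_mult G)"
proof -
  have G: "multigraph G" and deg: "\<And>v. v \<in> verts G \<Longrightarrow> degree G v = r"
    using assms unfolding r_graph_def regular_def by auto
  have "degree G ` verts G = {r}" using deg multigraphD(2)[OF G] by auto
  then have md: "max_degree G = r" unfolding max_degree_def by simp
  define P where "P k \<longleftrightarrow> (\<exists>c. proper_edge_colouring G c \<and> c ` edges G \<subseteq> {..<k})" for k
  have ge: "r \<le> k" if Pk: "P k" for k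
  proof -
    obtain c where c: "proper_edge_colouring G c" "c ` edges G \<subseteq> {..<k}" using Pk unfolding P_def by blast
    obtain v where v: "v \<in> verts G" using multigraphD(2)[OF G] by blast
    have "inj_on c {e \<in> edges G. v \<in> ends G e}"
      using c(1) unfolding proper_edge_colouring_def inj_on_def by blast
    then have "card {e \<in> edges G. v \<in> ends G e} \<le> card {..<k}" using c(2) by (intro card_inj_on_le) auto
    then show ?thesis using deg[OF v] unfolding degree_def by simp
  qed
  have ex: "\<exists>k. P k"
  proof -
    obtain c :: "'b \<Rightarrow> nat" where "inj_on c (edges G)" using multigraphD(3)[OF G] finite_imp_inj_to_nat_seg by blast
    then have "proper_edge_colouring G c" unfolding proper_edge_colouring_def inj_on_def by blast
    moreover have "c ` edges G \<subseteq> {..<Suc (Max (c ` edges G))}" using multigraphD(3)[OF G] by (auto simp: less_Suc_eq_le)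
    ultimately show ?thesis unfolding P_def by blast
  qed
  have "class_1 G \<longleftrightarrow> (LEAST k. P k) = r"
    unfolding class_1_def md edge_chromatic_number_def P_def by blast
  also have "\<dots> \<longleftrightarrow> P r"
  proof
    assume "(LEAST k. P k) = r"
    then show "P r" using LeastI_ex[OF ex] by simp
  next
    assume "P r"
    then show "(LEAST k. P k) = r" using ge by (intro Least_equality)
  qed
  also have "\<dots> \<longleftrightarrow> decomposable r (verts G) (edge_mult G)"
    unfolding P_def using colouring_iff_packing[OF assms] packing_iff_decomposable[OF assms] by blast
  finally show ?thesis .
qed

lemma class_2_pm_packing_number:
  assumes G: "r_graph r G" and "class_2 G" and "2 \<le> r"
  shows "pm_packing_number G \<le> r - 2"
proof (rule ccontr)
  assume "\<not> ?thesis"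
  then have "r - 1 \<le> pm_packing_number G" by simp
  moreover have mG: "multigraph G" and "r_weight (verts G) (edge_mult G) r" using G r_graph_iff by blast+
  ultimately obtain M where M: "packing G (r - 1) M" using le_pm_packing_number by blast
  interpret r_weight "verts G" "edge_mult G" r by fact
  obtain \<sigma> where "\<And>i. i < r - 1 \<Longrightarrow> pairing (verts G) (\<sigma> i)"
    "\<And>u v. u \<in> verts G \<Longrightarrow> v \<in> verts G \<Longrightarrow> (\<Sum>i<r - 1. pairing_weight (\<sigma> i) u v) \<le> edge_mult G u v"
    using packing_pairings[OF mG M] by blast
  then have "decomposable r (verts G) (edge_mult G)"
    by (intro pairings_decomposable_Suc[of "r - 1" \<sigma>]) (use assms in auto)
  then show False using class_1_iff_decomposable[OF G] assms(2) unfolding class_2_def by blast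
qed

lemma pm_packing_number_class_2:
  assumes G: "r_graph r G" and "pm_packing_number G < r"
  shows "class_2 G"
proof -
  have mG: "multigraph G" using G r_graph_iff by blast
  show ?thesis
    using le_pm_packing_number[OF mG, of r] packing_iff_decomposable[OF G] class_1_iff_decomposable[OF G] assms(2)
    unfolding class_2_def by auto
qed

subsection \<open>The Petersen graph with added matchings\<close>

lemma petersen_simps:
  "verts petersen = pairs5"
  "edges petersen = {{A, B} | A B. A \<in> pairs5 \<and> B \<in> pairs5 \<and> A \<inter> B = {}}"
  "ends petersen e = e"
  by (auto simp: petersen_def pairs5_def)

lemma petersen_edge_iff:
  assumes "A \<in> pairs5" "B \<in> pairs5"
  shows "{A, B} \<in> edges petersen \<longleftrightarrow> A \<inter> B = {}"
  using assms unfolding petersen_simps by (auto simp: doubleton_eq_iff)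

lemma multigraph_petersen: "multigraph petersen"
proof -
  have "edges petersen \<subseteq> Pow pairs5" unfolding petersen_simps by auto
  then have "finite (edges petersen)" using card_pairs5(2) finite_subset by blast
  moreover have "e \<subseteq> pairs5 \<and> card e = 2" if e: "e \<in> edges petersen" for e
  proof -
    obtain A B where "A \<in> pairs5" "B \<in> pairs5" "A \<inter> B = {}" "e = {A, B}" using e unfolding petersen_simps by blast
    moreover from this have "A \<noteq> B" unfolding pairs5_def by auto
    ultimately show ?thesis by simp
  qed
  moreover have "pairs5 \<noteq> {}" using card_pairs5 by auto
  ultimately show ?thesis unfolding multigraph_def petersen_simps using card_pairs5 by blast
qed

lemma edge_mult_petersen:
  assumes "A \<in> pairs5" "B \<in> pairs5"
  shows "edge_mult petersen A B = of_bool (A \<inter> B = {})"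
proof -
  have "{e \<in> edges petersen. e = {A, B}} = (if A \<inter> B = {} then {{A, B}} else {})"
    using petersen_edge_iff[OF assms] by auto
  then show ?thesis unfolding edge_mult_def petersen_simps(3) by simp
qed

lemma multigraph_add_matchings:
  assumes G: "multigraph G" and "\<And>M. M \<in># \<M> \<Longrightarrow> M \<subseteq> edges G"
  shows "multigraph (add_matchings G \<M>)"
proof -
  note m = multigraphD[OF G]
  have "{Inr (M, i, e) | M i e. M \<in># \<M> \<and> i < count \<M> M \<and> e \<in> M}
      \<subseteq> Inr ` (SIGMA M:set_mset \<M>. {..<count \<M> M} \<times> edges G)"
    using assms(2) by auto
  moreover have "finite (Inr ` (SIGMA M:set_mset \<M>. {..<count \<M> M} \<times> edges G))"
    using m(3) by auto
  ultimately have "finite {Inr (M, i, e) | M i e. M \<in># \<M> \<and> i < count \<M> M \<and> e \<in> M}"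
    by (rule finite_subset)
  then have "finite (edges (add_matchings G \<M>))" using m(3) by (simp add: add_matchings_def)
  moreover have "ends (add_matchings G \<M>) x \<subseteq> verts G \<and> card (ends (add_matchings G \<M>) x) = 2"
    if x: "x \<in> edges (add_matchings G \<M>)" for x
  proof -
    from x consider e where "e \<in> edges G" "x = Inl e" | M i e where "M \<in># \<M>" "e \<in> M" "x = Inr (M, i, e)"
      unfolding add_matchings_def by auto
    then show ?thesis
    proof cases
      case 1 then show ?thesis using m by (simp add: add_matchings_def)
    next
      case 2
      then have "e \<in> edges G" using assms(2) by blast
      then show ?thesis using m(4,5) 2 by (simp add: add_matchings_def)
    qed
  qed
  ultimately show ?thesis
    using m(1,2) unfolding multigraph_def by (simp add: add_matchings_def)
qed

text \<open>The multiset is represented by a list, so that summing over copies of each matching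
  becomes summing over positions.\<close>

lemma edge_mult_add_matchings:
  fixes G :: "('v, 'e) mgraph"
  assumes G: "multigraph G" and sub: "\<And>M. M \<in> set xs \<Longrightarrow> M \<subseteq> edges G"
  shows "edge_mult (add_matchings G (mset xs)) u v =
    edge_mult G u v + (\<Sum>i<length xs. card {e \<in> xs ! i. ends G e = {u, v}})"
proof -
  define c where "c M = card {e \<in> M. ends G e = {u, v}}" for M
  define S where "S = (SIGMA M:set xs. {..<count_list xs M} \<times> {e \<in> M. ends G e = {u, v}})"
  have fin: "finite {e \<in> M. ends G e = {u, v}}" if "M \<in> set xs" for M
    using sub[OF that] multigraphD(3)[OF G] finite_subset by fastforce
  have fS: "finite S" unfolding S_def using fin by (intro finite_SigmaI) auto
  have "{e \<in> edges (add_matchings G (mset xs)). ends (add_matchings G (mset xs)) e = {u, v}} =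
      Inl ` {e \<in> edges G. ends G e = {u, v}} \<union> Inr ` S"
  proof (rule set_eqI)
    fix x
    show "x \<in> {e \<in> edges (add_matchings G (mset xs)). ends (add_matchings G (mset xs)) e = {u, v}} \<longleftrightarrow>
      x \<in> Inl ` {e \<in> edges G. ends G e = {u, v}} \<union> Inr ` S"
    proof (cases x)
      case (Inl e) then show ?thesis by (auto simp: add_matchings_def)
    next
      case (Inr p)
      obtain M i e where "p = (M, i, e)" by (cases p)
      then show ?thesis using Inr by (auto simp: add_matchings_def S_def count_mset)
    qed
  qed
  then have "edge_mult (add_matchings G (mset xs)) u v =
      card (Inl ` {e \<in> edges G. ends G e = {u, v}} \<union> Inr ` S :: ('e + 'e set \<times> nat \<times> 'e) set)"
    unfolding edge_mult_def by (simp only:)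
  also have "\<dots> = card (Inl ` {e \<in> edges G. ends G e = {u, v}} :: ('e + 'e set \<times> nat \<times> 'e) set) +
      card (Inr ` S :: ('e + 'e set \<times> nat \<times> 'e) set)"
    using multigraphD(3)[OF G] fS by (intro card_Un_disjoint) auto
  also have "\<dots> = edge_mult G u v + card S"
    by (simp add: card_image edge_mult_def)
  also have "card S = (\<Sum>M\<in>set xs. count_list xs M * c M)"
    unfolding S_def using fin by (subst card_SigmaI) (auto simp: card_cartesian_product c_def)
  also have "\<dots> = sum_list (map c xs)" by (rule sum_list_map_eq_sum_count[symmetric])
  also have "\<dots> = (\<Sum>i<length xs. c (xs ! i))" by (simp add: sum_list_sum_nth atLeast0LessThan)
  finally show ?thesis unfolding c_def .
qed

section \<open>Isomorphism in terms of multiplicities\<close>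

lemma isomorphic_edge_mult:
  assumes G: "multigraph G" and H: "multigraph H" and iso: "isomorphic G H"
  shows "\<exists>f. bij_betw f (verts G) (verts H) \<and>
    (\<forall>u\<in>verts G. \<forall>v\<in>verts G. edge_mult G u v = edge_mult H (f u) (f v))"
proof -
  obtain f g where f: "bij_betw f (verts G) (verts H)" and g: "bij_betw g (edges G) (edges H)"
    and fg: "\<And>e. e \<in> edges G \<Longrightarrow> ends H (g e) = f ` ends G e"
    using iso unfolding isomorphic_def by blast
  have "edge_mult G u v = edge_mult H (f u) (f v)" if uv: "u \<in> verts G" "v \<in> verts G" for u v
  proof -
    have inj: "inj_on f (verts G)" using f unfolding bij_betw_def by blast
    have "ends H (g e) = {f u, f v} \<longleftrightarrow> ends G e = {u, v}" if e: "e \<in> edges G" for e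
    proof -
      have "f ` ends G e = f ` {u, v} \<longleftrightarrow> ends G e = {u, v}"
        using multigraphD(4)[OF G e] uv by (intro inj_on_image_eq_iff[OF inj]) auto
      then show ?thesis using fg[OF e] by simp
    qed
    then have "{e \<in> edges G. ends G e = {u, v}} = {e \<in> edges G. g e \<in> {e \<in> edges H. ends H e = {f u, f v}}}"
      using g unfolding bij_betw_def by auto
    then show ?thesis
      unfolding edge_mult_def using card_bij_betw_vimage[OF g, of "{e \<in> edges H. ends H e = {f u, f v}}"] by simp
  qed
  then show ?thesis using f by blast
qed

text \<open>Grouping the edges of \<open>G\<close> by the image of their ends and those of
  \<open>H\<close> by their ends gives classes of equal size, from which the bijection on edges is
  assembled.\<close>

lemma isomorphicI_edge_mult:
  assumes G: "multigraph G" and H: "multigraph H" and f: "bij_betw f (verts G) (verts H)"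
    and eq: "\<And>u v. u \<in> verts G \<Longrightarrow> v \<in> verts G \<Longrightarrow> edge_mult G u v = edge_mult H (f u) (f v)"
  shows "isomorphic G H"
proof -
  have inj: "inj_on f (verts G)" and im: "f ` verts G = verts H" using f unfolding bij_betw_def by auto
  have "card {e \<in> edges G. f ` ends G e = a} = card {e \<in> edges H. ends H e = a}" for a
  proof (cases "\<exists>u\<in>verts G. \<exists>v\<in>verts G. a = {f u, f v}")
    case True
    then obtain u v where uv: "u \<in> verts G" "v \<in> verts G" "a = f ` {u, v}" by auto
    have "f ` ends G e = f ` {u, v} \<longleftrightarrow> ends G e = {u, v}" if e: "e \<in> edges G" for e
      using multigraphD(4)[OF G e] uv by (intro inj_on_image_eq_iff[OF inj]) auto
    then have "{e \<in> edges G. f ` ends G e = a} = {e \<in> edges G. ends G e = {u, v}}" using uv(3) by blast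
    then show ?thesis using eq[OF uv(1,2)] uv(3) unfolding edge_mult_def by simp
  next
    case False
    have "f ` ends G e \<noteq> a" if e: "e \<in> edges G" for e
    proof
      assume a: "f ` ends G e = a"
      obtain u v where "ends G e = {u, v}" using multigraphD(5)[OF G e] by (auto simp: card_2_iff)
      then show False using False a multigraphD(4)[OF G e] by auto
    qed
    moreover have "ends H e \<noteq> a" if e: "e \<in> edges H" for e
    proof
      assume a: "ends H e = a"
      obtain x y where xy: "ends H e = {x, y}" using multigraphD(5)[OF H e] by (auto simp: card_2_iff)
      then have "x \<in> f ` verts G" "y \<in> f ` verts G" using multigraphD(4)[OF H e] im by auto
      then show False using False a xy by auto
    qed
    ultimately have "{e \<in> edges G. f ` ends G e = a} = {}" "{e \<in> edges H. ends H e = a} = {}" by auto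
    then show ?thesis by (simp only: card.empty)
  qed
  then obtain g where "bij_betw g (edges G) (edges H)" "\<forall>e\<in>edges G. ends H (g e) = f ` ends G e"
    using bij_betw_fibres[of "edges G" "edges H" "\<lambda>e. f ` ends G e" "ends H"]
      multigraphD(3)[OF G] multigraphD(3)[OF H] by blast
  then show ?thesis unfolding isomorphic_def using f by blast
qed

lemma petersen_plus_reindex:
  assumes h: "bij_betw h W V" and p: "petersen_plus m V \<mu>"
    and eq: "\<And>u v. u \<in> W \<Longrightarrow> v \<in> W \<Longrightarrow> \<nu> u v = \<mu> (h u) (h v)"
  shows "petersen_plus m W \<nu>"
proof -
  obtain f \<tau> where f: "bij_betw f V pairs5"
    and t: "\<And>i. i < m \<Longrightarrow> pairing V (\<tau> i)" "\<And>i v. i < m \<Longrightarrow> v \<in> V \<Longrightarrow> f v \<inter> f (\<tau> i v) = {}"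
    and mu: "\<And>u v. u \<in> V \<Longrightarrow> v \<in> V \<Longrightarrow> \<mu> u v = kneser f u v + (\<Sum>i<m. pairing_weight (\<tau> i) u v)"
    using p unfolding petersen_plus_def by blast
  define g where "g k = (\<lambda>i. inv_into W h (\<tau> k (h i)))" for k
  have hV: "h i \<in> V" if "i \<in> W" for i using h that unfolding bij_betw_def by auto
  have g: "pairing W (g k)" if "k < m" for k
    unfolding g_def by (rule pairing_reindex[OF h t(1)[OF that]])
  have hg: "h (g k i) = \<tau> k (h i)" if "k < m" "i \<in> W" for k i
  proof -
    have "\<tau> k (h i) \<in> h ` W" using t(1)[OF that(1)] hV[OF that(2)] h unfolding pairing_def bij_betw_def by auto
    then show ?thesis unfolding g_def by (rule f_inv_into_f)
  qed
  have "bij_betw (f \<circ> h) W pairs5" using bij_betw_trans[OF h f] .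
  moreover have "\<forall>k<m. pairing W (g k) \<and> (\<forall>i\<in>W. (f \<circ> h) i \<inter> (f \<circ> h) (g k i) = {})"
    using g t(2) hV by (simp add: hg)
  moreover have "\<nu> i j = kneser (f \<circ> h) i j + (\<Sum>k<m. pairing_weight (g k) i j)" if ij: "i \<in> W" "j \<in> W" for i j
  proof -
    have "(\<Sum>k<m. pairing_weight (\<tau> k) (h i) (h j)) = (\<Sum>k<m. pairing_weight (g k) i j)"
      using pairing_weight_reindex[OF h t(1) ij] unfolding g_def by (intro sum.cong) auto
    then show ?thesis using eq[OF ij] mu[OF hV hV, OF ij] by (simp add: kneser_def)
  qed
  ultimately show ?thesis unfolding petersen_plus_def by blast
qed

lemma petersen_plus_add_matchings:
  assumes pm: "\<And>M. M \<in># \<M> \<Longrightarrow> perfect_matching petersen M"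
  shows "petersen_plus (size \<M>) pairs5 (edge_mult (add_matchings petersen \<M>))"
proof -
  obtain xs where xs: "\<M> = mset xs" using ex_mset by metis
  have pmx: "perfect_matching petersen M" if "M \<in> set xs" for M using pm that unfolding xs by simp
  have sub: "M \<subseteq> edges petersen" if "M \<in> set xs" for M using pmx[OF that] unfolding perfect_matching_def by blast
  define Q where "Q i \<tau> \<longleftrightarrow> pairing pairs5 \<tau> \<and>
      (\<forall>u\<in>pairs5. \<forall>v\<in>pairs5. pairing_weight \<tau> u v = card {e \<in> xs ! i. ends petersen e = {u, v}})" for i \<tau>
  have "\<exists>\<tau>. Q i \<tau>" if "i < length xs" for i
    using perfect_matching_pairing[OF multigraph_petersen pmx[OF nth_mem[OF that]]]
    unfolding petersen_simps(1) Q_def .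
  then obtain \<tau> where Q: "\<And>i. i < length xs \<Longrightarrow> Q i (\<tau> i)" by metis
  then have t: "\<And>i. i < length xs \<Longrightarrow> pairing pairs5 (\<tau> i)"
    and c: "\<And>i u v. i < length xs \<Longrightarrow> u \<in> pairs5 \<Longrightarrow> v \<in> pairs5 \<Longrightarrow>
      pairing_weight (\<tau> i) u v = card {e \<in> xs ! i. ends petersen e = {u, v}}"
    unfolding Q_def by blast+
  have "A \<inter> \<tau> i A = {}" if iA: "i < length xs" "A \<in> pairs5" for i A
  proof -
    have tA: "\<tau> i A \<in> pairs5" using t[OF iA(1)] iA(2) unfolding pairing_def by blast
    have "card {e \<in> xs ! i. ends petersen e = {A, \<tau> i A}} = 1" using c[OF iA tA] by simp
    then have "{e \<in> xs ! i. ends petersen e = {A, \<tau> i A}} \<noteq> {}" by (metis card.empty zero_neq_one)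
    then have "{A, \<tau> i A} \<in> edges petersen" using sub[of "xs ! i"] iA(1) unfolding petersen_simps(3) by auto
    then show ?thesis using petersen_edge_iff[OF iA(2) tA] by simp
  qed
  moreover have "edge_mult (add_matchings petersen \<M>) u v = kneser id u v + (\<Sum>i<length xs. pairing_weight (\<tau> i) u v)"
    if uv: "u \<in> pairs5" "v \<in> pairs5" for u v
  proof -
    have "(\<Sum>i<length xs. card {e \<in> xs ! i. ends petersen e = {u, v}}) = (\<Sum>i<length xs. pairing_weight (\<tau> i) u v)"
      using c uv by (intro sum.cong) auto
    moreover have "edge_mult (add_matchings petersen \<M>) u v =
        edge_mult petersen u v + (\<Sum>i<length xs. card {e \<in> xs ! i. ends petersen e = {u, v}})"
      unfolding xs by (rule edge_mult_add_matchings[OF multigraph_petersen]) (rule sub)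
    ultimately show ?thesis
      unfolding edge_mult_petersen[OF uv] kneser_def id_apply by (simp only:)
  qed
  ultimately have "petersen_plus (length xs) pairs5 (edge_mult (add_matchings petersen \<M>))"
    unfolding petersen_plus_def using t by (intro exI[of _ id] exI[of _ \<tau>]) simp
  then show ?thesis unfolding xs by simp
qed

lemma pairing_perfect_matching:
  assumes f: "bij_betw f V pairs5" and t: "pairing V \<tau>" and adj: "\<And>v. v \<in> V \<Longrightarrow> f v \<inter> f (\<tau> v) = {}"
  defines "M \<equiv> {{f v, f (\<tau> v)} |v. v \<in> V}"
  shows "perfect_matching petersen M"
    and "\<And>u v. u \<in> V \<Longrightarrow> v \<in> V \<Longrightarrow> card {e \<in> M. ends petersen e = {f u, f v}} = pairing_weight \<tau> u v"
proof -
  have tp: "\<tau> v \<in> V" "\<tau> (\<tau> v) = v" if "v \<in> V" for v using t that unfolding pairing_def by blast+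
  have fV: "f v \<in> pairs5" if "v \<in> V" for v using f that unfolding bij_betw_def by auto
  have inj: "f u = f v \<longleftrightarrow> u = v" if "u \<in> V" "v \<in> V" for u v
    using f that unfolding bij_betw_def inj_on_def by blast
  show "perfect_matching petersen M"
    unfolding perfect_matching_def petersen_simps(1,3)
  proof (intro conjI ballI)
    show "M \<subseteq> edges petersen" unfolding M_def using petersen_edge_iff adj fV tp by auto
    fix A assume "A \<in> pairs5"
    then obtain v where v: "v \<in> V" "A = f v" using f unfolding bij_betw_def by blast
    show "\<exists>!e. e \<in> M \<and> A \<in> e"
    proof (intro ex1I conjI)
      show "{f v, f (\<tau> v)} \<in> M" unfolding M_def using v by blast
      show "A \<in> {f v, f (\<tau> v)}" using v by simp
      fix e assume "e \<in> M \<and> A \<in> e"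
      then obtain w where w: "w \<in> V" "e = {f w, f (\<tau> w)}" "A \<in> {f w, f (\<tau> w)}" unfolding M_def by auto
      then have "v = w \<or> v = \<tau> w" using v inj tp by auto
      then show "e = {f v, f (\<tau> v)}" using w tp by (auto simp: insert_commute)
    qed
  qed
  show "card {e \<in> M. ends petersen e = {f u, f v}} = pairing_weight \<tau> u v" if uv: "u \<in> V" "v \<in> V" for u v
  proof -
    have "{f u, f v} \<in> M \<longleftrightarrow> \<tau> u = v"
    proof
      assume "{f u, f v} \<in> M"
      then obtain w where w: "w \<in> V" "{f u, f v} = {f w, f (\<tau> w)}" unfolding M_def by blast
      then have "u = w \<and> v = \<tau> w \<or> u = \<tau> w \<and> v = w" using uv inj tp by (auto simp: doubleton_eq_iff)
      then show "\<tau> u = v" using w tp by auto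
    next
      assume "\<tau> u = v"
      then show "{f u, f v} \<in> M" unfolding M_def using uv by blast
    qed
    then have "{e \<in> M. ends petersen e = {f u, f v}} = (if \<tau> u = v then {{f u, f v}} else {})"
      unfolding petersen_simps(3) by auto
    then show ?thesis by simp
  qed
qed

lemma petersen_plus_isomorphic:
  assumes G: "multigraph G" and p: "petersen_plus m (verts G) (edge_mult G)"
  shows "\<exists>\<M>. size \<M> = m \<and> (\<forall>M \<in># \<M>. perfect_matching petersen M) \<and> isomorphic G (add_matchings petersen \<M>)"
proof -
  obtain f \<tau> where f: "bij_betw f (verts G) pairs5"
    and t: "\<And>i. i < m \<Longrightarrow> pairing (verts G) (\<tau> i)" "\<And>i v. i < m \<Longrightarrow> v \<in> verts G \<Longrightarrow> f v \<inter> f (\<tau> i v) = {}"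
    and mu: "\<And>u v. u \<in> verts G \<Longrightarrow> v \<in> verts G \<Longrightarrow>
      edge_mult G u v = kneser f u v + (\<Sum>i<m. pairing_weight (\<tau> i) u v)"
    using p unfolding petersen_plus_def by blast
  define M where "M i = {{f v, f (\<tau> i v)} |v. v \<in> verts G}" for i
  have Mp: "perfect_matching petersen (M i)" if "i < m" for i
    unfolding M_def by (rule pairing_perfect_matching(1)[OF f t(1)[OF that]]) (rule t(2)[OF that])
  have Mc: "card {e \<in> M i. ends petersen e = {f u, f v}} = pairing_weight (\<tau> i) u v"
    if "i < m" "u \<in> verts G" "v \<in> verts G" for i u v
    unfolding M_def by (rule pairing_perfect_matching(2)[OF f t(1)[OF that(1)] _ that(2,3)]) (rule t(2)[OF that(1)])
  define xs where "xs = map M [0..<m]"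
  have len: "length xs = m" "\<And>i. i < m \<Longrightarrow> xs ! i = M i" unfolding xs_def by simp_all
  have pm: "perfect_matching petersen N" if "N \<in> set xs" for N using that Mp unfolding xs_def by auto
  have sub: "N \<subseteq> edges petersen" if "N \<in> set xs" for N using pm[OF that] unfolding perfect_matching_def by blast
  have H: "multigraph (add_matchings petersen (mset xs))"
    by (rule multigraph_add_matchings[OF multigraph_petersen]) (use sub in simp)
  have "isomorphic G (add_matchings petersen (mset xs))"
  proof (rule isomorphicI_edge_mult[OF G H])
    show "bij_betw f (verts G) (verts (add_matchings petersen (mset xs)))"
      using f unfolding add_matchings_def petersen_simps by simp
    show "edge_mult G u v = edge_mult (add_matchings petersen (mset xs)) (f u) (f v)"
      if uv: "u \<in> verts G" "v \<in> verts G" for u v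
    proof -
      have fp: "f u \<in> pairs5" "f v \<in> pairs5" using f uv unfolding bij_betw_def by auto
      have "(\<Sum>i<length xs. card {e \<in> xs ! i. ends petersen e = {f u, f v}}) = (\<Sum>i<m. pairing_weight (\<tau> i) u v)"
        unfolding len(1) using Mc uv by (intro sum.cong) (simp_all add: len(2))
      moreover have "edge_mult (add_matchings petersen (mset xs)) (f u) (f v) =
          edge_mult petersen (f u) (f v) + (\<Sum>i<length xs. card {e \<in> xs ! i. ends petersen e = {f u, f v}})"
        by (rule edge_mult_add_matchings[OF multigraph_petersen]) (rule sub)
      ultimately show ?thesis
        unfolding edge_mult_petersen[OF fp] mu[OF uv] kneser_def by (simp only:)
    qed
  qed
  then show ?thesis using len(1) pm by (intro exI[of _ "mset xs"]) auto
qed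

lemma isomorphic_petersen_plus:
  assumes G: "multigraph G" and pm: "\<And>M. M \<in># \<M> \<Longrightarrow> perfect_matching petersen M"
    and iso: "isomorphic G (add_matchings petersen \<M>)"
  shows "petersen_plus (size \<M>) (verts G) (edge_mult G)"
proof -
  have H: "multigraph (add_matchings petersen \<M>)"
    by (rule multigraph_add_matchings[OF multigraph_petersen]) (use pm in \<open>auto simp: perfect_matching_def\<close>)
  obtain f where f: "bij_betw f (verts G) (verts (add_matchings petersen \<M>))"
    and eq: "\<And>u v. u \<in> verts G \<Longrightarrow> v \<in> verts G \<Longrightarrow> edge_mult G u v = edge_mult (add_matchings petersen \<M>) (f u) (f v)"
    using isomorphic_edge_mult[OF G H iso] by blast
  have "verts (add_matchings petersen \<M>) = pairs5" by (simp add: add_matchings_def petersen_simps)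
  then have f': "bij_betw f (verts G) pairs5" and eq': "\<And>u v. u \<in> verts G \<Longrightarrow> v \<in> verts G \<Longrightarrow>
      edge_mult G u v = edge_mult (add_matchings petersen \<M>) (f u) (f v)"
    using f eq by auto
  show ?thesis
    by (rule petersen_plus_reindex[OF f' petersen_plus_add_matchings eq']) (use pm in auto)
qed

text \<open>Needed to see that order ten is attained among graphs on natural numbers; m copies of
  one perfect matching of the Petersen graph suffice.\<close>

lemma ex_petersen_plus:
  "\<exists>G :: (nat, nat) mgraph. multigraph G \<and> petersen_plus m (verts G) (edge_mult G)"
proof -
  have d: "distinct [0, 1, 2, 3, 4 :: nat]" by simp
  have U: "{..<5} = {0, 1, 2, 3, 4 :: nat}" by auto
  obtain s where s: "pairing {..<10} s" "\<And>i. i < 10 \<Longrightarrow> hex i (s i)"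
    using r_weight.ex_supported_pairing[OF hex_r_weight] by (auto split: if_splits)
  have "\<exists>M. perfect_matching petersen M"
  proof (rule exI, rule pairing_perfect_matching(1))
    show "bij_betw (hex_label 0 1 2 3 4) {..<10} pairs5" by (rule hex_label_bij[OF d U])
    show "pairing {..<10} s" by (rule s(1))
    show "hex_label 0 1 2 3 4 v \<inter> hex_label 0 1 2 3 4 (s v) = {}" if "v \<in> {..<10}" for v
      using hex_label_adjacent[OF d] s that unfolding pairing_def by auto
  qed
  then obtain M where M: "perfect_matching petersen M" by blast
  define \<M> where "\<M> = replicate_mset m M"
  have pm: "perfect_matching petersen N" if "N \<in># \<M>" for N using that M unfolding \<M>_def by (auto split: if_splits)
  let ?H = "add_matchings petersen \<M>"
  have H: "multigraph ?H"
    by (rule multigraph_add_matchings[OF multigraph_petersen]) (use pm in \<open>auto simp: perfect_matching_def\<close>)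
  obtain G :: "(nat, nat) mgraph" where G: "multigraph G" "isomorphic ?H G"
    using multigraph_isomorphic_nat[OF H] by blast
  obtain f where f: "bij_betw f (verts ?H) (verts G)"
    and eq: "\<And>u v. u \<in> verts ?H \<Longrightarrow> v \<in> verts ?H \<Longrightarrow> edge_mult ?H u v = edge_mult G (f u) (f v)"
    using isomorphic_edge_mult[OF H G] by blast
  have VH: "verts ?H = pairs5" by (simp add: add_matchings_def petersen_simps)
  have "petersen_plus m (verts G) (edge_mult G)"
  proof (rule petersen_plus_reindex[OF bij_betw_inv_into[OF f]])
    show "petersen_plus m (verts ?H) (edge_mult ?H)"
    proof -
      have "petersen_plus (size \<M>) pairs5 (edge_mult ?H)" by (rule petersen_plus_add_matchings) (rule pm)
      moreover have "size \<M> = m" by (simp add: \<M>_def)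
      ultimately show ?thesis unfolding VH by simp
    qed
    show "edge_mult G u v = edge_mult ?H (inv_into (verts ?H) f u) (inv_into (verts ?H) f v)"
      if "u \<in> verts G" "v \<in> verts G" for u v
    proof -
      have "inv_into (verts ?H) f w \<in> verts ?H" "f (inv_into (verts ?H) f w) = w" if "w \<in> verts G" for w
        using f that unfolding bij_betw_def by (auto intro: inv_into_into f_inv_into_f)
      then show ?thesis using eq that by metis
    qed
  qed
  then show ?thesis using G by blast
qed

section \<open>Minimum order\<close>

lemma class_2_order_ge_10:
  assumes G: "r_graph r G" and c2: "class_2 G"
  shows "10 \<le> order G"
proof (rule ccontr)
  assume "\<not> ?thesis"
  then have "card (verts G) < 10" unfolding order_def by simp
  have rw: "r_weight (verts G) (edge_mult G) r" using G r_graph_iff by blast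
  interpret r_weight "verts G" "edge_mult G" r by (rule rw)
  have nd: "\<not> decomposable r (verts G) (edge_mult G)"
    using class_1_iff_decomposable[OF G] c2 unfolding class_2_def by blast
  then have "r > 0" using decomposable_0[of "verts G" "edge_mult G"] regular_weight_axioms by (cases r) auto
  then have "card (verts G) \<noteq> 9" using even_card by auto
  then have "card (verts G) \<le> 8" using \<open>card (verts G) < 10\<close> by linarith
  then show False using r_weight_decomposable_card_le_8[OF rw] nd by blast
qed

lemma class_2_order_10_iff:
  assumes "3 \<le> r"
  shows "r_graph r G \<and> class_2 G \<and> order G = 10 \<longleftrightarrow>
    multigraph G \<and> petersen_plus (r - 3) (verts G) (edge_mult G)"
proof
  assume G: "r_graph r G \<and> class_2 G \<and> order G = 10"
  then have "r_weight (verts G) (edge_mult G) r" "multigraph G" using r_graph_iff by blast+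
  moreover have "\<not> decomposable r (verts G) (edge_mult G)"
    using G class_1_iff_decomposable[of r G] unfolding class_2_def by blast
  ultimately show "multigraph G \<and> petersen_plus (r - 3) (verts G) (edge_mult G)"
    using nondecomposable_petersen_plus G unfolding order_def by blast
next
  assume G: "multigraph G \<and> petersen_plus (r - 3) (verts G) (edge_mult G)"
  then have p: "r_weight (verts G) (edge_mult G) r" "card (verts G) = 10"
    "\<not> decomposable r (verts G) (edge_mult G)"
    using petersen_plus_nondecomposable[of "r - 3" "verts G" "edge_mult G"] assms by auto
  then have "r_graph r G" using G r_graph_iff by blast
  then show "r_graph r G \<and> class_2 G \<and> order G = 10"
    using p class_1_iff_decomposable unfolding class_2_def order_def by blast
qed

text \<open>The upper bound holds for every r-graph of class 2. For the lower bound, the r - 3 added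
  matchings are joined by one perfect matching of the underlying Petersen graph.\<close>

lemma petersen_plus_packing_number:
  assumes r: "3 \<le> r" and G: "multigraph G" and p: "petersen_plus (r - 3) (verts G) (edge_mult G)"
  shows "pm_packing_number G = r - 2"
proof (rule antisym)
  have c2: "r_graph r G" "class_2 G" using class_2_order_10_iff[OF r, of G] G p by blast+
  show "pm_packing_number G \<le> r - 2" by (rule class_2_pm_packing_number[OF c2]) (use r in simp)
  obtain f \<tau> where f: "bij_betw f (verts G) pairs5"
    and t: "\<And>i. i < r - 3 \<Longrightarrow> pairing (verts G) (\<tau> i)"
    and mu: "\<And>u v. u \<in> verts G \<Longrightarrow> v \<in> verts G \<Longrightarrow>
      edge_mult G u v = kneser f u v + (\<Sum>i<r - 3. pairing_weight (\<tau> i) u v)"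
    using p unfolding petersen_plus_def by blast
  have "petersen_plus 0 (verts G) (kneser f)" unfolding petersen_plus_def using f by auto
  then interpret P: r_weight "verts G" "kneser f" 3 using petersen_plus_nondecomposable(1) by fastforce
  obtain \<sigma> where s: "pairing (verts G) \<sigma>" "\<And>v. v \<in> verts G \<Longrightarrow> 0 < kneser f v (\<sigma> v)"
    using P.ex_supported_pairing by auto
  define \<tau>' where "\<tau>' = \<tau>(r - 3 := \<sigma>)"
  have q: "r - 2 = Suc (r - 3)" using r by simp
  have "\<exists>M. packing G (r - 2) M"
  proof (rule pairings_packing[OF G])
    show "pairing (verts G) (\<tau>' i)" if "i < r - 2" for i
      using that t s(1) unfolding \<tau>'_def q by (auto simp: less_Suc_eq)
    show "(\<Sum>i<r - 2. pairing_weight (\<tau>' i) u v) \<le> edge_mult G u v" if uv: "u \<in> verts G" "v \<in> verts G" for u v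
    proof -
      have "pairing_weight \<sigma> u v \<le> kneser f u v" using s(2)[OF uv(1)] by (cases "\<sigma> u = v") auto
      then show ?thesis unfolding mu[OF uv] q \<tau>'_def by simp
    qed
  qed
  then show "r - 2 \<le> pm_packing_number G" using le_pm_packing_number[OF G] by blast
qed

theorem theorem2p2:
  fixes r :: nat
  assumes "r \<ge> 3"
  shows "smallest_class_2 r = smallest_packing r (r - 2) \<and>
    smallest_packing r (r - 2) =
      {G. multigraph G \<and>
          (\<exists>\<M>. size \<M> = r - 3 \<and> (\<forall>M \<in># \<M>. perfect_matching petersen M) \<and>
               isomorphic G (add_matchings petersen \<M>))}"
proof -
  define S :: "(nat, nat) mgraph set" where
    "S = {G. multigraph G \<and> petersen_plus (r - 3) (verts G) (edge_mult G)}"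
  have S: "G \<in> S \<longleftrightarrow> r_graph r G \<and> class_2 G \<and> order G = 10" for G
    using class_2_order_10_iff[OF assms, of G] unfolding S_def by blast
  obtain G0 where G0: "G0 \<in> S" using ex_petersen_plus[of "r - 3"] unfolding S_def by blast
  have pS: "pm_packing_number G = r - 2" if "G \<in> S" for G
    using petersen_plus_packing_number[OF assms] that unfolding S_def by blast
  \<comment> \<open>A packing number below r already forces class 2, so the lower bound ten applies
    to both notions of minimality.\<close>
  have p2: "class_2 G" if "r_graph r G" "pm_packing_number G = r - 2" for G :: "(nat, nat) mgraph"
    using pm_packing_number_class_2[OF that(1)] that(2) assms by simp
  have "smallest_class_2 r = S"
  proof (intro equalityI subsetI)
    fix G assume "G \<in> smallest_class_2 r"
    then have "r_graph r G" "class_2 G" "order G \<le> order G0" using G0 unfolding smallest_class_2_def S by auto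
    then show "G \<in> S" using class_2_order_ge_10[of r G] G0 unfolding S by simp
  next
    fix G assume "G \<in> S"
    then show "G \<in> smallest_class_2 r" using class_2_order_ge_10 unfolding smallest_class_2_def S by auto
  qed
  moreover have "smallest_packing r (r - 2) = S"
  proof (intro equalityI subsetI)
    fix G assume "G \<in> smallest_packing r (r - 2)"
    then have "r_graph r G" "class_2 G" "order G \<le> order G0"
      using G0 pS[OF G0] p2 unfolding smallest_packing_def S by auto
    then show "G \<in> S" using class_2_order_ge_10[of r G] G0 unfolding S by simp
  next
    fix G assume G: "G \<in> S"
    then show "G \<in> smallest_packing r (r - 2)"
      using class_2_order_ge_10 pS[OF G] p2 unfolding smallest_packing_def S by auto
  qed
  moreover have "S = {G. multigraph G \<and>
          (\<exists>\<M>. size \<M> = r - 3 \<and> (\<forall>M \<in># \<M>. perfect_matching petersen M) \<and>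
               isomorphic G (add_matchings petersen \<M>))}"
  proof (intro equalityI subsetI)
    fix G assume "G \<in> S"
    then show "G \<in> {G. multigraph G \<and>
          (\<exists>\<M>. size \<M> = r - 3 \<and> (\<forall>M \<in># \<M>. perfect_matching petersen M) \<and>
               isomorphic G (add_matchings petersen \<M>))}"
      using petersen_plus_isomorphic[of G "r - 3"] unfolding S_def by simp
  next
    fix G :: "(nat, nat) mgraph"
    assume "G \<in> {G. multigraph G \<and>
          (\<exists>\<M>. size \<M> = r - 3 \<and> (\<forall>M \<in># \<M>. perfect_matching petersen M) \<and>
               isomorphic G (add_matchings petersen \<M>))}"
    then obtain \<M> where "multigraph G" "size \<M> = r - 3" "\<And>M. M \<in># \<M> \<Longrightarrow> perfect_matching petersen M"
      "isomorphic G (add_matchings petersen \<M>)" by blast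
    then show "G \<in> S" using isomorphic_petersen_plus[of G \<M>] unfolding S_def by simp
  qed
  ultimately show ?thesis by simp
qed

end
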